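(* There is an (explicit) algorithm which, starting from an extended Farey symbol $\mathcal F=(\mathcal V,*,\mu_{ell})$ with group $\Gamma$, constructs a normalized extended Farey symbol $\mathcal F^{norm}$ with the same group $\Gamma$.
   Context: Notation. $\mathcal H$ is the Poincaré upper half-plane and $\mathcal H^*=\mathcal H\sqcup\mathbb P^1(\mathbb Q)$. For distinct $r,s\in\mathbb P^1(\mathbb Q)$, $a=(r,s)$ is the oriented geodesic arc in $\mathcal H^*$ from $r$ to $s$, $\overline a=(s,r)$ is the opposite arc, and $A_a=\begin{pmatrix} x_a & y_a \\ z_a & t_a \end{pmatrix}\in M_2(\mathbb Z)$ is the matrix, unique up to sign, with $\det A_a>0$, $r=x_a/z_a$, $s=y_a/t_a$, $\gcd(x_a,z_a)=\gcd(y_a,t_a)=1$. Put $A_a^-=A_a\begin{pmatrix} 0 & -1 \\ 1 & 0 \end{pmatrix}$, which represents $\overline a$. Extended Farey symbol: a triple $(\mathcal V,*,\mu_{ell})$ consisting of: (F1) an oriented convex hyperbolic polygon whose vertices $r_1,\dots,r_n$ are in $\mathbb P^1(\mathbb Q)$; its boundary is the sequence $\mathcal V$ of consecutive arcs $a_1=(r_1,r_2),\ a_2=(r_2,r_3),\dots,a_n=(r_n,r_1)$, considered up to cyclic permutation, and one of the $a_i$ is assumed to be the arc $(\infty,0)$; (F2) an involution $a\mapsto a^*$ of $\mathcal V$; (F3) a map $\mu_{ell}:\mathcal V_{ell}\to\{2,3\}$, where $\mathcal V_{ell}$ is the set of fixed points of $*$; such that (F4) each of the following gluing matrices $\gamma_a$,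 $a\in\mathcal V$, lies in $\mathrm{SL}_2(\mathbb Z)$: $\gamma_a=A_a(A_{a^*}^-)^{-1}$ if $a\notin\mathcal V_{ell}$; $\gamma_a=A_a(A_a^-)^{-1}$ if $a\in\mathcal V_{ell}$ and $\mu_{ell}(a)=2$; $\gamma_a=A_a^-\begin{pmatrix} 0 & -1 \\ 1 & -1 \end{pmatrix}(A_a^-)^{-1}$ if $a\in\mathcal V_{ell}$ and $\mu_{ell}(a)=3$. The group of the symbol is the subgroup $\Gamma\subset\mathrm{PSL}_2(\mathbb Z)$ generated by the $\gamma_a$, $a\in\mathcal V$. The distance on $\mathcal V=(a_1,\dots,a_n)$ is the cyclic distance $d(a_i,a_j)=\min(|i-j|,\,n-|i-j|)$. Two distinct elements $a,b\in\mathcal V$ are linked if the four arcs $a,b,a^*,b^*$ occur in $\mathcal V$, up to cyclic permutation, in the order $a,b,a^*,b^*$ or $a,b^*,a^*,b$. The symbol is normalized if for every $a\in\mathcal V$ one has $d(a,a^* )\le 2$, with equality if and only if $a$ is linked to another element. *)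

theory Defs
  imports
    "HOL-Analysis.Analysis"
    "HOL-Algebra.Generated_Groups"
    "HOL-Library.Sublist"
    "HOL-Library.Nat_Bijection"
begin

section \<open>Cusps and arcs\<close>

datatype cusp = Inf_cusp | Fin_cusp rat

text \<open>The point \<open>(p : q)\<close> of the projective line, for \<open>(p, q) \<noteq> (0, 0)\<close>.\<close>

definition cusp_of :: "int \<Rightarrow> int \<Rightarrow> cusp" where
  "cusp_of p q = (if q = 0 then Inf_cusp else Fin_cusp (Fract p q))"

type_synonym arc = "cusp \<times> cusp"

fun cusp_less :: "cusp \<Rightarrow> cusp \<Rightarrow> bool" where
  "cusp_less (Fin_cusp p) (Fin_cusp q) \<longleftrightarrow> p < q"
| "cusp_less (Fin_cusp p) Inf_cusp \<longleftrightarrow> True"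
| "cusp_less Inf_cusp c \<longleftrightarrow> False"

text \<open>
  \<open>left_of (r, s) v\<close> says that the boundary point \<open>v\<close> lies strictly to the left of the geodesic
  from \<open>r\<close> to \<open>s\<close>, i.e. that \<open>r, s, v\<close> are distinct and follow each other in the positive
  (counterclockwise) direction on the boundary circle of the upper half-plane. For instance the
  points to the left of the arc from \<open>\<infinity>\<close> to \<open>0\<close> are the positive rationals.
\<close>

fun left_of :: "arc \<Rightarrow> cusp \<Rightarrow> bool" where
  "left_of (r, s) v \<longleftrightarrow>
     (cusp_less r s \<and> cusp_less s v) \<or>
     (cusp_less s v \<and> cusp_less v r) \<or>
     (cusp_less v r \<and> cusp_less r s)"

section \<open>Matrices\<close>

definition mat2 :: "rat \<Rightarrow> rat \<Rightarrow> rat \<Rightarrow> rat \<Rightarrow> rat^2^2" where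
  "mat2 a b c d = vector [vector [a, b], vector [c, d]]"

definition is_arc_matrix :: "arc \<Rightarrow> rat^2^2 \<Rightarrow> bool" where
  "is_arc_matrix a A \<longleftrightarrow>
     (\<exists>x y z t :: int.
        A = mat2 (of_int x) (of_int y) (of_int z) (of_int t) \<and> det A > 0 \<and>
        coprime x z \<and> coprime y t \<and> fst a = cusp_of x z \<and> snd a = cusp_of y t)"

text \<open>
  For an arc with distinct end points the matrix is unique up to sign; the sign chosen is
  irrelevant below, since gluing matrices are only used modulo \<open>\<plusminus>1\<close>.
\<close>

definition arc_mat :: "arc \<Rightarrow> rat^2^2" where
  "arc_mat a = (SOME A. is_arc_matrix a A)"

definition arc_mat_minus :: "arc \<Rightarrow> rat^2^2" where
  "arc_mat_minus a = arc_mat a ** mat2 0 (-1) 1 0"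

definition SL2Z :: "(rat^2^2) monoid" where
  "SL2Z = \<lparr>carrier = {M. (\<forall>i j. M $ i $ j \<in> \<int>) \<and> det M = 1}, mult = (**), one = mat 1\<rparr>"

definition centre_SL2Z :: "(rat^2^2) set" where
  "centre_SL2Z = {mat 1, - mat 1}"

definition PSL2Z :: "(rat^2^2) set monoid" where
  "PSL2Z = SL2Z Mod centre_SL2Z"

definition PSL_class :: "rat^2^2 \<Rightarrow> (rat^2^2) set" where
  "PSL_class M = centre_SL2Z #>\<^bsub>SL2Z\<^esub> M"

section \<open>Extended Farey symbols\<close>

text \<open>
  The maps \<open>star\<close> and \<open>mu_ell\<close> are only relevant on the boundary arcs, respectively on the
  boundary arcs fixed by \<open>star\<close>.
\<close>

record farey_data =
  vertices :: "cusp list"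
  star :: "arc \<Rightarrow> arc"
  mu_ell :: "arc \<Rightarrow> nat"

definition polygon_sides :: "cusp list \<Rightarrow> arc list" where
  "polygon_sides rs = map (\<lambda>i. (rs ! i, rs ! (Suc i mod length rs))) [0..<length rs]"

text \<open>
  Convexity with positive orientation: the vertices other than its end points lie to the left of
  each side. The degenerate polygon with two vertices is admitted: it is needed for the group
  \<open>PSL\<^sub>2(\<int>)\<close> itself, whose symbol consists of the two elliptic arcs \<open>(\<infinity>, 0)\<close> and \<open>(0, \<infinity>)\<close>.
\<close>

definition convex_ideal_polygon :: "cusp list \<Rightarrow> bool" where
  "convex_ideal_polygon rs \<longleftrightarrow>
     2 \<le> length rs \<and> distinct rs \<and>
     (\<forall>a \<in> set (polygon_sides rs). \<forall>v \<in> set rs. v \<noteq> fst a \<and> v \<noteq> snd a \<longrightarrow> left_of a v)"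

definition arcs :: "farey_data \<Rightarrow> arc list" where
  "arcs F = polygon_sides (vertices F)"

definition ell_arcs :: "farey_data \<Rightarrow> arc set" where
  "ell_arcs F = {a \<in> set (arcs F). star F a = a}"

definition gluing_mat :: "farey_data \<Rightarrow> arc \<Rightarrow> rat^2^2" where
  "gluing_mat F a =
     (if a \<notin> ell_arcs F then arc_mat a ** matrix_inv (arc_mat_minus (star F a))
      else if mu_ell F a = 2 then arc_mat a ** matrix_inv (arc_mat_minus a)
      else arc_mat_minus a ** mat2 0 (-1) 1 (-1) ** matrix_inv (arc_mat_minus a))"

definition extended_farey_symbol :: "farey_data \<Rightarrow> bool" where
  "extended_farey_symbol F \<longleftrightarrow>
     convex_ideal_polygon (vertices F) \<and>
     (cusp_of 1 0, cusp_of 0 1) \<in> set (arcs F) \<and>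
     (\<forall>a \<in> set (arcs F). star F a \<in> set (arcs F) \<and> star F (star F a) = a) \<and>
     (\<forall>a \<in> ell_arcs F. mu_ell F a \<in> {2, 3}) \<and>
     (\<forall>a \<in> set (arcs F). gluing_mat F a \<in> carrier SL2Z)"

definition symbol_group :: "farey_data \<Rightarrow> (rat^2^2) set set" where
  "symbol_group F = generate PSL2Z ((\<lambda>a. PSL_class (gluing_mat F a)) ` set (arcs F))"

section \<open>Normalized symbols\<close>

definition arc_index :: "farey_data \<Rightarrow> arc \<Rightarrow> nat" where
  "arc_index F a = (THE i. i < length (arcs F) \<and> arcs F ! i = a)"

definition arc_dist :: "farey_data \<Rightarrow> arc \<Rightarrow> arc \<Rightarrow> int" where
  "arc_dist F a b =
     (let k = \<bar>int (arc_index F a) - int (arc_index F b)\<bar> in min k (int (length (arcs F)) - k))"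

definition in_cyclic_order :: "'a list \<Rightarrow> 'a list \<Rightarrow> bool" where
  "in_cyclic_order ys xs \<longleftrightarrow> (\<exists>k. subseq ys (rotate k xs))"

definition linked :: "farey_data \<Rightarrow> arc \<Rightarrow> arc \<Rightarrow> bool" where
  "linked F a b \<longleftrightarrow>
     a \<noteq> b \<and>
     (in_cyclic_order [a, b, star F a, star F b] (arcs F) \<or>
      in_cyclic_order [a, star F b, star F a, b] (arcs F))"

definition normalized :: "farey_data \<Rightarrow> bool" where
  "normalized F \<longleftrightarrow>
     (\<forall>a \<in> set (arcs F).
        arc_dist F a (star F a) \<le> 2 \<and>
        (arc_dist F a (star F a) = 2 \<longleftrightarrow> (\<exists>b \<in> set (arcs F). linked F a b)))"

section \<open>Algorithms\<close>

text \<open>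
  The partial recursive functions on the natural numbers, generated from the basic functions by
  pairing, composition, primitive recursion and unbounded minimization; functions of several
  arguments are coded by \<open>prod_encode\<close>.
\<close>

definition minimize :: "(nat \<Rightarrow> nat option) \<Rightarrow> nat \<Rightarrow> nat \<Rightarrow> bool" where
  "minimize f x n \<longleftrightarrow>
     f (prod_encode (x, n)) = Some 0 \<and> (\<forall>m<n. \<exists>k. f (prod_encode (x, m)) = Some (Suc k))"

inductive partial_recursive :: "(nat \<Rightarrow> nat option) \<Rightarrow> bool" where
  zero: "partial_recursive (\<lambda>_. Some 0)"
| succ: "partial_recursive (\<lambda>n. Some (Suc n))"
| left: "partial_recursive (\<lambda>n. Some (fst (prod_decode n)))"
| right: "partial_recursive (\<lambda>n. Some (snd (prod_decode n)))"
| pair: "partial_recursive f \<Longrightarrow> partial_recursive g \<Longrightarrow>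
    partial_recursive
      (\<lambda>n. Option.bind (f n) (\<lambda>a. Option.bind (g n) (\<lambda>b. Some (prod_encode (a, b)))))"
| comp: "partial_recursive f \<Longrightarrow> partial_recursive g \<Longrightarrow>
    partial_recursive (\<lambda>n. Option.bind (g n) f)"
| prec: "partial_recursive f \<Longrightarrow> partial_recursive g \<Longrightarrow>
    partial_recursive
      (\<lambda>p. rec_nat (f (fst (prod_decode p)))
         (\<lambda>m r. Option.bind r
            (\<lambda>y. g (prod_encode (fst (prod_decode p), prod_encode (m, y)))))
         (snd (prod_decode p)))"
| mini: "partial_recursive f \<Longrightarrow>
    partial_recursive
      (\<lambda>x. if \<exists>n. minimize f x n then Some (THE n. minimize f x n) else None)"

text \<open>
  Symbols are handed to an algorithm as the list of triples \<open>(a, a\<^sup>*, m)\<close>, with \<open>a\<close> running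
  through the boundary in order, where \<open>m\<close> is \<open>\<mu>\<^bsub>ell\<^esub>(a)\<close> if \<open>a\<close> is elliptic and \<open>0\<close>
  otherwise. This list determines the symbol.
\<close>

fun cusp_code :: "cusp \<Rightarrow> nat" where
  "cusp_code Inf_cusp = prod_encode (int_encode 1, int_encode 0)"
| "cusp_code (Fin_cusp q) =
     prod_encode (int_encode (fst (quotient_of q)), int_encode (snd (quotient_of q)))"

definition arc_code :: "arc \<Rightarrow> nat" where
  "arc_code a = prod_encode (cusp_code (fst a), cusp_code (snd a))"

definition symbol_code :: "farey_data \<Rightarrow> nat" where
  "symbol_code F = list_encode (map
     (\<lambda>a. prod_encode (arc_code a, prod_encode (arc_code (star F a),
            if a \<in> ell_arcs F then mu_ell F a else 0))) (arcs F))"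

end

theory Submission
  imports Defs
begin

text \<open>
  The boundary of the polygon is a cyclic word with an involution on its letters. Cutting off the
  triangle on two adjacent sides \<open>b\<close>, \<open>c\<close> and gluing it back along \<open>b\<close> changes neither the group
  nor the convexity of the polygon, and it cyclically rotates the part of the word between \<open>b\<close> and
  \<open>b\<^sup>*\<close>. Words \<open>e\<close>, \<open>a a\<^sup>*\<close> and \<open>a b a\<^sup>* b\<^sup>*\<close> can be moved past every letter by such slides, and
  an adjacent or linked pair can be brought into one of these forms; splitting them off one after
  the other normalizes the word. Since \<open>(\<infinity>, 0)\<close> must remain a side, nothing is ever slid over the
  letter \<open>o\<close> of that side. If only \<open>o\<close> obstructs the reduction, the remaining word is \<open>o\<close>, \<open>o o\<^sup>*\<close>
  or \<open>a o a\<^sup>* o\<^sup>*\<close>, which is normalized as well. The algorithm searches through all sequences of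
  slides until the word is a product of such blocks.
\<close>

section \<open>Computable functions\<close>

text \<open>The base side restricts only the letter along which a triangle is glued, since that side
  is replaced by a diagonal. The base side may itself be the side \<open>c\<close> that is carried
  along: it then moves by an element of the group, and translating the whole polygon back conjugates
  the group by one of its own elements. Hence \<open>move\<close> forbids \<open>b\<close> and
  \<open>mate b\<close> to be \<open>base\<close> but allows \<open>c\<close> to be. Termination
  comes from existence: the unbounded search halts as soon as some sequence of slides succeeds, and
  that is a statement about words alone. Illegal moves act as the identity, so whatever sequence the
  search meets first is sound as well. Gluing matrices are guessed and tested by integer arithmetic,
  which avoids gcds and division; integrality is automatic, because they are only multiplied by each
  other and by adjugates. The price is bookkeeping of signs: \<open>arc_mat\<close> is an arbitrary
  choice, so gluing matrices matter only up to sign and are compared through their action on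
  cusps.\<close>

class encodable =
  fixes enc :: "'a \<Rightarrow> nat"
  assumes enc_eq_iff: "enc x = enc y \<longleftrightarrow> x = y"

instantiation nat :: encodable
begin
definition enc_nat :: "nat \<Rightarrow> nat" where "enc_nat n = n"
instance by standard (simp add: enc_nat_def)
end

instantiation int :: encodable
begin
definition enc_int :: "int \<Rightarrow> nat" where "enc_int i = int_encode i"
instance by standard (simp add: enc_int_def int_encode_eq)
end

instantiation bool :: encodable
begin
definition enc_bool :: "bool \<Rightarrow> nat" where "enc_bool b = (if b then 1 else 0)"
instance by standard (simp add: enc_bool_def)
end

instantiation prod :: (encodable, encodable) encodable
begin
definition enc_prod :: "'a \<times> 'b \<Rightarrow> nat" where "enc_prod p = prod_encode (enc (fst p), enc (snd p))"
instance by standard (auto simp: enc_prod_def enc_eq_iff prod_eq_iff)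
end

text \<open>Chosen to agree with \<open>list_encode\<close>, so that \<open>enc\<close> of the list
  of triples of a symbol is literally its \<open>symbol_code\<close>.\<close>

instantiation list :: (encodable) encodable
begin
definition enc_list :: "'a list \<Rightarrow> nat" where "enc_list xs = list_encode (map enc xs)"
instance
proof
  fix xs ys :: "'a list"
  have "inj (enc :: 'a \<Rightarrow> nat)" by (rule injI) (simp add: enc_eq_iff)
  then show "enc xs = enc ys \<longleftrightarrow> xs = ys"
    by (simp add: enc_list_def inj_map_eq_map list_encode_eq)
qed
end

lemma enc_Pair [simp]: "enc (x, y) = prod_encode (enc x, enc y)"
  by (simp add: enc_prod_def)

lemma enc_Nil [simp]: "enc ([] :: 'a::encodable list) = 0"
  by (simp add: enc_list_def)

lemma enc_Cons [simp]: "enc (x # xs) = Suc (prod_encode (enc x, enc xs))"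
  by (simp add: enc_list_def)

lemma enc_nat_id [simp]: "enc (n :: nat) = n"
  by (simp add: enc_nat_def)

text \<open>Unbounded search steps through all numbers, so every number has to code a candidate
  witness. Only the type that is searched must satisfy this; it fails for \<open>bool\<close>, so it
  is kept out of the class.\<close>

lemma surj_enc_nat: "surj (enc :: nat \<Rightarrow> nat)"
  by (auto simp: surj_def)

lemma surj_enc_int: "surj (enc :: int \<Rightarrow> nat)"
  by (metis enc_int_def int_decode_inverse surjI)

lemma surj_enc_prod:
  assumes "surj (enc :: 'a::encodable \<Rightarrow> nat)" "surj (enc :: 'b::encodable \<Rightarrow> nat)"
  shows "surj (enc :: 'a \<times> 'b \<Rightarrow> nat)"
  unfolding surj_def
proof
  fix n
  obtain x :: 'a where x: "fst (prod_decode n) = enc x" using assms(1) by (metis surj_def)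
  obtain y :: 'b where y: "snd (prod_decode n) = enc y" using assms(2) by (metis surj_def)
  have "n = enc (x, y)" by (metis enc_Pair x y prod.collapse prod_decode_inverse)
  then show "\<exists>p :: 'a \<times> 'b. n = enc p" by blast
qed

lemma surj_enc_list:
  assumes "surj (enc :: 'a::encodable \<Rightarrow> nat)"
  shows "surj (enc :: 'a list \<Rightarrow> nat)"
  unfolding surj_def
proof
  fix n
  have "\<exists>xs :: 'a list. map enc xs = list_decode n"
    using assms by (metis ex_map_conv surj_def)
  then obtain xs :: "'a list" where "map enc xs = list_decode n" by blast
  then have "n = enc xs" by (simp add: enc_list_def)
  then show "\<exists>p :: 'a list. n = enc p" by blast
qed

section \<open>Total recursive functions and computability through codes\<close>

definition total_recursive :: "(nat \<Rightarrow> nat) \<Rightarrow> bool" where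
  "total_recursive f \<longleftrightarrow> partial_recursive (\<lambda>n. Some (f n))"

lemma total_recursive_comp:
  "total_recursive f \<Longrightarrow> total_recursive g \<Longrightarrow> total_recursive (\<lambda>n. f (g n))"
  unfolding total_recursive_def using partial_recursive.comp[of "\<lambda>n. Some (f n)" "\<lambda>n. Some (g n)"]
    by simp

lemma total_recursive_pair:
  "total_recursive f \<Longrightarrow> total_recursive g \<Longrightarrow> total_recursive (\<lambda>n. prod_encode (f n, g n))"
  unfolding total_recursive_def using partial_recursive.pair[of "\<lambda>n. Some (f n)" "\<lambda>n. Some (g n)"]
    by simp

lemma total_recursive_fst: "total_recursive (\<lambda>n. fst (prod_decode n))"
  unfolding total_recursive_def by (rule partial_recursive.left)

lemma total_recursive_snd: "total_recursive (\<lambda>n. snd (prod_decode n))"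
  unfolding total_recursive_def by (rule partial_recursive.right)

lemma total_recursive_id: "total_recursive (\<lambda>n. n)"
  using total_recursive_pair[OF total_recursive_fst total_recursive_snd] by simp

lemma total_recursive_const: "total_recursive (\<lambda>n. k)"
proof (induction k)
  case 0
  show ?case unfolding total_recursive_def by (rule partial_recursive.zero)
next
  case (Suc k)
  then show ?case
    unfolding total_recursive_def using partial_recursive.comp[OF partial_recursive.succ, of
      "\<lambda>n. Some k"] by simp
qed

text \<open>The scheme \<open>prec\<close> works with options; as both ingredients are total, no
  stage of the recursion is \<open>None\<close>.\<close>

lemma total_recursive_rec:
  assumes "total_recursive f" "total_recursive g"
  shows "total_recursive (\<lambda>p. rec_nat (f (fst (prod_decode p)))
    (\<lambda>m y. g (prod_encode (fst (prod_decode p), prod_encode (m, y)))) (snd (prod_decode p)))"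
proof -
  have eq: "rec_nat (Some (f a)) (\<lambda>m r. Option.bind r
    (\<lambda>y. Some (g (prod_encode (a, prod_encode (m, y)))))) n
      = Some (rec_nat (f a) (\<lambda>m y. g (prod_encode (a, prod_encode (m, y)))) n)" for a n
    by (induction n) auto
  show ?thesis
    using partial_recursive.prec[OF assms[unfolded total_recursive_def]]
    unfolding total_recursive_def eq .
qed

text \<open>Nothing is demanded of \<open>g\<close> off the range of \<open>enc\<close>.\<close>

definition computable :: "('a::encodable \<Rightarrow> 'b::encodable) \<Rightarrow> bool" where
  "computable f \<longleftrightarrow> (\<exists>g. total_recursive g \<and> (\<forall>x. g (enc x) = enc (f x)))"

lemma computableI: "total_recursive g \<Longrightarrow> (\<And>x. g (enc x) = enc (f x)) \<Longrightarrow> computable f"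
  unfolding computable_def by blast

lemma computableE:
  assumes "computable f"
  obtains g where "total_recursive g" "\<And>x. g (enc x) = enc (f x)"
  using assms unfolding computable_def by blast

lemma computable_nat_iff: "computable (f :: nat \<Rightarrow> nat) \<longleftrightarrow> total_recursive f"
proof
  assume "computable f"
  then obtain g where "total_recursive g" "\<And>x. g (enc x) = enc (f x)" by (rule computableE) blast
  then have "g = f" by (simp add: fun_eq_iff)
  then show "total_recursive f" using \<open>total_recursive g\<close> by simp
qed (auto intro: computableI)

text \<open>For functions that are obtained by arithmetic on the code itself.\<close>

lemma computable_via_code:
  "computable (g :: nat \<Rightarrow> nat) \<Longrightarrow> (\<And>x. g (enc x) = enc (f x)) \<Longrightarrow> computable f"
  unfolding computable_nat_iff by (rule computableI)

named_theorems computable_intros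

lemma computable_id [computable_intros]: "computable (\<lambda>x. x)"
  by (rule computableI[OF total_recursive_id]) simp

lemma computable_const [computable_intros]: "computable (\<lambda>x. c)"
  by (rule computableI[OF total_recursive_const]) simp

lemma computable_comp:
  assumes "computable f" "computable g"
  shows "computable (\<lambda>x. f (g x))"
proof -
  from assms obtain f' g' where "total_recursive f'" "\<And>x. f' (enc x) = enc (f x)"
    "total_recursive g'" "\<And>x. g' (enc x) = enc (g x)"
    by (meson computableE)
  then show ?thesis by (intro computableI[OF total_recursive_comp[of f' g']]) auto
qed

lemma computable_Pair [computable_intros]:
  assumes "computable f" "computable g"
  shows "computable (\<lambda>x. (f x, g x))"
proof -
  from assms obtain f' g' where "total_recursive f'" "\<And>x. f' (enc x) = enc (f x)"
    "total_recursive g'" "\<And>x. g' (enc x) = enc (g x)"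
    by (meson computableE)
  then show ?thesis by (intro computableI[OF total_recursive_pair[of f' g']]) auto
qed

lemma computable_fst [computable_intros]: "computable f \<Longrightarrow> computable (\<lambda>x. fst (f x))"
proof -
  have "computable (fst :: 'b \<times> 'c \<Rightarrow> 'b)"
    by (rule computableI[OF total_recursive_fst]) (auto simp: enc_prod_def)
  then show "computable f \<Longrightarrow> computable (\<lambda>x. fst (f x))" by (rule computable_comp)
qed

lemma computable_snd [computable_intros]: "computable f \<Longrightarrow> computable (\<lambda>x. snd (f x))"
proof -
  have "computable (snd :: 'b \<times> 'c \<Rightarrow> 'c)"
    by (rule computableI[OF total_recursive_snd]) (auto simp: enc_prod_def)
  then show "computable f \<Longrightarrow> computable (\<lambda>x. snd (f x))" by (rule computable_comp)
qed

lemma computable_comp2: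
  assumes "computable (\<lambda>p. f (fst p) (snd p))" "computable g" "computable h"
  shows "computable (\<lambda>x. f (g x) (h x))"
  using computable_comp[OF assms(1) computable_Pair[OF assms(2,3)]] by simp

lemma computable_comp3:
  assumes "computable (\<lambda>p. f (fst p) (fst (snd p)) (snd (snd p)))" "computable g" "computable h"
    "computable k"
  shows "computable (\<lambda>x. f (g x) (h x) (k x))"
  using computable_comp[OF assms(1) computable_Pair[OF assms(2) computable_Pair[OF assms(3,4)]]] by
    simp

lemma computable_rec_nat [computable_intros]:
  assumes "computable f" "computable (\<lambda>p. h (fst p) (fst (snd p)) (snd (snd p)))" "computable n"
  shows "computable (\<lambda>x. rec_nat (f x) (h x) (n x))"
proof -
  from assms obtain f' h' n' where *: "total_recursive f'" "\<And>x. f' (enc x) = enc (f x)"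
    "total_recursive h'" "\<And>x. h' (enc x) = enc (h (fst x) (fst (snd x)) (snd (snd x)))"
    "total_recursive n'" "\<And>x. n' (enc x) = enc (n x)"
    by (meson computableE)
  have "rec_nat (f' (enc x)) (\<lambda>m y. h' (prod_encode (enc x, prod_encode (m, y)))) k
      = enc (rec_nat (f x) (h x) k)" for x k
  proof (induction k)
    case (Suc k)
    then show ?case using *(4)[of "(x, k, rec_nat (f x) (h x) k)"] by simp
  qed (use * in simp)
  then show ?thesis
    using *(6) by (intro computableI[OF total_recursive_comp[OF total_recursive_rec[OF *(1,3)]
            total_recursive_pair[OF total_recursive_id *(5)]]]) simp
qed

lemma computable_enc [computable_intros]: "computable f \<Longrightarrow> computable (\<lambda>x. enc (f x))"
  unfolding computable_def by auto

lemma computable_Suc [computable_intros]: "computable f \<Longrightarrow> computable (\<lambda>x. Suc (f x))"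
proof -
  have "computable Suc"
    unfolding computable_nat_iff total_recursive_def by (rule partial_recursive.succ)
  then show "computable f \<Longrightarrow> computable (\<lambda>x. Suc (f x))" by (rule computable_comp)
qed

text \<open>Primitive recursion on the code of the condition, which is \<open>0\<close> or
  \<open>1\<close>: the step is taken exactly when the condition holds.\<close>

lemma computable_If [computable_intros]:
  assumes "computable c" "computable f" "computable g"
  shows "computable (\<lambda>x. if c x then f x else g x)"
proof -
  have "computable (\<lambda>x. rec_nat (g x) (\<lambda>_ _. f x) (enc (c x)))"
    by (intro computable_intros assms computable_comp[OF assms(2)])
  also have "(\<lambda>x. rec_nat (g x) (\<lambda>_ _. f x) (enc (c x))) = (\<lambda>x. if c x then f x else g x)"
    by (auto simp: fun_eq_iff enc_bool_def)
  finally show ?thesis .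
qed

lemma computable_Not [computable_intros]:
  assumes "computable f"
  shows "computable (\<lambda>x. \<not> f x)"
proof -
  have "computable (\<lambda>x. if f x then False else True)" by (intro computable_intros assms)
  also have "(\<lambda>x. if f x then False else True) = (\<lambda>x. \<not> f x)" by auto
  finally show ?thesis .
qed

lemma computable_conj [computable_intros]:
  assumes "computable f" "computable g"
  shows "computable (\<lambda>x. f x \<and> g x)"
proof -
  have "computable (\<lambda>x. if f x then g x else False)" by (intro computable_intros assms)
  also have "(\<lambda>x. if f x then g x else False) = (\<lambda>x. f x \<and> g x)" by auto
  finally show ?thesis .
qed

lemma computable_disj [computable_intros]:
  assumes "computable f" "computable g"
  shows "computable (\<lambda>x. f x \<or> g x)"
proof -
  have "computable (\<lambda>x. if f x then True else g x)" by (intro computable_intros assms)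
  also have "(\<lambda>x. if f x then True else g x) = (\<lambda>x. f x \<or> g x)" by auto
  finally show ?thesis .
qed

section \<open>Arithmetic on natural numbers and integers\<close>

lemma computable_add [computable_intros]:
  fixes f :: "'a::encodable \<Rightarrow> nat"
  assumes "computable f" "computable g"
  shows "computable (\<lambda>x. f x + g x)"
proof -
  have "computable (\<lambda>x. rec_nat (f x) (\<lambda>_ y. Suc y) (g x))"
    by (intro computable_intros assms)
  moreover have "rec_nat a (\<lambda>_ y. Suc y) b = a + b" for a b
    by (induction b) auto
  ultimately show ?thesis by simp
qed

lemma computable_mult [computable_intros]:
  fixes f :: "'a::encodable \<Rightarrow> nat"
  assumes "computable f" "computable g"
  shows "computable (\<lambda>x. f x * g x)"
proof -
  have "computable (\<lambda>x. rec_nat 0 (\<lambda>_ y. f x + y) (g x))"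
    by (intro computable_intros assms computable_comp[OF assms(1)])
  moreover have "rec_nat 0 (\<lambda>_ y. a + y) b = a * b" for a b :: nat
    by (induction b) auto
  ultimately show ?thesis by simp
qed

lemma computable_pred: "computable f \<Longrightarrow> computable (\<lambda>x. f x - Suc 0)"
proof -
  assume f: "computable f"
  have "computable (\<lambda>x. rec_nat 0 (\<lambda>m _. m) (f x))"
    by (intro computable_intros f)
  moreover have "rec_nat 0 (\<lambda>m _. m) b = b - Suc 0" for b :: nat
    by (induction b) auto
  ultimately show ?thesis by simp
qed

lemma computable_diff [computable_intros]:
  fixes f :: "'a::encodable \<Rightarrow> nat"
  assumes "computable f" "computable g"
  shows "computable (\<lambda>x. f x - g x)"
proof -
  have "computable (\<lambda>x. rec_nat (f x) (\<lambda>_ y. y - Suc 0) (g x))"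
    by (intro computable_intros assms computable_pred)
  moreover have "rec_nat a (\<lambda>_ y. y - Suc 0) b = a - b" for a b
    by (induction b) auto
  ultimately show ?thesis by simp
qed

text \<open>The sum of the two truncated differences of the codes vanishes iff the codes agree, and
  \<open>enc\<close> is injective.\<close>

lemma computable_eq [computable_intros]:
  assumes "computable f" "computable g"
  shows "computable (\<lambda>x. f x = g x)"
proof -
  have "computable (\<lambda>x. rec_nat True (\<lambda>_ _. False)
    ((enc (f x) - enc (g x)) + (enc (g x) - enc (f x))))"
    by (intro computable_intros assms)
  also have "(\<lambda>x. rec_nat True (\<lambda>_ _. False) ((enc (f x) - enc (g x)) + (enc (g x) - enc (f x))))
      = (\<lambda>x. f x = g x)"
  proof
    fix x
    have R: "rec_nat True (\<lambda>_ _. False) k = (k = 0)" for k by (cases k) auto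
    show "rec_nat True (\<lambda>_ _. False) ((enc (f x) - enc (g x)) + (enc (g x) - enc (f x))) =
      (f x = g x)"
      unfolding R enc_eq_iff[of "f x" "g x", symmetric] by auto
  qed
  finally show ?thesis .
qed

lemma computable_half: "computable (\<lambda>n::nat. n div 2)"
proof -
  \<comment> \<open>The counter \<open>y\<close> advances exactly when the next argument is the even
    number \<open>2 * Suc y\<close>.\<close>
  have "computable (\<lambda>n::nat. rec_nat 0 (\<lambda>m y. if Suc m = 2 * Suc y then Suc y else y) n)"
    by (intro computable_intros)
  moreover have "rec_nat 0 (\<lambda>m y. if Suc m = 2 * Suc y then Suc y else y) n = n div 2" for n :: nat
    by (induction n) auto
  ultimately show ?thesis by simp
qed

lemma computable_nat [computable_intros]: "computable f \<Longrightarrow> computable (\<lambda>x. nat (f x))"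
proof -
  have "computable nat"
  proof (rule computable_via_code)
    \<comment> \<open>\<open>int_encode\<close> sends \<open>i\<close> to the even number
      \<open>2 * i\<close> if \<open>i\<close> is nonnegative, and to the odd number
      \<open>2 * (- i - 1) + 1\<close> otherwise.\<close>
    show "computable (\<lambda>n::nat. if n = 2 * (n div 2) then n div 2 else 0)"
      by (intro computable_intros computable_comp[OF computable_half])
  qed (auto simp: enc_int_def int_encode_def sum_encode_def)
  then show "computable f \<Longrightarrow> computable (\<lambda>x. nat (f x))" by (rule computable_comp)
qed

lemma computable_nat_uminus: "computable f \<Longrightarrow> computable (\<lambda>x. nat (- f x))"
proof -
  have "computable (\<lambda>i. nat (- i))"
  proof (rule computable_via_code)
    show "computable (\<lambda>n::nat. if n = 2 * (n div 2) then 0 else Suc (n div 2))"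
      by (intro computable_intros computable_comp[OF computable_half])
  qed (auto simp: enc_int_def int_encode_def sum_encode_def)
  then show "computable f \<Longrightarrow> computable (\<lambda>x. nat (- f x))" by (rule computable_comp)
qed

text \<open>Integer arithmetic reduces to natural numbers: arguments are split into positive and
  negative parts, and the result is reassembled as a difference.\<close>

lemma computable_int_diff:
  assumes "computable f" "computable g"
  shows "computable (\<lambda>x. int (f x) - int (g x))"
proof -
  have "computable (\<lambda>x. if g x - f x = 0 then 2 * (f x - g x) else Suc (2 * (g x - f x - 1)))"
    by (intro computable_intros assms)
  then obtain g' where "total_recursive g'"
    "\<And>x. g' (enc x) = (if g x - f x = 0 then 2 * (f x - g x) else Suc (2 * (g x - f x - 1)))"
    by (auto elim: computableE)
  then show ?thesis
    by (intro computableI[of g']) (auto simp: enc_int_def int_encode_def sum_encode_def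
      nat_diff_distrib)
qed

lemma computable_int_add [computable_intros]:
  fixes f :: "'a::encodable \<Rightarrow> int"
  assumes "computable f" "computable g"
  shows "computable (\<lambda>x. f x + g x)"
proof -
  have "computable (\<lambda>x. int (nat (f x) + nat (g x)) - int (nat (- f x) + nat (- g x)))"
    by (intro computable_intros computable_int_diff computable_nat_uminus assms)
  moreover have "int (nat a + nat b) - int (nat (- a) + nat (- b)) = a + b" for a b by simp
  ultimately show ?thesis by simp
qed

lemma computable_int_uminus [computable_intros]:
  fixes f :: "'a::encodable \<Rightarrow> int"
  assumes "computable f"
  shows "computable (\<lambda>x. - f x)"
proof -
  have "computable (\<lambda>x. int (nat (- f x)) - int (nat (f x)))"
    by (intro computable_intros computable_int_diff computable_nat_uminus assms)
  moreover have "int (nat (- a)) - int (nat a) = - a" for a by simp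
  ultimately show ?thesis by simp
qed

lemma computable_int_minus [computable_intros]:
  fixes f :: "'a::encodable \<Rightarrow> int"
  assumes "computable f" "computable g"
  shows "computable (\<lambda>x. f x - g x)"
  using computable_int_add[OF assms(1) computable_int_uminus[OF assms(2)]] by simp

lemma computable_int_mult [computable_intros]:
  fixes f :: "'a::encodable \<Rightarrow> int"
  assumes "computable f" "computable g"
  shows "computable (\<lambda>x. f x * g x)"
proof -
  have "computable (\<lambda>x. int (nat (f x) * nat (g x) + nat (- f x) * nat (- g x))
      - int (nat (f x) * nat (- g x) + nat (- f x) * nat (g x)))"
    by (rule computable_int_diff) (intro computable_intros computable_nat_uminus assms)+
  moreover have "int (nat a * nat b + nat (- a) * nat (- b))
      - int (nat a * nat (- b) + nat (- a) * nat b) = a * b" for a b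
    by (cases "a \<ge> 0"; cases "b \<ge> 0") (auto simp: algebra_simps)
  ultimately show ?thesis by simp
qed

lemma computable_int_less [computable_intros]:
  fixes f :: "'a::encodable \<Rightarrow> int"
  assumes "computable f" "computable g"
  shows "computable (\<lambda>x. f x < g x)"
proof -
  have "computable (\<lambda>x. \<not> nat (g x - f x) = 0)"
    by (intro computable_intros assms)
  then show ?thesis by (simp add: not_le)
qed

section \<open>Lists and folds\<close>

lemma computable_Cons [computable_intros]:
  assumes "computable f" "computable g"
  shows "computable (\<lambda>x. f x # g x)"
proof -
  from assms obtain f' g' where "total_recursive f'" "\<And>x. f' (enc x) = enc (f x)"
    "total_recursive g'" "\<And>x. g' (enc x) = enc (g x)"
    by (meson computableE)
  moreover have "total_recursive Suc"
    unfolding total_recursive_def by (rule partial_recursive.succ)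
  ultimately show ?thesis
    by (intro computableI[OF total_recursive_comp[OF _ total_recursive_pair[of f' g']]]) auto
qed

lemma computable_case_list [computable_intros]:
  assumes "computable l" "computable f" "computable (\<lambda>p. g (fst p) (fst (snd p)) (snd (snd p)))"
  shows "computable (\<lambda>x. case l x of [] \<Rightarrow> f x | y # ys \<Rightarrow> g x y ys)"
proof -
  from assms obtain f' g' l' where *: "total_recursive f'" "\<And>x. f' (enc x) = enc (f x)"
    "total_recursive g'" "\<And>x. g' (enc x) = enc (g (fst x) (fst (snd x)) (snd (snd x)))"
    "total_recursive l'" "\<And>x. l' (enc x) = enc (l x)"
    by (meson computableE)
  have "total_recursive (\<lambda>n. g' (prod_encode (n, l' n - Suc 0)))"
    using *(5) computable_pred[of l']
    by (intro total_recursive_comp[OF *(3)] total_recursive_pair total_recursive_id)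
      (simp add: computable_nat_iff)
  \<comment> \<open>Code \<open>0\<close> is the empty list; otherwise the predecessor of the code
    is already the code of the pair of head and tail, so pairing it with the code of
    \<open>x\<close> yields the argument triple of \<open>g\<close>.\<close>
  then have "computable (\<lambda>n. if l' n = 0 then f' n else g' (prod_encode (n, l' n - Suc 0)))"
    using * by (intro computable_intros) (simp_all add: computable_nat_iff)
  then show ?thesis
  proof (rule computable_via_code)
    fix x
    show "(if l' (enc x) = 0 then f' (enc x) else g' (prod_encode (enc x, l' (enc x) - Suc 0)))
        = enc (case l x of [] \<Rightarrow> f x | y # ys \<Rightarrow> g x y ys)"
    proof (cases "l x")
      case (Cons y ys)
      then show ?thesis using *(6)[of x] *(4)[of "(x, y, ys)"] by simp
    qed (use * in simp)
  qed
qed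

lemma length_le_enc: "length xs \<le> enc (xs :: 'a::encodable list)"
proof (induction xs)
  case (Cons x xs)
  then show ?case using le_prod_encode_2[of "enc xs" "enc x"] by simp
qed simp

lemma computable_foldl [computable_intros]:
  assumes h: "computable (\<lambda>p. h (fst p) (fst (snd p)) (snd (snd p)))"
    and a: "computable a" and l: "computable l"
  shows "computable (\<lambda>x. foldl (h x) (a x) (l x))"
proof -
  define step where "step x s = (case snd s of [] \<Rightarrow> s | y # ys \<Rightarrow> (h x (fst s) y, ys))" for x s
  \<comment> \<open>The code of a list bounds its length, so this many iterations consume the whole
    list; surplus iterations are idle on the empty list.\<close>
  have "computable (\<lambda>x. fst (rec_nat (a x, l x) (\<lambda>_ s. step x s) (enc (l x))))"
    unfolding step_def by (intro computable_intros a l computable_comp3[OF h])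
  also have "(\<lambda>x. fst (rec_nat (a x, l x) (\<lambda>_ s. step x s) (enc (l x)))) =
    (\<lambda>x. foldl (h x) (a x) (l x))"
  proof
    fix x
    have *: "length ys \<le> n \<Longrightarrow> rec_nat (c, ys) (\<lambda>_ s. step x s) n = (foldl (h x) c ys, [])" for c ys n
    proof (induction n arbitrary: c ys)
      case (Suc n)
      have shift: "rec_nat s (\<lambda>_ s. step x s) (Suc n) = rec_nat (step x s) (\<lambda>_ s. step x s) n" for s
        n
        by (induction n) auto
      show ?case
      proof (cases ys)
        case Nil
        then show ?thesis using Suc.IH[of ys c] by (simp add: step_def)
      next
        case (Cons z zs)
        then have "step x (c, ys) = (h x c z, zs)" by (simp add: step_def)
        then show ?thesis unfolding shift using Suc Cons by simp
      qed
    qed simp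
    show "fst (rec_nat (a x, l x) (\<lambda>_ s. step x s) (enc (l x))) = foldl (h x) (a x) (l x)"
      using *[OF length_le_enc] by simp
  qed
  finally show ?thesis .
qed

lemma computable_rev [computable_intros]:
  assumes "computable l"
  shows "computable (\<lambda>x. rev (l x))"
proof -
  have "computable (\<lambda>x. foldl (\<lambda>acc y. y # acc) [] (l x))"
    by (intro computable_intros assms)
  moreover have "foldl (\<lambda>acc y. y # acc) acc ys = rev ys @ acc" for acc ys :: "'b list"
    by (induction ys arbitrary: acc) auto
  ultimately show ?thesis by simp
qed

lemma computable_foldr [computable_intros]:
  assumes "computable (\<lambda>p. h (fst p) (fst (snd p)) (snd (snd p)))" "computable a" "computable l"
  shows "computable (\<lambda>x. foldr (h x) (l x) (a x))"
proof -
  have "computable (\<lambda>p. (\<lambda>acc y. h (fst p) y acc) (fst (snd p)) (snd (snd p)))"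
    using computable_comp[OF assms(1),
        of "\<lambda>p. (fst p, snd (snd p), fst (snd p))"] by (simp add: computable_intros)
  then have "computable (\<lambda>x. foldl (\<lambda>acc y. h x y acc) (a x) (rev (l x)))"
    by (intro computable_intros assms)
  then show ?thesis by (simp add: foldr_conv_foldl)
qed

lemma computable_append [computable_intros]:
  assumes "computable f" "computable g"
  shows "computable (\<lambda>x. f x @ g x)"
proof -
  have "computable (\<lambda>x. foldr (\<lambda>y acc. y # acc) (f x) (g x))"
    by (intro computable_intros assms)
  moreover have "foldr (\<lambda>y acc. y # acc) xs ys = xs @ ys" for xs ys :: "'b list"
    by (induction xs) auto
  ultimately show ?thesis by simp
qed

lemma computable_map [computable_intros]:
  assumes "computable (\<lambda>p. h (fst p) (snd p))" "computable l"
  shows "computable (\<lambda>x. map (h x) (l x))"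
proof -
  have "computable (\<lambda>x. foldr (\<lambda>y acc. h x y # acc) (l x) [])"
    by (intro computable_intros assms computable_comp2[OF assms(1)])
  moreover have "foldr (\<lambda>y acc. h x y # acc) ys [] = map (h x) ys" for x ys
    by (induction ys) auto
  ultimately show ?thesis by simp
qed

lemma computable_concat [computable_intros]:
  assumes "computable l"
  shows "computable (\<lambda>x. concat (l x))"
proof -
  have "computable (\<lambda>x. foldr (\<lambda>y acc. y @ acc) (l x) [])"
    by (intro computable_intros assms)
  moreover have "foldr (\<lambda>y acc. y @ acc) ys [] = concat ys" for ys :: "'b list list"
    by (induction ys) auto
  ultimately show ?thesis by simp
qed

text \<open>Unbounded minimization for the decidable \<open>P\<close>, followed by evaluating
  \<open>f\<close> at the input and the witness found. The witness is the one of least code, about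
  which nothing is claimed except that it satisfies \<open>P\<close>.\<close>

lemma partial_recursive_search:
  fixes P :: "'a::encodable \<Rightarrow> 'b::encodable \<Rightarrow> bool" and f :: "'a \<Rightarrow> 'b \<Rightarrow> 'c::encodable"
  assumes P: "computable (\<lambda>p. P (fst p) (snd p))" and f: "computable (\<lambda>p. f (fst p) (snd p))"
    and surj: "surj (enc :: 'b \<Rightarrow> nat)"
  shows "\<exists>alg. partial_recursive alg \<and>
    (\<forall>x. (\<exists>y. P x y) \<longrightarrow> (\<exists>y. P x y \<and> alg (enc x) = Some (enc (f x y))))"
proof -
  \<comment> \<open>\<open>minimize\<close> looks for a zero and \<open>False\<close> is coded by
    \<open>0\<close>, so the search runs on the negation of \<open>P\<close>.\<close>
  from computable_Not[OF P] obtain p' where p': "total_recursive p'"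
    "\<And>x. p' (enc x) = enc (\<not> P (fst x) (snd x))" by (rule computableE) blast
  from f obtain f' where f': "total_recursive f'"
    "\<And>x. f' (enc x) = enc (f (fst x) (snd x))" by (rule computableE) blast
  define q where "q = (\<lambda>n. Some (p' n))"
  define srch where "srch = (\<lambda>x. if \<exists>n. minimize q x n then Some (THE n. minimize q x n) else None)"
  define alg where "alg = (\<lambda>n. Option.bind (Option.bind (Some n) (\<lambda>a. Option.bind (srch n)
    (\<lambda>b. Some (prod_encode (a, b))))) (\<lambda>n. Some (f' n)))"
  have "partial_recursive srch"
    unfolding srch_def using p'(1) by (intro partial_recursive.mini)
      (simp add: q_def total_recursive_def)
  then have "partial_recursive alg"
    unfolding alg_def using f'(1) total_recursive_id
    by (intro partial_recursive.comp partial_recursive.pair) (simp_all add: total_recursive_def)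
  moreover have "\<exists>y. P x y \<and> alg (enc x) = Some (enc (f x y))" if "\<exists>y. P x y" for x
  proof -
    have p0: "p' (prod_encode (enc x, enc y)) = 0 \<longleftrightarrow> P x y" for y
      using p'(2)[of "(x, y)"] by (simp add: enc_bool_def)
    define n where "n = (LEAST n. p' (prod_encode (enc x, n)) = 0)"
    have n: "p' (prod_encode (enc x, n)) = 0"
      unfolding n_def using that p0 by (metis (mono_tags, lifting) LeastI)
    have n_less: "p' (prod_encode (enc x, m)) \<noteq> 0" if "m < n" for m
      using that not_less_Least unfolding n_def by blast
    have "minimize q (enc x) m \<longleftrightarrow> m = n" for m
      using n n_less unfolding minimize_def q_def
      by (metis (no_types, lifting) linorder_neqE_nat nat.distinct(1) not0_implies_Suc
        option.inject)
    then have min: "minimize q (enc x) = (\<lambda>m. m = n)" by (simp add: fun_eq_iff)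
    obtain y :: 'b where y: "n = enc y" using surj by (metis surj_def)
    have "srch (enc x) = Some n" by (simp add: srch_def min)
    then have "alg (enc x) = Some (enc (f x y))"
      using f'(2)[of "(x, y)"] by (simp add: alg_def y)
    moreover have "P x y" using n y p0 by simp
    ultimately show ?thesis by blast
  qed
  ultimately show ?thesis by blast
qed

section \<open>Side pairings as words\<close>

text \<open>
  Words stand for the boundary of a polygon, and \<open>mate\<close> for the pairing of its sides. A \<open>slide\<close>
  cuts off the triangle spanned by the adjacent sides \<open>b\<close>, \<open>c\<close> and glues it back along \<open>b\<close>; the
  letter \<open>b\<close> then denotes the new diagonal. A \<open>spin\<close> is the same operation at a side folded onto
  itself. The letter \<open>base\<close> is never slid over, because the side \<open>(\<infinity>, 0)\<close> has to survive.
\<close>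

locale side_pairing =
  fixes mate :: "'l \<Rightarrow> 'l" and base :: 'l
begin

inductive move :: "'l list \<Rightarrow> 'l list \<Rightarrow> bool" where
  rot: "move (x # w) (w @ [x])"
| slide: "mate b \<noteq> b \<Longrightarrow> b \<noteq> base \<Longrightarrow> mate b \<noteq> base \<Longrightarrow>
    move (b # c # X @ mate b # Y) (b # X @ c # mate b # Y)"
| spin: "mate e = e \<Longrightarrow> e \<noteq> base \<Longrightarrow> move (e # c # X) (c # e # X)"

abbreviation reach :: "'l list \<Rightarrow> 'l list \<Rightarrow> bool" where
  "reach \<equiv> move\<^sup>*\<^sup>*"

text \<open>The words that yield normalized symbols. Unlike the blocks that are split off during the
  reduction, these may contain \<open>base\<close>.\<close>

inductive blocks :: "'l list \<Rightarrow> bool" where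
  Nil: "blocks []"
| ell: "mate e = e \<Longrightarrow> blocks w \<Longrightarrow> blocks (e # w)"
| pair: "mate a \<noteq> a \<Longrightarrow> blocks w \<Longrightarrow> blocks (a # mate a # w)"
| handle: "mate a \<noteq> a \<Longrightarrow> mate b \<noteq> b \<Longrightarrow> blocks w \<Longrightarrow> blocks (a # b # mate a # mate b # w)"

definition slider :: "'l \<Rightarrow> bool" where
  "slider b \<longleftrightarrow> mate b \<noteq> b \<and> b \<noteq> base \<and> mate b \<noteq> base \<and> mate (mate b) = b"

lemma slider_inv: "slider b \<Longrightarrow> slider (mate b)"
  by (auto simp: slider_def)

lemma reach_rotate: "reach (X @ Y) (Y @ X)"
proof (induction X arbitrary: Y)
  case (Cons x X)
  have "move (x # X @ Y) (X @ Y @ [x])"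
    using move.rot[of x "X @ Y"] by simp
  with Cons[of "Y @ [x]"] show ?case by (auto intro: converse_rtranclp_into_rtranclp)
qed simp

lemma reach_mset: "reach w w' \<Longrightarrow> set w' = set w \<and> (distinct w' \<longleftrightarrow> distinct w) \<and> length w' = length w"
proof (induction rule: rtranclp_induct)
  case (step y z)
  from step(2) have "set z = set y \<and> (distinct z \<longleftrightarrow> distinct y) \<and> length z = length y"
    by cases auto
  with step(3) show ?case by simp
qed simp

text \<open>Each letter of \<open>U\<close> in turn is sent to the far end of the segment between
  \<open>b\<close> and \<open>mate b\<close>, so the two parts of that segment trade places.\<close>

lemma reach_slide_head:
  assumes "slider b"
  shows "reach (b # U @ X @ mate b # Y) (b # X @ U @ mate b # Y)"
proof (induction U arbitrary: X)
  case (Cons c U)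
  have "move (b # c # (U @ X) @ mate b # Y) (b # (U @ X) @ c # mate b # Y)"
    using assms by (intro move.slide) (auto simp: slider_def)
  moreover have "reach (b # U @ (X @ [c]) @ mate b # Y) (b # (X @ [c]) @ U @ mate b # Y)"
    by (rule Cons)
  ultimately show ?case by (auto intro: converse_rtranclp_into_rtranclp)
qed simp

lemma reach_slide:
  assumes "slider b"
  shows "reach (A @ b # U @ X @ mate b # Y) (A @ b # X @ U @ mate b # Y)"
proof -
  have "reach (A @ b # U @ X @ mate b # Y) (b # U @ X @ mate b # Y @ A)"
    using reach_rotate[of A "b # U @ X @ mate b # Y"] by simp
  also have "reach (b # U @ X @ mate b # Y @ A) (b # X @ U @ mate b # Y @ A)"
    by (rule reach_slide_head[OF assms])
  also have "reach (b # X @ U @ mate b # Y @ A) (A @ b # X @ U @ mate b # Y)"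
    using reach_rotate[of "b # X @ U @ mate b # Y" A] by simp
  finally show ?thesis .
qed

text \<open>Free words commute with every letter, so they can be split off before an induction.\<close>

definition free :: "'l list \<Rightarrow> bool" where
  "free B \<longleftrightarrow> (\<forall>x Z. reach (B @ x # Z) (x # B @ Z))"

text \<open>Slides and spins act at the head of the word, so \<open>B\<close> can be parked at the
  far end meanwhile. Freeness enters for rotations: the first letter has to get past
  \<open>B\<close> before it can go to the end.\<close>

lemma free_reach:
  assumes B: "free B" and "reach W W'"
  shows "reach (B @ W) (B @ W')"
  using assms(2)
proof (induction rule: rtranclp_induct)
  case (step y z)
  have to_end: "reach (B @ y) (y @ B)" and to_front: "reach (z @ B) (B @ z)"
    by (rule reach_rotate)+
  from step(2) have "reach (B @ y) (B @ z)"
  proof cases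
    case (rot x w)
    have "reach (B @ x # w) (x # B @ w)" using B by (auto simp: free_def)
    also have "reach (x # B @ w) (B @ w @ [x])"
      using reach_rotate[of "[x]" "B @ w"] by simp
    finally show ?thesis using rot by simp
  next
    case (slide b c X Y)
    have "move (y @ B) (z @ B)"
      using move.slide[of b c X "Y @ B"] slide by simp
    with to_end to_front show ?thesis by (meson converse_rtranclp_into_rtranclp rtranclp_trans)
  next
    case (spin e c X)
    have "move (y @ B) (z @ B)"
      using move.spin[of e c "X @ B"] spin by simp
    with to_end to_front show ?thesis by (meson converse_rtranclp_into_rtranclp rtranclp_trans)
  qed
  with step(3) show ?case by simp
qed simp

lemma free_ell: "mate e = e \<Longrightarrow> e \<noteq> base \<Longrightarrow> free [e]"
  by (auto simp: free_def intro: move.spin)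

text \<open>Read cyclically from \<open>mate a\<close>, everything outside the pair lies between
  \<open>mate a\<close> and \<open>a\<close>; sliding along \<open>mate a\<close> turns
  \<open>x Z\<close> into \<open>Z x\<close>, which puts \<open>x\<close> just before
  \<open>a\<close>.\<close>

lemma free_pair:
  assumes "slider a"
  shows "free [a, mate a]"
  unfolding free_def
proof (intro allI)
  fix x Z
  have "reach ([a, mate a] @ x # Z) (mate a # [x] @ Z @ mate (mate a) # [])"
    using reach_rotate[of "[a]" "mate a # x # Z"] assms by (simp add: slider_def)
  also have "reach \<dots> (mate a # Z @ [x] @ mate (mate a) # [])"
    by (rule reach_slide_head[OF slider_inv[OF assms]])
  also have "reach \<dots> (x # [a, mate a] @ Z)"
    using reach_rotate[of "mate a # Z" "[x, a]"] assms by (simp add: slider_def)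
  finally show "reach ([a, mate a] @ x # Z) (x # [a, mate a] @ Z)" .
qed

text \<open>Four slides along \<open>mate b\<close>, \<open>a\<close>, \<open>b\<close>,
  \<open>mate a\<close> carry \<open>x\<close> from behind \<open>mate b\<close> to between
  \<open>a\<close> and \<open>b\<close>, then between \<open>b\<close> and \<open>mate a\<close>,
  then between \<open>mate a\<close> and \<open>mate b\<close>, and finally to the front of
  \<open>a\<close>.\<close>

lemma free_handle:
  assumes a: "slider a" and b: "slider b"
  shows "free [a, b, mate a, mate b]"
  unfolding free_def
proof (intro allI)
  fix x Z
  have [simp]: "mate (mate a) = a" "mate (mate b) = b" using a b by (auto simp: slider_def)
  have "reach ([a, b, mate a, mate b] @ x # Z)
    (mate b # [x] @ (Z @ [a]) @ mate (mate b) # [mate a])"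
    using reach_rotate[of "[a, b, mate a]" "mate b # x # Z"] by simp
  also have "reach \<dots> (mate b # (Z @ [a]) @ [x] @ mate (mate b) # [mate a])"
    by (rule reach_slide_head[OF slider_inv[OF b]])
  also have "reach \<dots> (a # [x] @ [b] @ mate a # mate b # Z)"
    using reach_rotate[of "mate b # Z" "[a, x, b, mate a]"] by simp
  also have "reach \<dots> (a # [b] @ [x] @ mate a # mate b # Z)"
    by (rule reach_slide_head[OF a])
  also have "reach \<dots> (b # [x] @ [mate a] @ mate b # Z @ [a])"
    using reach_rotate[of "[a]" "[b, x, mate a, mate b] @ Z"] by simp
  also have "reach \<dots> (b # [mate a] @ [x] @ mate b # Z @ [a])"
    by (rule reach_slide_head[OF b])
  also have "reach \<dots> (mate a # [x] @ (mate b # Z) @ mate (mate a) # [b])"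
    using reach_rotate[of "[b]" "[mate a, x, mate b] @ Z @ [a]"] by simp
  also have "reach \<dots> (mate a # (mate b # Z) @ [x] @ mate (mate a) # [b])"
    by (rule reach_slide_head[OF slider_inv[OF a]])
  also have "reach \<dots> (x # [a, b, mate a, mate b] @ Z)"
    using reach_rotate[of "mate a # mate b # Z" "[x, a, b]"] by simp
  finally show "reach ([a, b, mate a, mate b] @ x # Z) (x # [a, b, mate a, mate b] @ Z)" .
qed

text \<open>The step of the classification of surfaces that collects a handle: slides along
  \<open>a\<close>, \<open>b\<close> and \<open>mate a\<close> close one after the other the gaps
  between consecutive letters of the handle. The other segments come out permuted, which does no
  harm.\<close>

lemma reach_handle:
  assumes a: "slider a" and b: "slider b"
  shows "reach (X0 @ a # X1 @ b # X2 @ mate a # X3 @ mate b # X4)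
    ([a, b, mate a, mate b] @ (X4 @ X0) @ X3 @ X2 @ X1)"
proof -
  have [simp]: "mate (mate a) = a" "mate (mate b) = b" using a b by (auto simp: slider_def)
  have "reach (X0 @ a # X1 @ b # X2 @ mate a # X3 @ mate b # X4)
      (a # X1 @ (b # X2) @ mate a # X3 @ mate b # X4 @ X0)"
    using reach_rotate[of X0 "a # X1 @ b # X2 @ mate a # X3 @ mate b # X4"] by simp
  also have "reach \<dots> (a # (b # X2) @ X1 @ mate a # X3 @ mate b # X4 @ X0)"
    by (rule reach_slide_head[OF a])
  also have "reach \<dots> ([a] @ b # (X2 @ X1) @ (mate a # X3) @ mate b # X4 @ X0)"
    by simp
  also have "reach \<dots> ([a] @ b # (mate a # X3) @ (X2 @ X1) @ mate b # X4 @ X0)"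
    by (rule reach_slide[OF b])
  also have "reach \<dots> (mate a # (X3 @ X2 @ X1) @ (mate b # X4 @ X0) @ mate (mate a) # [b])"
    using reach_rotate[of "[a, b]" "mate a # X3 @ X2 @ X1 @ mate b # X4 @ X0"] by simp
  also have "reach \<dots> (mate a # (mate b # X4 @ X0) @ (X3 @ X2 @ X1) @ mate (mate a) # [b])"
    by (rule reach_slide_head[OF slider_inv[OF a]])
  also have "reach \<dots> ([a, b, mate a, mate b] @ (X4 @ X0) @ X3 @ X2 @ X1)"
    using reach_rotate[of "mate a # mate b # X4 @ X0 @ X3 @ X2 @ X1" "[a, b]"] by simp
  finally show ?thesis .
qed

section \<open>Reduction of closed words to blocks\<close>

definition mate_closed :: "'l list \<Rightarrow> bool" where
  "mate_closed w \<longleftrightarrow> (\<forall>x\<in>set w. mate x \<in> set w \<and> mate (mate x) = x)"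

text \<open>The patterns from which a block without \<open>base\<close> can be split off. Handles
  may have gaps, which \<open>reach_handle\<close> closes; pairs must be adjacent.\<close>

definition reducible :: "'l list \<Rightarrow> bool" where
  "reducible w \<longleftrightarrow>
     (\<exists>e\<in>set w. mate e = e \<and> e \<noteq> base) \<or>
     (\<exists>a X Y. slider a \<and> w = X @ a # mate a # Y) \<or>
     (\<exists>a b X0 X1 X2 X3 X4. slider a \<and> slider b \<and>
        w = X0 @ a # X1 @ b # X2 @ mate a # X3 @ mate b # X4)"

lemma reducible_append:
  assumes "reducible w"
  shows "reducible (u @ w @ v)"
proof -
  consider e where "e \<in> set w" "mate e = e" "e \<noteq> base"
    | a X Y where "slider a" "w = X @ a # mate a # Y"
    | a b X0 X1 X2 X3 X4 where "slider a" "slider b"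
        "w = X0 @ a # X1 @ b # X2 @ mate a # X3 @ mate b # X4"
    using assms unfolding reducible_def by blast
  then show ?thesis
  proof cases
    case 1 then show ?thesis by (auto simp: reducible_def)
  next
    case 2
    then have "u @ w @ v = (u @ X) @ a # mate a # (Y @ v)" by simp
    then show ?thesis unfolding reducible_def using 2(1) by blast
  next
    case 3
    then have "u @ w @ v = (u @ X0) @ a # X1 @ b # X2 @ mate a # X3 @ mate b # (X4 @ v)" by simp
    then show ?thesis unfolding reducible_def using 3(1,2) by blast
  qed
qed

text \<open>Let \<open>X\<close> be the segment between the first letter \<open>c\<close> and its
  mate. If \<open>X\<close> is closed under \<open>mate\<close>, then either it is empty and
  \<open>c\<close> forms an adjacent pair, or induction applies to it. Otherwise some letter of
  \<open>X\<close> has its mate beyond \<open>mate c\<close> and interleaves with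
  \<open>c\<close>.\<close>

lemma mate_closed_reducible:
  assumes "mate_closed w" "w \<noteq> []" "distinct w" "base \<notin> set w"
  shows "reducible w"
  using assms
proof (induction "length w" arbitrary: w rule: less_induct)
  case less
  show ?case
  proof (cases "\<exists>e\<in>set w. mate e = e")
    case True
    then show ?thesis using less.prems by (auto simp: reducible_def)
  next
    case False
    have sl: "slider x" if "x \<in> set w" for x
      using that False less.prems by (auto simp: slider_def mate_closed_def)
    obtain c Z where w: "w = c # Z" using less.prems by (cases w) auto
    then have "mate c \<in> set Z" using less.prems False by (force simp: mate_closed_def)
    then obtain X Y where Z: "Z = X @ mate c # Y" by (meson split_list)
    show ?thesis
    proof (cases "mate_closed X")
      case True
      show ?thesis
      proof (cases "X = []")
        case True
        then have "w = [] @ c # mate c # Y" using w Z by simp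
        then show ?thesis unfolding reducible_def using sl[of c] by (metis w list.set_intros(1))
      next
        case False
        have "reducible X"
          using less.hyps[of X] True False less.prems w Z by auto
        then show ?thesis using reducible_append[of X "[c]" "mate c # Y"] w Z by simp
      qed
    next
      case nX: False
      then obtain d where d: "d \<in> set X" "mate d \<notin> set X"
        using less.prems(1) w Z by (auto simp: mate_closed_def)
      have dd: "mate (mate d) = d" "mate d \<in> set w" using less.prems(1) d w Z by
        (auto simp: mate_closed_def)
      have cc: "mate (mate c) = c" using less.prems(1) w by (auto simp: mate_closed_def)
      have "mate d \<noteq> c" using dd d less.prems(3) w Z by auto
      moreover have "mate d \<noteq> mate c" using dd cc d less.prems(3) w Z by
        (metis UnCI distinct.simps(2) set_append)
      ultimately have "mate d \<in> set Y" using dd d w Z by auto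
      then obtain Y1 Y2 where Y: "Y = Y1 @ mate d # Y2" by (meson split_list)
      obtain X1 X2 where X: "X = X1 @ d # X2" using d by (meson split_list)
      have "w = [] @ c # X1 @ d # X2 @ mate c # Y1 @ mate d # Y2" using w X Y Z by simp
      moreover have "slider c" "slider d" using sl w X Z by auto
      ultimately show ?thesis unfolding reducible_def by blast
    qed
  qed
qed

text \<open>\<open>B\<close> is closed under \<open>mate\<close>, so the remainder is closed too,
  and freeness of \<open>B\<close> keeps it out of the way when the remainder is reduced
  further.\<close>

lemma reducible_split:
  assumes "reducible w" "mate_closed w" "distinct w" "base \<in> set w"
  obtains B w' where "reach w (B @ w')" "free B" "\<And>v. blocks v \<Longrightarrow> blocks (B @ v)" "B \<noteq> []"
    "mate_closed B" "base \<notin> set B"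
proof -
  consider e where "e \<in> set w" "mate e = e" "e \<noteq> base"
    | a X Y where "slider a" "w = X @ a # mate a # Y"
    | a b X0 X1 X2 X3 X4 where "slider a" "slider b"
        "w = X0 @ a # X1 @ b # X2 @ mate a # X3 @ mate b # X4"
    using assms(1) unfolding reducible_def by blast
  then show ?thesis
  proof cases
    case 1
    then obtain X Y where "w = X @ e # Y" by (meson split_list)
    then have "reach w ([e] @ (Y @ X))" using reach_rotate[of X "e # Y"] by simp
    then show ?thesis
      using 1 by (intro that[of "[e]" "Y @ X"])
        (auto intro: free_ell blocks.ell simp: mate_closed_def)
  next
    case 2
    then have "reach w ([a, mate a] @ (Y @ X))" using reach_rotate[of X "a # mate a # Y"] by simp
    then show ?thesis
      using 2 by (intro that[of "[a, mate a]" "Y @ X"])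
        (auto intro: free_pair blocks.pair simp: mate_closed_def slider_def)
  next
    case 3
    then show ?thesis
      using reach_handle[of a b X0 X1 X2 X3 X4]
      by (intro that[of "[a, b, mate a, mate b]" "(X4 @ X0) @ X3 @ X2 @ X1"])
        (auto intro: free_handle blocks.handle simp: mate_closed_def slider_def)
  qed
qed

text \<open>
  A word that cannot be shortened by splitting off a block is one of \<open>o\<close>, \<open>o o\<^sup>*\<close>, \<open>a o\<^sup>* a\<^sup>* o\<close>,
  where \<open>o\<close> is the base letter.
\<close>

lemma reach_blocks_or_reducible:
  assumes "mate_closed w" "distinct w" "base \<in> set w"
  obtains v where "reach w v" "blocks v \<or> reducible v"
proof -
  obtain X Y where "w = X @ base # Y" using assms(3) by (meson split_list)
  define Z where "Z = Y @ X"
  have r: "reach w (base # Z)"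
    using reach_rotate[of X "base # Y"] \<open>w = _\<close> by (simp add: Z_def)
  have cl: "mate_closed (base # Z)" and di: "distinct (base # Z)"
    using assms \<open>w = _\<close> by (auto simp: Z_def mate_closed_def)
  show ?thesis
  proof (cases "mate base = base")
    case True
    have "mate_closed Z" using cl di True by (auto simp: mate_closed_def)
    then have "Z = [] \<or> reducible (base # Z)"
      using mate_closed_reducible[of Z] di reducible_append[of Z "[base]" "[]"] by auto
    moreover have "blocks [base]" using True by (intro blocks.intros)
    ultimately show ?thesis using that[OF r] by auto
  next
    case False
    define q where "q = mate base"
    have iq: "mate q = base" using cl by (auto simp: q_def mate_closed_def)
    have "q \<in> set Z" using cl False by (auto simp: q_def mate_closed_def)
    then obtain U V where Z: "Z = U @ q # V" by (meson split_list)
    \<comment> \<open>Away from the base letter and its mate, a letter fails to be a slider only by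
      being its own mate, and then it makes the word reducible.\<close>
    have sl: "slider x \<or> reducible (base # Z)" if "x \<in> set U \<union> set V" for x
      using that cl di iq Z q_def
      by (auto simp: slider_def mate_closed_def reducible_def)
    show ?thesis
    proof (cases "mate_closed U \<and> mate_closed V")
      case True
      show ?thesis
      proof (cases "U = [] \<and> V = []")
        case True
        then have "blocks (base # Z)" using Z False by (auto simp: q_def intro: blocks.intros)
        then show ?thesis using that[OF r] by simp
      next
        case False
        then have "reducible U \<or> reducible V"
          using True mate_closed_reducible[of U] mate_closed_reducible[of V] di Z by auto
        then have "reducible (base # Z)"
          using reducible_append[of U "[base]" "q # V"] reducible_append[of V "base # U @ [q]" "[]"]
            Z
          by auto
        then show ?thesis using that[OF r] by simp
      qed
    next
      case ncl: False
      have invU: "mate x \<in> set U \<union> set V \<and> mate (mate x) = x" if "x \<in> set U \<union> set V" for x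
      proof -
        have "mate (mate x) = x" "mate x = base \<or> mate x = q \<or> mate x \<in> set U \<union> set V"
          using that cl Z by (auto simp: mate_closed_def)
        moreover have "x \<noteq> base" "x \<noteq> q" using that di Z by auto
        ultimately show ?thesis using iq q_def by metis
      qed
      \<comment> \<open>If one of the segments is not closed under \<open>mate\<close>, some letter
        has its mate in the other one; \<open>a\<close> is the member of such a pair that lies in
        \<open>U\<close>.\<close>
      obtain a where a: "a \<in> set U" "mate a \<in> set V"
      proof -
        from ncl consider "\<not> mate_closed U" | "\<not> mate_closed V" by blast
        then show ?thesis
        proof cases
          case 1
          then obtain x where "x \<in> set U" "mate x \<notin> set U"
            using invU by (auto simp: mate_closed_def)
          then show ?thesis using invU that by blast
        next
          case 2
          then obtain x where "x \<in> set V" "mate x \<notin> set V"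
            using invU by (auto simp: mate_closed_def)
          then show ?thesis using invU[of x] that[of "mate x"] by auto
        qed
      qed
      show ?thesis
      proof (cases "reducible (base # Z)")
        case True
        then show ?thesis using that[OF r] by simp
      next
        case nred: False
        have sl: "slider x" if "x \<in> set U \<union> set V" for x using sl[OF that] nred by simp
        obtain U1 U2 where U: "U = U1 @ a # U2" using a by (meson split_list)
        obtain V1 V2 where V: "V = V1 @ mate a # V2" using a by (meson split_list)
        have sa: "slider a" and ia [simp]: "mate (mate a) = a"
          using sl[of a] a by (auto simp: slider_def)
        \<comment> \<open>\<open>a\<close> interleaves with the base letter, which is no slider, so
          \<open>reach_handle\<close> does not apply. Slides along \<open>a\<close> and
          \<open>mate a\<close> alone still gather the four letters up to the two segments
          \<open>P\<close> and \<open>Q\<close>.\<close>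
        have "reach (base # Z) ((base # U1) @ a # U2 @ (q # V1) @ mate a # V2)"
          using Z U V by simp
        also have "reach \<dots> ((base # U1) @ a # (q # V1) @ U2 @ mate a # V2)"
          by (rule reach_slide[OF sa])
        also have "reach \<dots> (mate a # V2 @ (base # U1) @ mate (mate a) # q # V1 @ U2)"
          using reach_rotate[of "base # U1 @ a # q # V1 @ U2" "mate a # V2"] by simp
        also have "reach \<dots> (mate a # (base # U1) @ V2 @ mate (mate a) # q # V1 @ U2)"
          by (rule reach_slide_head[OF slider_inv[OF sa]])
        finally have r2: "reach w (mate a # base # (U1 @ V2) @ a # q # (V1 @ U2))" (is "reach w ?v")
          using r by simp
        define P where "P = U1 @ V2"
        define Q where "Q = V1 @ U2"
        have UV: "set U \<union> set V = insert a (insert (mate a) (set P \<union> set Q))"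
          by (auto simp: P_def Q_def U V)
        have dP: "distinct (mate a # base # P @ a # q # Q)"
          using reach_mset[OF r2] assms(2) by (simp add: P_def Q_def)
        have invP: "mate x \<in> set P \<union> set Q" if "x \<in> set P \<union> set Q" for x
        proof -
          have "mate (mate x) = x" "mate x = a \<or> mate x = mate a \<or> mate x \<in> set P \<union> set Q"
            using invU[of x] that by (auto simp: UV)
          moreover have "x \<noteq> a" "x \<noteq> mate a" using that dP by auto
          ultimately show ?thesis by (metis ia)
        qed
        have "blocks ?v \<or> reducible ?v"
        proof (cases "mate_closed P")
          case False
          \<comment> \<open>A pair straddling \<open>P\<close> and \<open>Q\<close> interleaves with
            \<open>mate a\<close>, which gives a handle of two sliders.\<close>
          then obtain x where x: "x \<in> set P" "mate x \<notin> set P"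
            using invU UV by (auto simp: mate_closed_def)
          then have "mate x \<in> set Q" using invP by auto
          then obtain Q1 Q2 where Q: "Q = Q1 @ mate x # Q2" by (meson split_list)
          obtain P1 P2 where P: "P = P1 @ x # P2" using x by (meson split_list)
          have "?v = [] @ mate a # (base # P1) @ x # P2 @ mate (mate a) # (q # Q1) @ mate x # Q2"
            using P Q by (simp add: P_def Q_def)
          moreover have "slider x" "slider (mate a)" using sl UV x slider_inv[OF sa] by auto
          ultimately show ?thesis unfolding reducible_def by blast
        next
          case True
          have "mate_closed Q"
            unfolding mate_closed_def
          proof
            fix x assume x: "x \<in> set Q"
            have ii: "mate (mate x) = x" using invU[of x] x UV by auto
            have "mate x \<notin> set P" using True x ii dP by (auto simp: mate_closed_def)
            then show "mate x \<in> set Q \<and> mate (mate x) = x" using invP[of x] x ii by auto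
          qed
          show ?thesis
          proof (cases "P = [] \<and> Q = []")
            case True
            \<comment> \<open>Nothing is left to split off: the word is itself a handle, with the
              base letter in it.\<close>
            then have "?v = mate a # base # mate (mate a) # mate base # []"
              by (simp add: P_def Q_def q_def)
            moreover have "blocks (mate a # base # mate (mate a) # mate base # [])"
              using slider_inv[OF sa] False by (intro blocks.intros) (auto simp: slider_def)
            ultimately show ?thesis by simp
          next
            case False
            then have "reducible P \<or> reducible Q"
              using \<open>mate_closed P\<close> \<open>mate_closed Q\<close> mate_closed_reducible[of P]
                mate_closed_reducible[of Q] dP by auto
            then have "reducible ?v"
              using reducible_append[of P "[mate a, base]" "a # q # Q"]
                reducible_append[of Q "mate a # base # P @ [a, q]" "[]"]
              by (auto simp: P_def Q_def)
            then show ?thesis by simp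
          qed
        qed
        then show ?thesis using that[OF r2] by simp
      qed
    qed
  qed
qed

text \<open>Induction on the length: \<open>B\<close> is nonempty, and \<open>free_reach\<close>
  allows the remainder to be reduced behind it.\<close>

theorem reach_normal_form:
  assumes "mate_closed w" "distinct w" "base \<in> set w"
  shows "\<exists>v. reach w v \<and> blocks v"
  using assms
proof (induction "length w" arbitrary: w rule: less_induct)
  case less
  obtain u where u: "reach w u" "blocks u \<or> reducible u"
    using reach_blocks_or_reducible less.prems by blast
  show ?case
  proof (cases "blocks u")
    case False
    have cu: "mate_closed u" "distinct u" "base \<in> set u" "length u = length w"
      using reach_mset[OF u(1)] less.prems by (auto simp: mate_closed_def)
    obtain B w' where B: "reach u (B @ w')" "free B" "\<And>v. blocks v \<Longrightarrow> blocks (B @ v)" "B \<noteq> []"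
      "mate_closed B" "base \<notin> set B"
      using reducible_split[OF _ cu(1-3)] u False by blast
    have s: "set (B @ w') = set u" "distinct (B @ w')" "length (B @ w') = length w"
      using reach_mset[OF B(1)] cu by auto
    have "mate_closed w'"
      unfolding mate_closed_def
    proof
      fix x assume x: "x \<in> set w'"
      then have ii: "mate (mate x) = x" "mate x \<in> set B \<union> set w'" using cu(1) s by
        (auto simp: mate_closed_def)
      moreover have "mate x \<notin> set B" using B(5) x ii s by (auto simp: mate_closed_def)
      ultimately show "mate x \<in> set w' \<and> mate (mate x) = x" by simp
    qed
    moreover have "base \<in> set w'" "distinct w'" "length w' < length w"
      using s cu B by (auto simp: length_greater_0_conv[symmetric] simp del: length_greater_0_conv)
    ultimately obtain v where "reach w' v" "blocks v" using less.hyps by blast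
    with B u free_reach[OF B(2)] show ?thesis
      by (meson rtranclp_trans)
  qed (use u in auto)
qed

end

section \<open>Cusps, cyclic order and gluing matrices\<close>

type_synonym ivec = "int \<times> int"
type_synonym imat = "int \<times> int \<times> int \<times> int"

fun vdet :: "ivec \<Rightarrow> ivec \<Rightarrow> int" where
  "vdet (x, y) (x', y') = x * y' - y * x'"

fun mvec :: "imat \<Rightarrow> ivec \<Rightarrow> ivec" where
  "mvec (a, b, c, d) (x, y) = (a * x + b * y, c * x + d * y)"

fun mmul :: "imat \<Rightarrow> imat \<Rightarrow> imat" where
  "mmul (a, b, c, d) (a', b', c', d') = (a * a' + b * c', a * b' + b * d', c * a' + d * c', c * b' +
    d * d')"

text \<open>The adjugate, which is the inverse in determinant one and keeps all computations in the
  integers.\<close>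

fun madj :: "imat \<Rightarrow> imat" where
  "madj (a, b, c, d) = (d, - b, - c, a)"

fun mdet :: "imat \<Rightarrow> int" where
  "mdet (a, b, c, d) = a * d - b * c"

fun mtr :: "imat \<Rightarrow> int" where
  "mtr (a, b, c, d) = a + d"

fun cols :: "ivec \<Rightarrow> ivec \<Rightarrow> imat" where
  "cols (x, z) (y, t) = (x, y, z, t)"

definition nrm :: "ivec \<Rightarrow> ivec" where
  "nrm v = (if snd v < 0 \<or> snd v = 0 \<and> fst v < 0 then (- fst v, - snd v) else v)"

text \<open>Selects one of the two primitive vectors on a rational line: positive denominator, or
  \<open>(1, 0)\<close> for infinity. For finite cusps this is the output of
  \<open>quotient_of\<close>, so it matches \<open>cusp_code\<close>.\<close>

definition prim :: "ivec \<Rightarrow> bool" where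
  "prim v \<longleftrightarrow> coprime (fst v) (snd v) \<and> (snd v > 0 \<or> v = (1, 0))"

definition act :: "imat \<Rightarrow> ivec \<Rightarrow> ivec" where
  "act M v = nrm (mvec M v)"

lemma mdet_mmul [simp]: "mdet (mmul M N) = mdet M * mdet N"
  by (cases M; cases N) (simp add: algebra_simps)

lemma mdet_madj [simp]: "mdet (madj M) = mdet M"
  by (cases M) (simp add: algebra_simps)

lemma mtr_conj: "mtr (mmul (mmul M N) (madj M)) = mdet M * mtr N"
  by (cases M; cases N) (simp add: algebra_simps)

lemma mvec_mmul: "mvec (mmul M N) v = mvec M (mvec N v)"
  by (cases M; cases N; cases v) (simp add: algebra_simps)

lemma mvec_uminus: "mvec M (- v) = - mvec M v" "mvec (- M) v = - mvec M v"
  by (cases M; cases v; simp)+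

lemma mdet_uminus [simp]: "mdet (- M) = mdet M"
  by (cases M) simp

lemma vdet_mvec: "vdet (mvec M u) (mvec M v) = mdet M * vdet u v"
  by (cases M; cases u; cases v) (simp add: algebra_simps)

lemma vdet_uminus [simp]: "vdet (- u) v = - vdet u v" "vdet u (- v) = - vdet u v"
  by (cases u; cases v; simp)+

lemma vdet_self [simp]: "vdet u u = 0"
  by (cases u) simp

lemma vdet_swap: "vdet v u = - vdet u v"
  by (cases u; cases v) simp

lemma mvec_madj: "mdet M = 1 \<Longrightarrow> mvec (madj M) (mvec M v) = v"
proof (cases M; cases v)
  fix a b c d x y assume M: "M = (a, b, c, d)" and v: "v = (x, y)" and "mdet M = 1"
  then have *: "a * d = 1 + b * c" by simp
  have "d * (a * x + b * y) - b * (c * x + d * y) = (a * d - b * c) * x"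
    "a * (c * x + d * y) - c * (a * x + b * y) = (a * d - b * c) * y"
    by (simp_all add: algebra_simps)
  then show ?thesis using * M v by (simp add: algebra_simps)
qed

lemma nrm_cases: "nrm v = v \<or> nrm v = - v"
  by (cases v) (simp add: nrm_def)

lemma nrm_uminus [simp]: "nrm (- v) = nrm v"
  by (cases v) (auto simp: nrm_def)

lemma nrm_prim: "prim v \<Longrightarrow> nrm v = v"
  by (auto simp: nrm_def prim_def)

lemma act_uminus: "act (- M) = act M"
  by (simp add: fun_eq_iff act_def mvec_uminus)

lemma act_cases: "act M v = mvec M v \<or> act M v = - mvec M v"
  unfolding act_def by (rule nrm_cases)

lemma act_eqD: "act M u = v \<Longrightarrow> mvec M u = v \<or> mvec M u = - v"
  using act_cases[of M u] by auto

lemma prim_nrm: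
  assumes "coprime (fst v) (snd v)"
  shows "prim (nrm v)"
proof (cases v)
  case (Pair p q)
  with assms have "coprime p q" by simp
  moreover have "\<bar>p\<bar> = 1" if "q = 0" using that \<open>coprime p q\<close> by simp
  ultimately show ?thesis by (auto simp: Pair nrm_def prim_def)
qed

lemma prim_act:
  assumes "mdet M = 1" "prim v"
  shows "prim (act M v)"
proof -
  have "coprime (fst (mvec M v)) (snd (mvec M v))"
  proof (rule coprimeI)
    fix k assume k: "k dvd fst (mvec M v)" "k dvd snd (mvec M v)"
    have "k dvd fst (mvec (madj M) (mvec M v))" "k dvd snd (mvec (madj M) (mvec M v))"
      using k by (cases M; cases "mvec M v"; auto)+
    then have "k dvd fst v" "k dvd snd v" using mvec_madj[OF assms(1)] by auto
    then show "is_unit k" using assms(2) by (meson coprime_common_divisor prim_def)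
  qed
  then show ?thesis unfolding act_def by (rule prim_nrm)
qed

lemma act_mmul: "act (mmul M N) v = act M (act N v)"
  using act_cases[of N v] by (auto simp: act_def mvec_mmul mvec_uminus)

lemma act_madj: "mdet M = 1 \<Longrightarrow> prim v \<Longrightarrow> act (madj M) (act M v) = v"
  using act_mmul[of "madj M" M v] by (simp add: act_def mvec_mmul[symmetric])
    (simp add: mvec_mmul mvec_madj nrm_prim)

lemma madj_madj [simp]: "madj (madj M) = M"
  by (cases M) simp

lemma act_act_madj: "mdet M = 1 \<Longrightarrow> prim v \<Longrightarrow> act M (act (madj M) v) = v"
  using act_madj[of "madj M" v] by simp

lemma act_inj: "mdet M = 1 \<Longrightarrow> prim u \<Longrightarrow> prim v \<Longrightarrow> act M u = act M v \<longleftrightarrow> u = v"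
  by (metis act_madj)

definition cusp_vec :: "cusp \<Rightarrow> ivec" where
  "cusp_vec c = (case c of Inf_cusp \<Rightarrow> (1, 0) | Fin_cusp q \<Rightarrow> quotient_of q)"

definition vec_cusp :: "ivec \<Rightarrow> cusp" where
  "vec_cusp v = cusp_of (fst v) (snd v)"

lemma prim_cusp_vec [simp]: "prim (cusp_vec c)"
  by (cases c) (auto simp: cusp_vec_def prim_def quotient_of_coprime quotient_of_denom_pos
      intro: quotient_of_coprime[OF prod.collapse[symmetric]]
        quotient_of_denom_pos[OF prod.collapse[symmetric]])

lemma vec_cusp_cusp_vec [simp]: "vec_cusp (cusp_vec c) = c"
proof (cases c)
  case (Fin_cusp q)
  obtain a b where ab: "quotient_of q = (a, b)" by (cases "quotient_of q")
  then have "b > 0" "Fract a b = q"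
    using quotient_of_denom_pos[of q] quotient_of_div[of q a b] by
      (simp_all add: Fract_of_int_quotient)
  then show ?thesis using Fin_cusp ab by (simp add: vec_cusp_def cusp_vec_def cusp_of_def)
qed (simp add: vec_cusp_def cusp_vec_def cusp_of_def)

lemma cusp_vec_vec_cusp [simp]: "prim v \<Longrightarrow> cusp_vec (vec_cusp v) = v"
  by (cases v) (auto simp: vec_cusp_def cusp_vec_def cusp_of_def prim_def quotient_of_Fract
    normalize_def)

lemma vec_cusp_inject: "prim u \<Longrightarrow> prim v \<Longrightarrow> vec_cusp u = vec_cusp v \<longleftrightarrow> u = v"
  by (metis cusp_vec_vec_cusp)

lemma vec_cusp_uminus: "vec_cusp (- v) = vec_cusp v"
  by (cases v) (simp add: vec_cusp_def cusp_of_def eq_rat)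

lemma vec_cusp_nrm: "vec_cusp (nrm v) = vec_cusp v"
  using nrm_cases[of v] by (auto simp: vec_cusp_uminus)

section \<open>Cyclic order of cusps\<close>

lemma cusp_less_iff:
  assumes "prim u" "prim v"
  shows "cusp_less (vec_cusp u) (vec_cusp v) \<longleftrightarrow> vdet u v < 0"
  using assms
  by (cases u; cases v) (auto simp: prim_def vec_cusp_def cusp_of_def mult.commute)

lemma cusp_less_trans: "cusp_less a b \<Longrightarrow> cusp_less b c \<Longrightarrow> cusp_less a c"
  by (cases a; cases b; cases c) auto

lemma cusp_less_irrefl: "\<not> cusp_less a a"
  by (cases a) auto

lemma cusp_less_linear: "cusp_less a b \<or> a = b \<or> cusp_less b a"
  by (cases a; cases b) auto

text \<open>Every vector occurs in two factors, so the signs of the representatives cancel, and a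
  matrix of determinant one preserves each factor. Invariance under the group is thus immediate,
  which it is not for \<open>left_of\<close>.\<close>

definition ccw :: "ivec \<Rightarrow> ivec \<Rightarrow> ivec \<Rightarrow> bool" where
  "ccw u v w \<longleftrightarrow> vdet u v * vdet v w * vdet w u > 0"

lemma ccw_rotate: "ccw u v w \<longleftrightarrow> ccw v w u"
  by (simp add: ccw_def mult.commute mult.left_commute)

lemma ccw_distinct: "ccw u v w \<Longrightarrow> u \<noteq> v \<and> v \<noteq> w \<and> w \<noteq> u"
  by (auto simp: ccw_def)

lemma left_of_iff_ccw:
  assumes "prim u" "prim v" "prim w"
  shows "left_of (vec_cusp u, vec_cusp v) (vec_cusp w) \<longleftrightarrow> ccw u v w"
proof -
  define A B C where "A = vdet u v" and "B = vdet v w" and "C = vdet w u"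
  have lt: "cusp_less (vec_cusp u) (vec_cusp v) \<longleftrightarrow> A < 0"
    "cusp_less (vec_cusp v) (vec_cusp u) \<longleftrightarrow> A > 0"
    "cusp_less (vec_cusp v) (vec_cusp w) \<longleftrightarrow> B < 0" "cusp_less (vec_cusp w) (vec_cusp v) \<longleftrightarrow> B > 0"
    "cusp_less (vec_cusp w) (vec_cusp u) \<longleftrightarrow> C < 0" "cusp_less (vec_cusp u) (vec_cusp w) \<longleftrightarrow> C > 0"
    using assms by (simp_all add: cusp_less_iff A_def B_def C_def vdet_swap[of v u]
      vdet_swap[of w v] vdet_swap[of u w])
  \<comment> \<open>The product is positive when none or exactly two of the factors are negative.
    Transitivity rules out the former and makes two negative factors force a positive third
    one.\<close>
  have tr: "A < 0 \<Longrightarrow> B < 0 \<Longrightarrow> C > 0" "B < 0 \<Longrightarrow> C < 0 \<Longrightarrow> A > 0" "C < 0 \<Longrightarrow> A < 0 \<Longrightarrow> B > 0"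
    "A > 0 \<Longrightarrow> B > 0 \<Longrightarrow> C < 0"
    using cusp_less_trans unfolding lt[symmetric] by blast+
  have "A * B * C > 0 \<longleftrightarrow> (A < 0 \<and> B < 0) \<or> (B < 0 \<and> C < 0) \<or> (C < 0 \<and> A < 0)"
    using tr by (auto simp: zero_less_mult_iff mult_less_0_iff)
  then show ?thesis by (simp add: lt ccw_def A_def[symmetric] B_def[symmetric] C_def[symmetric])
qed

lemma ccw_act: 
  assumes "mdet M = 1"
  shows "ccw (act M u) (act M v) (act M w) \<longleftrightarrow> ccw u v w"
  using act_cases[of M u] act_cases[of M v] act_cases[of M w]
  by (auto simp: ccw_def vdet_mvec assms)

text \<open>The points occur in the cyclic order \<open>s\<close>, \<open>w\<close>,
  \<open>r\<close>, \<open>z\<close>; with the circle cut open at infinity this is transitivity of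
  the linear order of cusps.\<close>

lemma ccw_trans:
  assumes "prim s" "prim w" "prim r" "prim z" "ccw s w r" "ccw s r z"
  shows "ccw s w z" "ccw w r z"
proof -
  have "left_of (vec_cusp s, vec_cusp w) (vec_cusp r)"
    "left_of (vec_cusp s, vec_cusp r) (vec_cusp z)"
    using assms by (simp_all add: left_of_iff_ccw del: left_of.simps)
  then have "left_of (vec_cusp s, vec_cusp w) (vec_cusp z) \<and> left_of (vec_cusp w, vec_cusp r)
    (vec_cusp z)"
    using cusp_less_trans cusp_less_irrefl by (auto; blast)
  then show "ccw s w z" "ccw w r z"
    using assms by (simp_all add: left_of_iff_ccw del: left_of.simps)
qed

text \<open>Convexity in terms of all triples of vertices instead of sides: this form passes to
  subsequences, survives rotation and is easy to check when a vertex is inserted.\<close>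

definition ccw_list :: "ivec list \<Rightarrow> bool" where
  "ccw_list vs \<longleftrightarrow> (\<forall>x y z. subseq [x, y, z] vs \<longrightarrow> ccw x y z)"

lemma ccw_listD: "ccw_list vs \<Longrightarrow> subseq [x, y, z] vs \<Longrightarrow> ccw x y z"
  unfolding ccw_list_def by blast

lemma ccw_list_subseq: "ccw_list vs \<Longrightarrow> subseq us vs \<Longrightarrow> ccw_list us"
  unfolding ccw_list_def using subseq_order.order_trans by blast

lemma ccw_list_rotate1: "ccw_list (v # vs) \<Longrightarrow> ccw_list (vs @ [v])"
  unfolding ccw_list_def
proof (intro allI impI)
  fix x y z assume c: "\<forall>x y z. subseq [x, y, z] (v # vs) \<longrightarrow> ccw x y z" and s:
    "subseq [x, y, z] (vs @ [v])"
  show "ccw x y z"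
  proof (cases "subseq [x, y, z] vs")
    case True
    then show ?thesis using c by (meson list_emb_Cons)
  next
    case False
    from s obtain p q where pq: "[x, y, z] = p @ q" "subseq p vs" "subseq q [v]"
      by (meson subseq_appendE)
    then have "q \<noteq> []" using False by auto
    then have "q = [v]" using pq(3) by (cases q) (auto split: if_splits)
    then have "z = v" "subseq [x, y] vs" using pq by (auto simp: append_eq_Cons_conv)
    then have "subseq [v, x, y] (v # vs)" by simp
    then have "ccw v x y" using c by blast
    then show ?thesis using ccw_rotate[of v x y] \<open>z = v\<close> by simp
  qed
qed

lemma ccw_list_rotate: "ccw_list (us @ vs) \<Longrightarrow> ccw_list (vs @ us)"
proof (induction us arbitrary: vs)
  case (Cons u us)
  then show ?case using ccw_list_rotate1[of u "us @ vs"] Cons(1)[of "vs @ [u]"] by simp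
qed simp

text \<open>\<open>w\<close> lies on the boundary arc from \<open>s\<close> to its successor
  \<open>r\<close>, so transitivity based at \<open>s\<close> places it before all remaining
  vertices.\<close>

lemma ccw_list_insert:
  assumes "ccw_list (s # r # V)" "ccw s w r" "prim w" "\<forall>v\<in>set (s # r # V). prim v"
  shows "ccw_list (s # w # r # V)" "w \<notin> set (s # r # V)"
proof -
  have z: "ccw s w z \<and> (z \<noteq> r \<longrightarrow> ccw w r z)" if "z \<in> set (r # V)" for z
  proof (cases "z = r")
    case False
    then have "z \<in> set V" using that by auto
    then have "subseq [s, r, z] (s # r # V)" by (auto simp: subseq_singleton_left)
    then have "ccw s r z" by (rule ccw_listD[OF assms(1)])
    then show ?thesis using ccw_trans[of s w r z] assms that by auto
  qed (use assms in auto)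
  show "w \<notin> set (s # r # V)" using z ccw_distinct assms(2) by fastforce
  have yz: "ccw w y z" if "subseq [y, z] (r # V)" for y z
  proof -
    have "subseq [s, y, z] (s # r # V)" using that by simp
    then have c: "ccw s y z" by (rule ccw_listD[OF assms(1)])
    have "y \<in> set (r # V)" "z \<in> set (r # V)"
      using subseq_order.order_trans[OF _ that, of "[y]"]
        subseq_order.order_trans[OF _ that, of "[z]"]
      by (simp_all only: subseq_singleton_left) auto
    then show ?thesis using ccw_trans[of s w y z] z c assms by auto
  qed
  show "ccw_list (s # w # r # V)"
    unfolding ccw_list_def
  proof (intro allI impI)
    fix x y z' assume sub: "subseq [x, y, z'] (s # w # r # V)"
    show "ccw x y z'"
    proof (cases "subseq [x, y, z'] (s # r # V)")
      case True
      then show ?thesis by (rule ccw_listD[OF assms(1)])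
    next
      case False
      show ?thesis
      proof (cases "x = w")
        case True
        have "x \<noteq> s" using True assms(2) ccw_distinct by blast
        then have "subseq [y, z'] (r # V)" using sub True
          by (metis subseq_Cons2' subseq_Cons2_iff)
        then show ?thesis using yz True by simp
      next
        case nw: False
        show ?thesis
        proof (cases "x = s")
          case xs: True
          then have s2: "subseq [y, z'] (w # r # V)" using sub by simp
          show ?thesis
          proof (cases "y = w")
            case True
            then have "subseq [z'] (r # V)" using s2 by simp
            then show ?thesis using z xs True by (metis subseq_singleton_left)
          next
            case F: False
            then have "subseq [y, z'] (r # V)" using s2 by simp
            then show ?thesis using False xs by simp
          qed
        next
          case False
          then have "subseq [x, y, z'] (r # V)" using sub nw by simp
          then show ?thesis using \<open>\<not> subseq _ (s # r # V)\<close> by (meson list_emb_Cons)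
        qed
      qed
    qed
  qed
qed

lemma subseq_Cons_drop_iff:
  "subseq (x # xs) (drop m ys) \<longleftrightarrow> (\<exists>i\<ge>m. i < length ys \<and> ys ! i = x \<and> subseq xs (drop (Suc i) ys))"
proof
  assume "subseq (x # xs) (drop m ys)"
  from list_emb_ConsD[OF this] obtain us vs where uv: "drop m ys = us @ x # vs" "subseq xs vs"
    by blast
  then have m: "m \<le> length ys" by (metis drop_all append_is_Nil_conv list.distinct(1) nat_le_linear)
  define i where "i = m + length us"
  have "length (drop m ys) = length us + Suc (length vs)" using uv(1) by simp
  then have i: "i < length ys" using m by (simp add: i_def)
  have "ys ! i = drop m ys ! length us" using m by (simp add: i_def)
  then have "ys ! i = x" using uv(1) by simp
  moreover have "drop (Suc i) ys = drop (Suc (length us)) (drop m ys)" by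
    (simp add: i_def add.commute)
  then have "drop (Suc i) ys = vs" using uv(1) by simp
  ultimately show "\<exists>i\<ge>m. i < length ys \<and> ys ! i = x \<and> subseq xs (drop (Suc i) ys)"
    using i uv(2) by (intro exI[of _ i]) (simp add: i_def)
next
  assume "\<exists>i\<ge>m. i < length ys \<and> ys ! i = x \<and> subseq xs (drop (Suc i) ys)"
  then obtain i where i: "i \<ge> m" "i < length ys" "ys ! i = x" "subseq xs (drop (Suc i) ys)" by blast
  then have "subseq (x # xs) (drop i ys)" by (simp add: Cons_nth_drop_Suc[symmetric])
  moreover have "subseq (drop i ys) (drop m ys)"
    using i(1) suffix_imp_subseq[OF suffix_drop[of "i - m" "drop m ys"]] by simp
  ultimately show "subseq (x # xs) (drop m ys)" by (meson subseq_order.order_trans)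
qed

lemma subseq_Cons_nth_iff:
  "subseq (x # xs) ys \<longleftrightarrow> (\<exists>i<length ys. ys ! i = x \<and> subseq xs (drop (Suc i) ys))"
  using subseq_Cons_drop_iff[of x xs 0 ys] by simp

lemma ccw_list_nth_iff:
  "ccw_list vs \<longleftrightarrow> (\<forall>i j k. i < j \<longrightarrow> j < k \<longrightarrow> k < length vs \<longrightarrow> ccw (vs ! i) (vs ! j) (vs ! k))"
proof
  assume c: "ccw_list vs"
  show "\<forall>i j k. i < j \<longrightarrow> j < k \<longrightarrow> k < length vs \<longrightarrow> ccw (vs ! i) (vs ! j) (vs ! k)"
  proof (intro allI impI)
    fix i j k assume ijk: "i < j" "j < k" "k < length vs"
    have "subseq [vs ! k] (drop (Suc j) vs)"
      unfolding subseq_Cons_drop_iff using ijk by (intro exI[of _ k]) auto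
    then have "subseq [vs ! j, vs ! k] (drop (Suc i) vs)"
      unfolding subseq_Cons_drop_iff[of "vs ! j"] using ijk by (intro exI[of _ j]) auto
    then have "subseq [vs ! i, vs ! j, vs ! k] vs"
      unfolding subseq_Cons_nth_iff[of "vs ! i"] using ijk by (intro exI[of _ i]) auto
    then show "ccw (vs ! i) (vs ! j) (vs ! k)" by (rule ccw_listD[OF c])
  qed
next
  assume c: "\<forall>i j k. i < j \<longrightarrow> j < k \<longrightarrow> k < length vs \<longrightarrow> ccw (vs ! i) (vs ! j) (vs ! k)"
  show "ccw_list vs"
    unfolding ccw_list_def
  proof (intro allI impI)
    fix x y z assume "subseq [x, y, z] vs"
    then obtain i j k where "i < length vs" "vs ! i = x" "Suc i \<le> j" "j < length vs" "vs ! j = y"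
      "Suc j \<le> k" "k < length vs" "vs ! k = z"
      unfolding subseq_Cons_nth_iff[of x] subseq_Cons_drop_iff by blast
    then show "ccw x y z" using c by (metis Suc_le_lessD)
  qed
qed

lemma polygon_sides_conv_zip: "polygon_sides rs = zip rs (rotate1 rs)"
  by (rule nth_equalityI) (auto simp: polygon_sides_def nth_rotate1)

text \<open>From sides to triples: fix \<open>i\<close> and \<open>k\<close> and let the middle
  vertex advance from \<open>i\<close> towards \<open>k\<close> one side at a time; transitivity
  based at vertex \<open>k\<close> carries the orientation along. The converse reads off single
  triples up to rotation.\<close>

lemma convex_ideal_polygon_iff:
  assumes "length vs \<ge> 2" "distinct vs" "\<forall>v\<in>set vs. prim v"
  shows "convex_ideal_polygon (map vec_cusp vs) \<longleftrightarrow> ccw_list vs"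
proof -
  let ?n = "length vs"
  have inj: "inj_on vec_cusp (set vs)" using assms(3) by (auto simp: inj_on_def vec_cusp_inject)
  have pr: "prim (vs ! i)" if "i < ?n" for i using that assms(3) by simp
  have eq: "vec_cusp (vs ! i) = vec_cusp (vs ! j) \<longleftrightarrow> i = j" if "i < ?n" "j < ?n" for i j
    using that assms(2) by (simp add: vec_cusp_inject pr nth_eq_iff_index_eq)
  have "convex_ideal_polygon (map vec_cusp vs) \<longleftrightarrow>
    (\<forall>i<?n. \<forall>k<?n. k \<noteq> i \<and> k \<noteq> Suc i mod ?n \<longrightarrow> ccw (vs ! i) (vs ! (Suc i mod ?n)) (vs ! k))" (is "_ =
      ?R")
  proof -
    have lt: "Suc i mod ?n < ?n" for i using assms(1) by (intro mod_less_divisor) linarith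
    have sd: "polygon_sides (map vec_cusp vs)
        = map (\<lambda>i. (vec_cusp (vs ! i), vec_cusp (vs ! (Suc i mod ?n)))) [0..<?n]"
      unfolding polygon_sides_def by (intro map_cong) (auto simp: lt)
    have "map vec_cusp vs = map (\<lambda>k. vec_cusp (vs ! k)) [0..<?n]"
      by (rule nth_equalityI) auto
    then have st: "set (map vec_cusp vs) = (\<lambda>k. vec_cusp (vs ! k)) ` {0..<?n}"
      by (simp only: set_map set_upt)
    have "distinct (map vec_cusp vs)" using assms(2) inj by (simp add: distinct_map)
    then have "convex_ideal_polygon (map vec_cusp vs) \<longleftrightarrow>
      (\<forall>i\<in>{0..<?n}. \<forall>k\<in>{0..<?n}. vec_cusp (vs ! k) \<noteq> vec_cusp (vs ! i) \<and>
        vec_cusp (vs ! k) \<noteq> vec_cusp (vs ! (Suc i mod ?n)) \<longrightarrow>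
        left_of (vec_cusp (vs ! i), vec_cusp (vs ! (Suc i mod ?n))) (vec_cusp (vs ! k)))"
      unfolding convex_ideal_polygon_def sd st
      using assms(1) by (simp del: left_of.simps)
    also have "\<dots> \<longleftrightarrow> ?R"
    proof -
      have "(vec_cusp (vs ! k) \<noteq> vec_cusp (vs ! i) \<and>
          vec_cusp (vs ! k) \<noteq> vec_cusp (vs ! (Suc i mod ?n)) \<longrightarrow>
          left_of (vec_cusp (vs ! i), vec_cusp (vs ! (Suc i mod ?n))) (vec_cusp (vs ! k))) \<longleftrightarrow>
        (k \<noteq> i \<and> k \<noteq> Suc i mod ?n \<longrightarrow> ccw (vs ! i) (vs ! (Suc i mod ?n)) (vs ! k))"
        if "i < ?n" "k < ?n" for i k
        by (simp only: left_of_iff_ccw pr eq lt that)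
      then show ?thesis by (metis (no_types, lifting) atLeastLessThan_iff le0)
    qed
    finally show ?thesis .
  qed
  also have "\<dots> \<longleftrightarrow> ccw_list vs"
  proof
    assume R: ?R
    have "ccw (vs ! i) (vs ! j) (vs ! k)" if "i < j" "j < k" "k < ?n" for i j k
      using that
    proof (induction j)
      case (Suc j)
      show ?case
      proof (cases "i = j")
        case True
        then show ?thesis using R[rule_format, of i k] Suc.prems by simp
      next
        case False
        then have "ccw (vs ! i) (vs ! j) (vs ! k)" using Suc by simp
        moreover have "ccw (vs ! j) (vs ! Suc j) (vs ! k)"
          using R[rule_format, of j k] Suc.prems by simp
        ultimately have "ccw (vs ! k) (vs ! i) (vs ! j)" "ccw (vs ! k) (vs ! j) (vs ! Suc j)"
          using ccw_rotate by blast+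
        then have "ccw (vs ! k) (vs ! i) (vs ! Suc j)"
          using ccw_trans(1)[of "vs ! k" "vs ! i" "vs ! j" "vs ! Suc j"] Suc.prems pr by auto
        then show ?thesis using ccw_rotate by blast
      qed
    qed simp
    then show "ccw_list vs" unfolding ccw_list_nth_iff by blast
  next
    assume L: "ccw_list vs"
    show ?R
    proof (intro allI impI)
      fix i k assume i: "i < ?n" and k: "k < ?n" and ik: "k \<noteq> i \<and> k \<noteq> Suc i mod ?n"
      show "ccw (vs ! i) (vs ! (Suc i mod ?n)) (vs ! k)"
      proof (cases "Suc i < ?n")
        case True
        then have S: "Suc i mod ?n = Suc i" by simp
        consider "k < i" | "Suc i < k" using ik S by linarith
        then show ?thesis
        proof cases
          case 1
          then have "ccw (vs ! k) (vs ! i) (vs ! Suc i)" using L True unfolding ccw_list_nth_iff by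
            simp
          then show ?thesis using ccw_rotate S by metis
        next
          case 2
          then show ?thesis using L k S unfolding ccw_list_nth_iff by simp
        qed
      next
        case False
        then have S: "Suc i = ?n" using i by simp
        then have "Suc i mod ?n = 0" by simp
        moreover have "ccw (vs ! 0) (vs ! k) (vs ! i)"
          using L ik k i S \<open>Suc i mod ?n = 0\<close> unfolding ccw_list_nth_iff by simp
        ultimately show ?thesis using ccw_rotate by metis
      qed
    qed
  qed
  finally show ?thesis .
qed

section \<open>Integer matrices and subgroups of \<open>PSL2Z\<close>\<close>

definition rat_mat :: "imat \<Rightarrow> rat^2^2" where
  "rat_mat M = (case M of (a, b, c, d) \<Rightarrow> mat2 (of_int a) (of_int b) (of_int c) (of_int d))"

lemma mat2_nth [simp]:
  "mat2 a b c d $ 1 $ 1 = a" "mat2 a b c d $ 1 $ 2 = b" "mat2 a b c d $ 2 $ 1 = c"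
    "mat2 a b c d $ 2 $ 2 = d"
  by (simp_all add: mat2_def)

lemma mat2_eq_iff: "A = B \<longleftrightarrow> A $ 1 $ 1 = B $ 1 $ 1 \<and> A $ 1 $ 2 = B $ 1 $ 2 \<and> A $ 2 $ 1 = B $ 2 $ 1 \<and>
  A $ 2 $ 2 = B $ 2 $ 2"
  for A B :: "'a^2^2"
  by (auto simp: vec_eq_iff forall_2)

lemma mat2_mult:
  "mat2 a b c d ** mat2 a' b' c' d' = mat2 (a * a' + b * c') (a * b' + b * d') (c * a' + d * c')
    (c * b' + d * d')"
  by (simp add: mat2_eq_iff matrix_matrix_mult_def sum_2)

lemma mat_1_conv_mat2: "mat 1 = mat2 1 0 0 1"
  by (simp add: mat2_eq_iff mat_def)

lemma rat_mat_mmul: "rat_mat (mmul M N) = rat_mat M ** rat_mat N"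
  by (cases M; cases N) (simp add: rat_mat_def mat2_mult)

lemma rat_mat_uminus: "rat_mat (- M) = - rat_mat M"
  by (cases M) (simp add: rat_mat_def mat2_eq_iff)

lemma rat_mat_1: "rat_mat (1, 0, 0, 1) = mat 1"
  by (simp add: rat_mat_def mat_1_conv_mat2)

lemma det_rat_mat: "det (rat_mat M) = of_int (mdet M)"
  by (cases M) (simp add: rat_mat_def det_2)

lemma rat_mat_inject: "rat_mat M = rat_mat N \<longleftrightarrow> M = N"
  by (cases M; cases N) (auto simp: rat_mat_def mat2_eq_iff)

lemma mmul_madj: "mdet M = 1 \<Longrightarrow> mmul (madj M) M = (1, 0, 0, 1)"
  "mdet M = 1 \<Longrightarrow> mmul M (madj M) = (1, 0, 0, 1)"
  by (cases M; simp add: algebra_simps)+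

lemma carrier_SL2Z: "carrier SL2Z = rat_mat ` {M. mdet M = 1}"
proof
  show "carrier SL2Z \<subseteq> rat_mat ` {M. mdet M = 1}"
  proof
    fix A assume "A \<in> carrier SL2Z"
    then have A: "\<forall>i j. A $ i $ j \<in> \<int>" "det A = 1" by (auto simp: SL2Z_def)
    obtain a b c d where "A $ 1 $ 1 = of_int a" "A $ 1 $ 2 = of_int b" "A $ 2 $ 1 = of_int c"
      "A $ 2 $ 2 = of_int d"
      using A(1) by (metis Ints_cases)
    then have eq: "A = rat_mat (a, b, c, d)" by (simp add: rat_mat_def mat2_eq_iff)
    then have "mdet (a, b, c, d) = 1" using A(2) det_rat_mat[of "(a, b, c, d)"] by
      (metis of_int_eq_1_iff)
    then show "A \<in> rat_mat ` {M. mdet M = 1}" using eq by blast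
  qed
  show "rat_mat ` {M. mdet M = 1} \<subseteq> carrier SL2Z"
    by (auto simp: SL2Z_def forall_2 det_rat_mat simp del: mdet.simps) (auto simp: rat_mat_def)
qed

lemma rat_mat_in_SL2Z [simp]: "mdet M = 1 \<Longrightarrow> rat_mat M \<in> carrier SL2Z"
  by (auto simp: carrier_SL2Z)

lemma mult_SL2Z [simp]: "x \<otimes>\<^bsub>SL2Z\<^esub> y = x ** y" and one_SL2Z [simp]: "\<one>\<^bsub>SL2Z\<^esub> = mat 1"
  by (simp_all add: SL2Z_def)

lemma group_SL2Z: "group SL2Z"
proof (rule groupI)
  fix x assume "x \<in> carrier SL2Z"
  then obtain M where M: "mdet M = 1" "x = rat_mat M" by (auto simp: carrier_SL2Z)
  then have "rat_mat (madj M) ** x = mat 1" by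
    (simp add: rat_mat_mmul[symmetric] mmul_madj rat_mat_1)
  then show "\<exists>y\<in>carrier SL2Z. y \<otimes>\<^bsub>SL2Z\<^esub> x = \<one>\<^bsub>SL2Z\<^esub>"
    using M by (intro bexI[of _ "rat_mat (madj M)"]) auto
next
  fix x y assume "x \<in> carrier SL2Z" "y \<in> carrier SL2Z"
  then obtain M N where "mdet M = 1" "x = rat_mat M" "mdet N = 1" "y = rat_mat N" by
    (auto simp: carrier_SL2Z)
  then show "x \<otimes>\<^bsub>SL2Z\<^esub> y \<in> carrier SL2Z" by (simp add: rat_mat_mmul[symmetric])
next
  show "\<one>\<^bsub>SL2Z\<^esub> \<in> carrier SL2Z" by (simp add: rat_mat_1[symmetric])
qed (auto simp: matrix_mul_assoc)

lemma centre_SL2Z_conv: "centre_SL2Z = {rat_mat (1, 0, 0, 1), rat_mat (-1, 0, 0, -1)}"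
  using rat_mat_uminus[of "(1, 0, 0, 1)"] by (simp add: centre_SL2Z_def rat_mat_1)

lemma normal_centre: "centre_SL2Z \<lhd> SL2Z"
proof (rule group.normal_invI[OF group_SL2Z])
  interpret group SL2Z by (rule group_SL2Z)
  have c: "centre_SL2Z \<subseteq> carrier SL2Z"
    unfolding centre_SL2Z_conv by auto
  have m: "x ** y \<in> centre_SL2Z" if "x \<in> centre_SL2Z" "y \<in> centre_SL2Z" for x y
    using that unfolding centre_SL2Z_conv by (auto simp: rat_mat_mmul[symmetric])
  show "subgroup centre_SL2Z SL2Z"
  proof (rule subgroupI)
    fix x assume x: "x \<in> centre_SL2Z"
    then have "x ** x = rat_mat (1, 0, 0, 1)"
      unfolding centre_SL2Z_conv by (auto simp: rat_mat_mmul[symmetric])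
    then have "inv\<^bsub>SL2Z\<^esub> x = x" using x c by (intro inv_equality) (auto simp: rat_mat_1)
    then show "inv\<^bsub>SL2Z\<^esub> x \<in> centre_SL2Z" using x by simp
  qed (use c m in \<open>auto simp: centre_SL2Z_def\<close>)
  fix x h assume x: "x \<in> carrier SL2Z" and h: "h \<in> centre_SL2Z"
  have "x ** h = h ** x"
    using h by (auto simp: centre_SL2Z_def mat2_eq_iff matrix_matrix_mult_def sum_2 mat_def)
  then have "x \<otimes>\<^bsub>SL2Z\<^esub> h \<otimes>\<^bsub>SL2Z\<^esub> inv\<^bsub>SL2Z\<^esub> x = h \<otimes>\<^bsub>SL2Z\<^esub> (x \<otimes>\<^bsub>SL2Z\<^esub> inv\<^bsub>SL2Z\<^esub> x)"
    using x h c by (simp add: matrix_mul_assoc)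
  also have "\<dots> = h" unfolding r_inv[OF x] using h c by auto
  finally show "x \<otimes>\<^bsub>SL2Z\<^esub> h \<otimes>\<^bsub>SL2Z\<^esub> inv\<^bsub>SL2Z\<^esub> x \<in> centre_SL2Z" using h by simp
qed

lemma group_PSL2Z: "group PSL2Z"
  unfolding PSL2Z_def by (rule normal.factorgroup_is_group[OF normal_centre])

lemma PSL_class_hom: "PSL_class \<in> hom SL2Z PSL2Z"
  using normal.r_coset_hom_Mod[OF normal_centre] unfolding PSL2Z_def PSL_class_def[abs_def] .

definition psl :: "imat \<Rightarrow> (rat^2^2) set" where
  "psl M = PSL_class (rat_mat M)"

text \<open>Makes the sign ambiguity of gluing matrices invisible in the group.\<close>

lemma psl_uminus [simp]: "psl (- M) = psl M"
  by (auto simp: psl_def PSL_class_def r_coset_def centre_SL2Z_def rat_mat_uminus mat2_eq_iff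
      matrix_matrix_mult_def sum_2 mat_def)

lemma psl_closed [simp]: "mdet M = 1 \<Longrightarrow> psl M \<in> carrier PSL2Z"
  unfolding psl_def using PSL_class_hom by (auto simp: hom_def)

lemma psl_mmul: "mdet M = 1 \<Longrightarrow> mdet N = 1 \<Longrightarrow> psl (mmul M N) = psl M \<otimes>\<^bsub>PSL2Z\<^esub> psl N"
  unfolding psl_def rat_mat_mmul using PSL_class_hom rat_mat_in_SL2Z by (auto simp: hom_def)

lemma psl_madj:
  assumes "mdet M = 1"
  shows "psl (madj M) = inv\<^bsub>PSL2Z\<^esub> psl M"
proof -
  interpret group PSL2Z by (rule group_PSL2Z)
  have "psl (1, 0, 0, 1) = \<one>\<^bsub>PSL2Z\<^esub>"
    using hom_one[OF PSL_class_hom group_SL2Z group_PSL2Z] by (simp add: psl_def rat_mat_1)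
  then have "psl (madj M) \<otimes>\<^bsub>PSL2Z\<^esub> psl M = \<one>\<^bsub>PSL2Z\<^esub>"
    using psl_mmul[of "madj M" M] assms by (simp only: mmul_madj mdet_madj)
  then show ?thesis using assms by (metis inv_equality mdet_madj psl_closed)
qed

definition psl_gen :: "imat set \<Rightarrow> (rat^2^2) set set" where
  "psl_gen S = generate PSL2Z (psl ` S)"

lemma psl_gen_incl: "M \<in> S \<Longrightarrow> psl M \<in> psl_gen S"
  unfolding psl_gen_def by (auto intro: generate.incl)

lemma psl_gen_mmul:
  "psl M \<in> psl_gen S \<Longrightarrow> psl N \<in> psl_gen S \<Longrightarrow> mdet M = 1 \<Longrightarrow> mdet N = 1 \<Longrightarrow> psl (mmul M N) \<in> psl_gen S"
  unfolding psl_gen_def by (simp add: psl_mmul generate.eng)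

lemma psl_gen_madj:
  assumes "psl M \<in> psl_gen S" "mdet M = 1" "\<forall>N\<in>S. mdet N = 1"
  shows "psl (madj M) \<in> psl_gen S"
proof -
  interpret group PSL2Z by (rule group_PSL2Z)
  have "psl ` S \<subseteq> carrier PSL2Z" using assms(3) by auto
  then show ?thesis using assms unfolding psl_gen_def by (simp add: psl_madj generate_m_inv_closed)
qed

lemma psl_gen_subset:
  assumes "\<forall>M\<in>S. psl M \<in> psl_gen T" "\<forall>N\<in>T. mdet N = 1"
  shows "psl_gen S \<subseteq> psl_gen T"
proof -
  interpret group PSL2Z by (rule group_PSL2Z)
  have "subgroup (psl_gen T) PSL2Z"
    using assms(2) unfolding psl_gen_def by (intro generate_is_subgroup) auto
  then show ?thesis
    using assms(1) unfolding psl_gen_def[of S] by (intro generate_subgroup_incl) auto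
qed

section \<open>Arcs and their gluing matrices\<close>

type_synonym iarc = "ivec \<times> ivec"

definition cusp_arc :: "iarc \<Rightarrow> arc" where
  "cusp_arc a = (vec_cusp (fst a), vec_cusp (snd a))"

definition arc_ok :: "iarc \<Rightarrow> bool" where
  "arc_ok a \<longleftrightarrow> prim (fst a) \<and> prim (snd a) \<and> fst a \<noteq> snd a"

lemma mdet_cols [simp]: "mdet (cols u v) = vdet u v"
  by (cases u; cases v) simp

lemma mmul_cols: "mmul M (cols u v) = cols (mvec M u) (mvec M v)"
  by (cases M; cases u; cases v) simp

lemma cols_inject: "cols u v = cols u' v' \<longleftrightarrow> u = u' \<and> v = v'"
  by (cases u; cases v; cases u'; cases v') auto

lemma act_uminus_vec [simp]: "act M (- v) = act M v"
  by (simp add: act_def mvec_uminus)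

lemma mmul_assoc: "mmul (mmul L M) N = mmul L (mmul M N)"
  by (cases L; cases M; cases N) (simp add: algebra_simps)

lemma mmul_1: "mmul (1, 0, 0, 1) M = M" "mmul M (1, 0, 0, 1) = M"
  by (cases M; simp)+

lemma vdet_prim_nonzero:
  assumes "prim r" "prim s" "r \<noteq> s"
  shows "vdet r s \<noteq> 0"
  using cusp_less_linear[of "vec_cusp r" "vec_cusp s"] cusp_less_iff[OF assms(1,2)]
    cusp_less_iff[OF assms(2,1)]
    vdet_swap[of r s] assms by (auto simp: vec_cusp_inject)

text \<open>\<open>arc_mat\<close> is an arbitrary choice, so each column is known only up to sign;
  positivity of the determinant couples the two signs. The vector \<open>r'\<close> of the proof
  exhibits an admissible matrix, so that the choice is not vacuous.\<close>

lemma arc_mat_cases: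
  assumes "arc_ok a"
  obtains u v where "u = fst a \<or> u = - fst a" "v = snd a \<or> v = - snd a" "vdet u v > 0"
    "arc_mat (cusp_arc a) = rat_mat (cols u v)"
proof -
  obtain r s where a: "a = (r, s)" by (cases a)
  have rs: "prim r" "prim s" "r \<noteq> s" using assms by (auto simp: arc_ok_def a)
  have *: "is_arc_matrix (cusp_arc a) A \<longleftrightarrow> (\<exists>u v. A = rat_mat (cols u v) \<and> vdet u v > 0 \<and>
      coprime (fst u) (snd u) \<and> coprime (fst v) (snd v) \<and> vec_cusp r = vec_cusp u \<and> vec_cusp s =
        vec_cusp v)" for A
  proof -
    have "is_arc_matrix (cusp_arc a) A \<longleftrightarrow> (\<exists>x y z t. A = rat_mat (x, y, z, t) \<and> det A > 0 \<and>
      coprime x z \<and> coprime y t \<and> vec_cusp r = vec_cusp (x, z) \<and> vec_cusp s = vec_cusp (y, t))"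
      by (simp add: is_arc_matrix_def cusp_arc_def a rat_mat_def vec_cusp_def)
    also have "\<dots> \<longleftrightarrow> (\<exists>x y z t. A = rat_mat (cols (x, z) (y, t)) \<and> vdet (x, z) (y, t) > 0 \<and>
      coprime x z \<and> coprime y t \<and> vec_cusp r = vec_cusp (x, z) \<and> vec_cusp s = vec_cusp (y, t))"
    proof -
      have "det A > 0 \<longleftrightarrow> vdet (x, z) (y, t) > 0" if "A = rat_mat (x, y, z, t)" for x y z t
        unfolding that det_rat_mat of_int_0_less_iff by (simp add: mult.commute)
      then show ?thesis by (simp only: cols.simps cong: conj_cong)
    qed
    also have "\<dots> \<longleftrightarrow> (\<exists>u v. A = rat_mat (cols u v) \<and> vdet u v > 0 \<and>
      coprime (fst u) (snd u) \<and> coprime (fst v) (snd v) \<and> vec_cusp r = vec_cusp u \<and> vec_cusp s =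
        vec_cusp v)"
      by (simp only: split_paired_Ex fst_conv snd_conv) blast
    finally show ?thesis .
  qed
  define r' where "r' = (if vdet r s > 0 then r else - r)"
  have "vdet r' s > 0" using vdet_prim_nonzero[OF rs] by (auto simp: r'_def)
  moreover have "coprime (fst r') (snd r')" "vec_cusp r = vec_cusp r'" "coprime (fst s) (snd s)"
    using rs by (auto simp: r'_def prim_def vec_cusp_uminus)
  ultimately have "is_arc_matrix (cusp_arc a) (rat_mat (cols r' s))" unfolding * by blast
  then have "is_arc_matrix (cusp_arc a) (arc_mat (cusp_arc a))" unfolding arc_mat_def by
    (rule someI)
  then obtain u v where uv: "arc_mat (cusp_arc a) = rat_mat (cols u v)" "vdet u v > 0"
      "coprime (fst u) (snd u)" "coprime (fst v) (snd v)" "vec_cusp r = vec_cusp u"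
        "vec_cusp s = vec_cusp v"
    unfolding * by blast
  have "nrm u = r" "nrm v = s"
    using uv(3-6) rs prim_nrm by (simp_all add: vec_cusp_nrm flip: vec_cusp_inject)
  then have "u = r \<or> u = - r" "v = s \<or> v = - s" using nrm_cases[of u] nrm_cases[of v] by auto
  with uv that show ?thesis by (simp add: a)
qed

lemma arc_mat_minus_eq:
  "arc_mat a = rat_mat (cols u v) \<Longrightarrow> arc_mat_minus a = rat_mat (cols v (- u))"
  unfolding arc_mat_minus_def by (cases u; cases v) (simp add: rat_mat_def mat2_mult)

text \<open>Turns the definition of a gluing matrix into equations for the images of two
  columns.\<close>

lemma eq_mult_matrix_inv_iff:
  fixes B :: "rat^2^2"
  assumes "det B \<noteq> 0"
  shows "X = A ** matrix_inv B \<longleftrightarrow> X ** B = A"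
proof -
  have "\<exists>B'. B ** B' = mat 1 \<and> B' ** B = mat 1"
    using assms invertible_det_nz[of B] by (simp add: invertible_def)
  then have "B ** matrix_inv B = mat 1" "matrix_inv B ** B = mat 1"
    unfolding matrix_inv_def by (metis (mono_tags, lifting) someI_ex)+
  then show ?thesis by (metis matrix_mul_assoc matrix_mul_rid)
qed

text \<open>A side of order \<open>2\<close> is its own mate, so it is glued by the same formula as
  a paired side; paired sides carry the order \<open>0\<close>.\<close>

definition glue_mat :: "nat \<Rightarrow> arc \<Rightarrow> arc \<Rightarrow> rat^2^2" where
  "glue_mat m a b = (if m = 3 then arc_mat_minus a ** mat2 0 (-1) 1 (-1) ** matrix_inv
    (arc_mat_minus a)
     else arc_mat a ** matrix_inv (arc_mat_minus b))"

text \<open>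
  Elements of order \<open>3\<close> of \<open>PSL\<^sub>2(\<int>)\<close> are represented by their lift of trace \<open>-1\<close>. The condition
  on \<open>vdet\<close> selects the rotation in the positive direction.
\<close>

definition glue :: "nat \<Rightarrow> imat \<Rightarrow> iarc \<Rightarrow> iarc \<Rightarrow> bool" where
  "glue m M a b \<longleftrightarrow> mdet M = 1 \<and>
     (if m = 3 then mtr M = -1 \<and> vdet (snd a) (mvec M (snd a)) > 0 \<and> act M (snd a) = fst a
      else act M (snd b) = fst a \<and> act M (fst b) = snd a)"

text \<open>Recovers the trace from the action on any two independent vectors.\<close>

lemma mtr_vdet: "vdet (mvec M u) v + vdet u (mvec M v) = mtr M * vdet u v"
  by (cases M; cases u; cases v) (simp add: algebra_simps)

text \<open>Cayley-Hamilton for trace \<open>-1\<close> and determinant \<open>1\<close>: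
  \<open>M^2 + M + 1 = 0\<close>.\<close>

lemma mvec_cayley: "mdet M = 1 \<Longrightarrow> mtr M = -1 \<Longrightarrow> mvec M (mvec M v) = - v - mvec M v"
proof (cases M; cases v)
  fix a b c d x y assume "M = (a, b, c, d)" "v = (x, y)" "mdet M = 1" "mtr M = - 1"
  then have M: "a * d - b * c = 1" "d = - 1 - a" "M = (a, b, c, d)" "v = (x, y)" by auto
  then have bc: "b * c = - 1 - a - a * a" by (simp add: algebra_simps)
  have "a * (a * x + b * y) + b * (c * x + d * y) = (a * a + b * c) * x + (a * b + b * d) * y"
    "c * (a * x + b * y) + d * (c * x + d * y) = (c * a + d * c) * x + (b * c + d * d) * y"
    by (simp_all add: algebra_simps)
  then show ?thesis using M(3,4) unfolding bc M(2) by (simp add: algebra_simps)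
qed

lemma glue_mat_SL2Z:
  assumes "glue_mat m (cusp_arc a) (cusp_arc b) \<in> carrier SL2Z" "arc_ok a" "arc_ok b"
  obtains M where "glue m M a b" "glue_mat m (cusp_arc a) (cusp_arc b) = rat_mat M"
proof -
  obtain u v where uv: "u = fst a \<or> u = - fst a" "v = snd a \<or> v = - snd a" "vdet u v > 0"
    "arc_mat (cusp_arc a) = rat_mat (cols u v)"
    using arc_mat_cases[OF assms(2)] by blast
  obtain u' v' where uv': "u' = fst b \<or> u' = - fst b" "v' = snd b \<or> v' = - snd b" "vdet u' v' > 0"
    "arc_mat (cusp_arc b) = rat_mat (cols u' v')"
    using arc_mat_cases[OF assms(3)] by blast
  obtain M where M: "mdet M = 1" "glue_mat m (cusp_arc a) (cusp_arc b) = rat_mat M"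
    using assms(1) by (auto simp: carrier_SL2Z)
  have pr: "prim (fst a)" "prim (snd a)" using assms(2) by (auto simp: arc_ok_def)
  have "glue m M a b"
  proof (cases "m = 3")
    case True
    have "rat_mat M = rat_mat (cols v (- u)) ** rat_mat (0, -1, 1, -1) ** matrix_inv
      (rat_mat (cols v (- u)))"
      using M(2) True by (simp add: glue_mat_def arc_mat_minus_eq[OF uv(4)] rat_mat_def)
    then have "rat_mat M ** rat_mat (cols v (- u)) = rat_mat (cols v (- u)) ** rat_mat
      (0, -1, 1, -1)"
      using uv(3) by (subst (asm) eq_mult_matrix_inv_iff) (auto simp: det_rat_mat vdet_swap[of v u])
    then have "mmul M (cols v (- u)) = mmul (cols v (- u)) (0, -1, 1, -1)"
      by (simp add: rat_mat_mmul[symmetric] rat_mat_inject)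
    \<comment> \<open>In these columns the matrix of order \<open>3\<close> permutes the vectors
      \<open>v\<close>, \<open>-u\<close>, \<open>u - v\<close>, whose sum is zero,
      cyclically.\<close>
    also have "\<dots> = cols (- u) (u - v)" by (cases u; cases v) simp
    finally have Mv: "mvec M v = - u" "mvec M u = v - u"
      by (auto simp: mmul_cols cols_inject mvec_uminus minus_equation_iff)
    have "mtr M * vdet v u = - vdet v u"
      unfolding mtr_vdet[symmetric] Mv by (cases u; cases v) (simp add: algebra_simps)
    then have "(mtr M + 1) * vdet v u = 0" by (simp add: algebra_simps)
    then have "mtr M = -1" using uv(3) vdet_swap[of v u] by auto
    moreover have "vdet (snd a) (mvec M (snd a)) > 0"
      using uv(2) Mv uv(3) vdet_swap[of v u] by (auto simp: mvec_uminus)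
    moreover have "act M v = fst a" unfolding act_def Mv using uv(1) pr by (auto simp: nrm_prim)
    then have "act M (snd a) = fst a" using uv(2) by auto
    ultimately show ?thesis using M True by (simp add: glue_def)
  next
    case False
    have "rat_mat M = rat_mat (cols u v) ** matrix_inv (rat_mat (cols v' (- u')))"
      using M(2) False by (simp add: glue_mat_def arc_mat_minus_eq[OF uv'(4)] uv(4))
    then have "rat_mat M ** rat_mat (cols v' (- u')) = rat_mat (cols u v)"
      using uv'(3) by (subst (asm) eq_mult_matrix_inv_iff)
        (auto simp: det_rat_mat vdet_swap[of v' u'])
    then have "mmul M (cols v' (- u')) = cols u v"
      by (simp add: rat_mat_mmul[symmetric] rat_mat_inject)
    then have Mv: "mvec M v' = u" "mvec M u' = - v"
      by (auto simp: mmul_cols cols_inject mvec_uminus minus_equation_iff)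
    have "act M v' = fst a" "act M u' = snd a"
      unfolding act_def Mv using uv(1,2) pr by (auto simp: nrm_prim)
    then have "act M (snd b) = fst a" "act M (fst b) = snd a" using uv'(1,2) by auto
    then show ?thesis using M False by (simp add: glue_def)
  qed
  with M that show ?thesis by blast
qed

text \<open>\<open>glue\<close> speaks of cusps, so images of columns are known only up to sign. For
  order \<open>3\<close> the trace and the positivity condition fix the signs; otherwise determinant
  one excludes mixed signs and leaves \<open>M\<close> and \<open>- M\<close>.\<close>

lemma glue_mat_eq:
  assumes g: "glue m M a b" and "arc_ok a" "arc_ok b"
  shows "glue_mat m (cusp_arc a) (cusp_arc b) = rat_mat M \<or> glue_mat m (cusp_arc a) (cusp_arc b) =
    rat_mat (- M)"
proof -
  obtain u v where uv: "u = fst a \<or> u = - fst a" "v = snd a \<or> v = - snd a" "vdet u v > 0"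
    "arc_mat (cusp_arc a) = rat_mat (cols u v)"
    using arc_mat_cases[OF assms(2)] by blast
  obtain u' v' where uv': "u' = fst b \<or> u' = - fst b" "v' = snd b \<or> v' = - snd b" "vdet u' v' > 0"
    "arc_mat (cusp_arc b) = rat_mat (cols u' v')"
    using arc_mat_cases[OF assms(3)] by blast
  have dM: "mdet M = 1" using g by (simp add: glue_def)
  show ?thesis
  proof (cases "m = 3")
    case True
    have tr: "mtr M = -1" and pos: "vdet (snd a) (mvec M (snd a)) > 0" and ac:
      "act M (snd a) = fst a"
      using g True by (auto simp: glue_def)
    have pos: "vdet v (mvec M v) > 0" using pos uv(2) by (auto simp: mvec_uminus)
    have "mvec M v = u \<or> mvec M v = - u" using act_eqD[OF ac] uv(1,2) by (auto simp: mvec_uminus)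
    then have Mv: "mvec M v = - u" using pos uv(3) vdet_swap[of v u] by auto
    then have "mvec M (- u) = u - v" using mvec_cayley[OF dM tr, of v] by simp
    then have "mmul M (cols v (- u)) = cols (- u) (u - v)" using Mv by (simp add: mmul_cols)
    also have "\<dots> = mmul (cols v (- u)) (0, -1, 1, -1)" by (cases u; cases v) simp
    finally have "rat_mat M ** rat_mat (cols v (- u)) = rat_mat (cols v (- u)) ** rat_mat
      (0, -1, 1, -1)"
      by (simp add: rat_mat_mmul[symmetric])
    then have "rat_mat M = rat_mat (cols v (- u)) ** rat_mat (0, -1, 1, -1) ** matrix_inv
      (rat_mat (cols v (- u)))"
      using uv(3) by (subst eq_mult_matrix_inv_iff) (auto simp: det_rat_mat vdet_swap[of v u])
    then show ?thesis using True by (simp add: glue_mat_def arc_mat_minus_eq[OF uv(4)] rat_mat_def)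
  next
    case False
    have "act M (snd b) = fst a" "act M (fst b) = snd a" using g False by (auto simp: glue_def)
    then have "mvec M v' = u \<or> mvec M v' = - u" "mvec M (- u') = v \<or> mvec M (- u') = - v"
      using act_eqD[of M "snd b" "fst a"] act_eqD[of M "fst b" "snd a"] uv(1,2) uv'(1,2)
      by (auto simp: mvec_uminus)
    moreover have "vdet (mvec M v') (mvec M (- u')) > 0"
      unfolding vdet_mvec dM using uv'(3) vdet_swap[of v' u'] by simp
    ultimately have "mvec M v' = u \<and> mvec M (- u') = v \<or> mvec M v' = - u \<and> mvec M (- u') = - v"
      using uv(3) by auto
    then have "mmul M (cols v' (- u')) = cols u v \<or> mmul (- M) (cols v' (- u')) = cols u v"
      by (auto simp: mmul_cols cols_inject mvec_uminus)
    then obtain N where N: "N = M \<or> N = - M" "mmul N (cols v' (- u')) = cols u v" by blast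
    have "rat_mat N ** rat_mat (cols v' (- u')) = rat_mat (cols u v)"
      using N(2) by (simp add: rat_mat_mmul[symmetric])
    then have "rat_mat N = rat_mat (cols u v) ** matrix_inv (rat_mat (cols v' (- u')))"
      using uv'(3) by (subst eq_mult_matrix_inv_iff) (auto simp: det_rat_mat vdet_swap[of v' u'])
    then show ?thesis using False N(1) by (auto simp: glue_mat_def arc_mat_minus_eq[OF uv'(4)]
      uv(4))
  qed
qed

lemma glue_unique:
  assumes "glue m M a b" "glue m N a b" "arc_ok a" "arc_ok b"
  shows "M = N \<or> M = - N"
  using glue_mat_eq[OF assms(1,3,4)] glue_mat_eq[OF assms(2,3,4)]
  by (auto simp: rat_mat_inject rat_mat_uminus)
    (metis minus_equation_iff rat_mat_inject rat_mat_uminus)+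

text \<open>The quadratic form taking \<open>v\<close> to \<open>vdet v (mvec M v)\<close> has
  discriminant \<open>(mtr M)^2 - 4 * mdet M = -3\<close>, hence is definite, and its sign at
  \<open>s\<close> is its sign everywhere; \<open>key\<close> completes the square. This allows the
  end point of an elliptic side to change.\<close>

lemma order3_definite:
  assumes "mdet M = 1" "mtr M = -1" "vdet s (mvec M s) > 0" "prim u"
  shows "vdet u (mvec M u) > 0"
proof -
  obtain a b c d where M: "M = (a, b, c, d)" by (cases M)
  have ab: "d = - 1 - a" "a * d - b * c = 1" using assms M by auto
  have key: "4 * c * vdet v (mvec M v) = (2 * c * fst v + (d - a) * snd v)\<^sup>2 + 3 * (snd v)\<^sup>2" for v
  proof -
    obtain x y where v: "v = (x, y)" by (cases v)
    have "4 * c * vdet v (mvec M v) = (2 * c * x + (d - a) * y)\<^sup>2 +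
      (4 * (a * d - b * c) - (a + d)\<^sup>2) * y\<^sup>2"
      by (simp add: M v power2_eq_square algebra_simps)
    also have "4 * (a * d - b * c) - (a + d)\<^sup>2 = 3" using ab by simp
    finally show ?thesis by (simp add: v)
  qed
  have nn: "4 * c * vdet v (mvec M v) \<ge> 0" for v unfolding key by simp
  have c0: "c \<noteq> 0"
  proof
    assume "c = 0"
    then have "a * (- 1 - a) = 1" using ab by simp
    then have "a * a + a + 1 = 0" by (simp add: algebra_simps)
    moreover have "4 * (a * a + a + 1) = (2 * a + 1)\<^sup>2 + 3" by
      (simp add: power2_eq_square algebra_simps)
    ultimately show False by (smt (verit) zero_le_power2)
  qed
  have "c > 0" using nn[of s] assms(3) c0 by (simp add: zero_le_mult_iff)
  moreover have "4 * c * vdet u (mvec M u) \<noteq> 0"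
  proof
    assume "4 * c * vdet u (mvec M u) = 0"
    then have "(2 * c * fst u + (d - a) * snd u)\<^sup>2 + 3 * (snd u)\<^sup>2 = 0" using key by simp
    then have "snd u = 0" "2 * c * fst u + (d - a) * snd u = 0"
      by (smt (verit) zero_le_power2 power_eq_0_iff)+
    then show False using c0 assms(4) by (auto simp: prim_def)
  qed
  ultimately show ?thesis using nn[of u] by (simp add: zero_le_mult_iff)
qed

text \<open>Exchanging two cusps forces trace zero by \<open>mtr_vdet\<close>; then the square of
  \<open>M\<close> is minus the identity, which is trivial on cusps.\<close>

lemma order2_involutive:
  assumes "mdet M = 1" "act M s = r" "act M r = s" "prim r" "prim s" "r \<noteq> s" "prim v"
  shows "act M (act M v) = v"
proof -
  have "mtr M * vdet s r = 0"
    using mtr_vdet[of M s r] act_eqD[OF assms(2)] act_eqD[OF assms(3)] by auto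
  then have tr: "mtr M = 0" using vdet_prim_nonzero[OF assms(5,4)] assms(6) by auto
  obtain a b c d where M: "M = (a, b, c, d)" by (cases M)
  have "d = - a" "a * d - b * c = 1" using assms(1) tr M by auto
  then have "mmul M M = - (1, 0, 0, 1)" by (simp add: M algebra_simps)
  then have "act (mmul M M) v = act (1, 0, 0, 1) v" by (simp only: act_uminus)
  also have "\<dots> = v" using nrm_prim[OF assms(7)] by (cases v) (simp add: act_def)
  finally show ?thesis by (simp add: act_mmul)
qed

section \<open>Cutting and pasting polygons\<close>

lemma mmul_cancel:
  assumes "mdet A = 1"
  shows "mmul (madj A) (mmul A M) = M" "mmul (mmul M (madj A)) A = M"
  by (simp_all only: mmul_assoc[symmetric] mmul_madj[OF assms] mmul_1)
    (simp only: mmul_assoc mmul_madj[OF assms] mmul_1)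

lemma psl_gen_image_subset:
  assumes "\<And>l. l \<in> L \<Longrightarrow> psl (f l) \<in> psl_gen (h ` K)" "\<And>l. l \<in> K \<Longrightarrow> mdet (h l) = 1"
  shows "psl_gen (f ` L) \<subseteq> psl_gen (h ` K)"
  using assms by (intro psl_gen_subset) auto

locale labelled_pairing = side_pairing mate base for mate :: "'l \<Rightarrow> 'l" and base :: 'l +
  fixes mu :: "'l \<Rightarrow> nat"
begin

text \<open>The matrices of a letter and of its mate are chosen independently, so they are inverse
  only up to sign; this is why their relation is expressed through the action on cusps.\<close>

definition gluable :: "'l list \<Rightarrow> ('l \<Rightarrow> ivec) \<Rightarrow> ('l \<Rightarrow> ivec) \<Rightarrow> ('l \<Rightarrow> imat) \<Rightarrow> bool" where
  "gluable w st en g \<longleftrightarrow>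
     (\<forall>l\<in>set w. glue (mu l) (g l) (st l, en l) (st (mate l), en (mate l)) \<and>
        (mate l \<noteq> l \<longrightarrow> (\<forall>v. prim v \<longrightarrow> act (g l) (act (g (mate l)) v) = v)))"

definition polygon :: "'l list \<Rightarrow> ('l \<Rightarrow> ivec) \<Rightarrow> ('l \<Rightarrow> ivec) \<Rightarrow> bool" where
  "polygon w st en \<longleftrightarrow> (\<forall>l\<in>set w. prim (st l)) \<and> distinct (map st w) \<and> ccw_list (map st w) \<and>
     map st (rotate1 w) = map en w"

definition labels_ok :: "'l list \<Rightarrow> bool" where
  "labels_ok w \<longleftrightarrow> distinct w \<and> mate_closed w \<and> 2 \<le> length w \<and> base \<in> set w \<and>
     (\<forall>l\<in>set w. if mate l = l then mu l \<in> {2, 3} else mu l = 0)"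

definition good :: "'l list \<Rightarrow> ('l \<Rightarrow> ivec) \<Rightarrow> ('l \<Rightarrow> ivec) \<Rightarrow> ('l \<Rightarrow> imat) \<Rightarrow> bool" where
  "good w st en g \<longleftrightarrow> labels_ok w \<and> polygon w st en \<and> gluable w st en g"

lemma polygonD:
  assumes "polygon w st en"
  shows "\<forall>l\<in>set w. prim (st l)" "distinct (map st w)" "ccw_list (map st w)"
    "map st (rotate1 w) = map en w"
  using assms unfolding polygon_def by blast+

lemma polygon_rotate:
  assumes "polygon (x # w) st en"
  shows "polygon (w @ [x]) st en"
proof -
  have "map st (rotate1 (w @ [x])) = map en (w @ [x])"
  proof (cases w)
    case (Cons a v)
    then have "st a = en x" "map st v @ [st x] = en a # map en v" using assms by
      (simp_all add: polygon_def)
    then show ?thesis using Cons by simp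
  qed (use assms in \<open>simp add: polygon_def\<close>)
  moreover have "ccw_list (map st (w @ [x]))" "distinct (map st (w @ [x]))"
    "\<forall>l\<in>set (w @ [x]). prim (st l)"
    using ccw_list_rotate1[of "st x" "map st w"] polygonD(1-3)[OF assms] by simp_all
  ultimately show ?thesis unfolding polygon_def by blast
qed

lemma good_rotate: "good (x # w) st en g \<Longrightarrow> good (w @ [x]) st en g"
  using polygon_rotate by (auto simp: good_def labels_ok_def gluable_def mate_closed_def)

lemma polygon_arc_ok:
  assumes "polygon w st en" "l \<in> set w" "2 \<le> length w" "distinct w"
  shows "arc_ok (st l, en l)"
proof -
  obtain i where i: "i < length w" "w ! i = l" using assms(2) by (meson in_set_conv_nth)
  define j where "j = Suc i mod length w"
  have j: "j < length w" using assms(3) unfolding j_def by (intro mod_less_divisor) linarith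
  have "j \<noteq> i"
  proof (cases "Suc i < length w")
    case False
    then have "Suc i = length w" using i by simp
    then show ?thesis using assms(3) by (simp add: j_def)
  qed (simp add: j_def)
  have "map st (rotate1 w) ! i = map en w ! i" using assms(1) by (simp add: polygon_def)
  then have "en l = st (w ! j)" using i by (simp add: nth_rotate1 j_def)
  moreover have "st (w ! j) \<noteq> st (w ! i)"
    using assms(1) i j \<open>j \<noteq> i\<close> unfolding polygon_def by
      (metis length_map nth_eq_iff_index_eq nth_map)
  ultimately show ?thesis using assms(1) i j by (auto simp: arc_ok_def polygon_def)
qed

lemma good_arc_ok: "good w st en g \<Longrightarrow> l \<in> set w \<Longrightarrow> arc_ok (st l, en l)"
  using polygon_arc_ok by (auto simp: good_def labels_ok_def)

text \<open>
  Here \<open>h\<close> maps the reversed side \<open>b\<close> to its mate. The triangle on \<open>b\<close> and \<open>c\<close> is moved by \<open>h\<close>, so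
  \<open>c\<close> is replaced by its image, \<open>b\<close> by the diagonal, and the mate of \<open>b\<close> by the reversed image of
  the diagonal. The formulas cover the case \<open>mate b = b\<close> as well.
\<close>

definition slide_st :: "'l \<Rightarrow> 'l \<Rightarrow> imat \<Rightarrow> ('l \<Rightarrow> ivec) \<Rightarrow> ('l \<Rightarrow> ivec) \<Rightarrow> 'l \<Rightarrow> ivec" where
  "slide_st b c h st en = st(c := act h (st c), mate b := act h (en c))"

definition slide_en :: "'l \<Rightarrow> 'l \<Rightarrow> imat \<Rightarrow> ('l \<Rightarrow> ivec) \<Rightarrow> 'l \<Rightarrow> ivec" where
  "slide_en b c h en = en(c := act h (en c), b := en c)"

text \<open>For a paired letter \<open>g l\<close> takes the reversed mate of \<open>l\<close> to
  \<open>l\<close>. Moving \<open>c\<close> by \<open>h\<close> thus multiplies on the left at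
  \<open>c\<close> and by the inverse on the right at \<open>mate c\<close>, and conjugates when
  \<open>c\<close> is its own mate. The matrices at \<open>b\<close> and \<open>mate b\<close> still
  fit, because \<open>h\<close> matches the new diagonals.\<close>

definition slide_g :: "'l \<Rightarrow> imat \<Rightarrow> ('l \<Rightarrow> imat) \<Rightarrow> 'l \<Rightarrow> imat" where
  "slide_g c h g = (\<lambda>l. if l = c then (if mate c = c then mmul (mmul h (g c)) (madj h) else mmul h
    (g c))
     else if l = mate c then mmul (g l) (madj h) else g l)"

text \<open>Only one vertex changes. The common vertex of \<open>b\<close> and \<open>c\<close>
  disappears, which is a passage to a subsequence, and the image \<open>w\<close> of the end of
  \<open>c\<close> appears between the end points of \<open>mate b\<close>; it lies there because
  \<open>h\<close> preserves the cyclic order of the corners of the triangle.\<close>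

lemma slide_polygon:
  assumes p: "polygon (b # c # X @ mate b # Y) st en" and "distinct (b # c # X @ mate b # Y)"
    and d: "mdet h = 1" and h: "act h (en b) = st (mate b)" "act h (st b) = en (mate b)"
  shows "polygon (b # X @ c # mate b # Y) (slide_st b c h st en) (slide_en b c h en)"
proof -
  define s' u w where "s' = st (mate b)" and "u = en c" and "w = act h u"
  define V where "V = map st Y @ st b # map st X"
  have cyc: "st c = en b" "map st X @ [s'] = u # map en X"
    "map st Y @ [st b] = en (mate b) # map en Y"
  proof -
    have "st c # (map st X @ [s']) @ (map st Y @ [st b]) = en b # (u # map en X) @
      (en (mate b) # map en Y)"
      using p by (simp add: polygon_def s'_def u_def)
    then have "st c = en b" and eq: "(map st X @ [s']) @ (map st Y @ [st b]) = (u # map en X) @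
      (en (mate b) # map en Y)"
      by simp_all
    moreover have "length (map st X @ [s']) = length (u # map en X)" by simp
    ultimately show "st c = en b" "map st X @ [s'] = u # map en X"
      "map st Y @ [st b] = en (mate b) # map en Y"
      by (metis append_eq_append_conv)+
  qed
  \<comment> \<open>If \<open>Y\<close> is empty, the side after \<open>mate b\<close> is
    \<open>b\<close> and \<open>en (mate b)\<close> is \<open>st b\<close>; putting
    \<open>st b\<close> behind \<open>Y\<close> makes both cases uniform.\<close>
  have hdV: "V = en (mate b) # tl V"
  proof -
    have "hd (map st Y @ [st b]) = en (mate b)" using cyc(3) by simp
    then show ?thesis unfolding V_def by (cases Y) auto
  qed
  have pr: "prim (st b)" "prim (st c)" "prim s'" "\<forall>x\<in>set X \<union> set Y. prim (st x)"
    using p by (auto simp: polygon_def s'_def)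
  have u_in: "u = s' \<or> u \<in> st ` set X" using cyc(2) by (cases X) auto
  then have pu: "prim u" using pr by auto
  have pw: "prim w" unfolding w_def using prim_act[OF d pu] .
  have cc: "ccw_list (st b # st c # map st X @ s' # map st Y)" using polygonD(3)[OF p] by
    (simp add: s'_def)
  have "subseq [u] (map st X @ s' # map st Y)" unfolding subseq_singleton_left using u_in by auto
  then have "subseq [st b, st c, u] (st b # st c # map st X @ s' # map st Y)" by simp
  then have "ccw (st b) (st c) u" using cc ccw_listD by blast
  then have "ccw (st c) u (st b)" using ccw_rotate by blast
  then have c1: "ccw s' w (en (mate b))"
    using ccw_act[OF d, of "st c" u "st b"] h cyc(1) by (simp add: s'_def w_def)
  have "ccw_list ((st b # map st X) @ s' # map st Y)"
    using ccw_list_subseq[OF cc subseq_Cons2[OF list_emb_Cons[OF subseq_order.refl]]] by simp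
  then have c2: "ccw_list (s' # en (mate b) # tl V)"
    using ccw_list_rotate[of "st b # map st X" "s' # map st Y"] hdV by (simp add: V_def)
  have prV: "\<forall>v\<in>set (s' # en (mate b) # tl V). prim v"
    using pr unfolding hdV[symmetric] by (auto simp: V_def)
  have ins: "ccw_list (s' # w # V)" "w \<notin> set (s' # V)"
    using ccw_list_insert[OF c2 c1 pw prV] hdV by auto
  have e1: "map (slide_st b c h st en) X = map st X" "map (slide_st b c h st en) Y = map st Y"
    "map (slide_en b c h en) X = map en X" "map (slide_en b c h en) Y = map en Y"
    using assms(2) by (auto simp: slide_st_def slide_en_def)
  have e2: "slide_st b c h st en c = s'" "slide_st b c h st en (mate b) = w"
    "slide_st b c h st en b = st b"
    "slide_en b c h en c = w" "slide_en b c h en b = u" "slide_en b c h en (mate b) = en (mate b)"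
    using assms(2) h cyc(1) by (auto simp: slide_st_def slide_en_def s'_def w_def u_def)
  have "ccw_list (st b # map st X @ s' # w # map st Y)"
    using ins(1) ccw_list_rotate[of "s' # w # map st Y" "st b # map st X"] by (simp add: V_def)
  moreover have "distinct (st b # map st X @ s' # w # map st Y)"
    using ins(2) polygonD(2)[OF p] by (auto simp: V_def s'_def)
  moreover have "\<forall>v\<in>set (st b # map st X @ s' # w # map st Y). prim v" using pr pw by auto
  moreover have "map st X @ s' # w # map st Y @ [st b] = u # map en X @ w # en (mate b) # map en Y"
    using cyc(2,3) by (metis append.assoc append_Cons append_Nil)
  moreover have M: "map (slide_st b c h st en) (b # X @ c # mate b # Y) = st b # map st X @ s' # w #
    map st Y"
    "map (slide_st b c h st en) (rotate1 (b # X @ c # mate b # Y)) = map st X @ s' # w # map st Y @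
      [st b]"
    "map (slide_en b c h en) (b # X @ c # mate b # Y) = u # map en X @ w # en (mate b) # map en Y"
    by (simp_all add: e1 e2)
  ultimately show ?thesis
    unfolding polygon_def M by (metis M(1) list.set_map imageI)
qed

text \<open>The hypothesis \<open>out\<close> says that \<open>h\<close> throws the polygon side of
  \<open>e\<close> into the boundary arc cut off by \<open>e\<close>; in this form it covers the
  elliptic orders \<open>2\<close> and \<open>3\<close> at once.\<close>

lemma spin_polygon:
  assumes p: "polygon (e # c # X) st en" and "distinct (e # c # X)" and "mate e = e"
    and d: "mdet h = 1" and h: "act h (en e) = st e"
    and out: "\<And>u. prim u \<Longrightarrow> ccw (st e) (en e) u \<Longrightarrow> ccw (st e) (act h u) (en e)"
  shows "polygon (c # e # X) (slide_st e c h st en) (slide_en e c h en)"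
proof -
  define r u w where "r = st e" and "u = en c" and "w = act h u"
  have cyc: "st c = en e" "map st X @ [r] = u # map en X"
    using p by (simp_all add: polygon_def r_def u_def)
  have pr: "prim r" "prim (st c)" "\<forall>x\<in>set X. prim (st x)"
    using p by (auto simp: polygon_def r_def)
  have u_in: "u = r \<or> u \<in> st ` set X" using cyc(2) by (cases X) auto
  then have pu: "prim u" using pr by auto
  have pw: "prim w" unfolding w_def using prim_act[OF d pu] .
  have cc: "ccw_list (r # st c # map st X)" and di: "distinct (r # st c # map st X)"
    using polygonD(2,3)[OF p] by (simp_all add: r_def)
  have ins: "ccw_list (r # w # map st X) \<and> w \<notin> set (r # map st X)"
  proof (cases X)
    case Nil
    \<comment> \<open>A polygon with two sides: convexity is vacuous and only
      \<open>w \<noteq> r\<close> remains, by injectivity of the action.\<close>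
    then have "u = r" using cyc(2) by simp
    then have "w \<noteq> r" using act_inj[OF d pr(2) pr(1)] h cyc(1) di by (auto simp: w_def r_def)
    then show ?thesis using Nil by (simp add: ccw_list_def)
  next
    case (Cons x X')
    then have x: "st x = u" using cyc(2) by simp
    have c1: "ccw r (st c) u" using cc Cons x by (intro ccw_listD[OF cc]) simp
    then have "ccw r w (st c)" using out[OF pu] cyc(1) by (simp add: r_def w_def)
    then have c2: "ccw r w u" using ccw_trans(1)[OF pr(1) pw pr(2) pu] c1 by blast
    have "ccw_list (r # u # map st X')"
      using ccw_list_subseq[OF cc, of "r # u # map st X'"]
        subseq_Cons2[OF list_emb_Cons[OF subseq_order.refl], of r "u # map st X'" "st c"]
      by (simp add: Cons x del: subseq_Cons2_iff)
    moreover have "\<forall>v\<in>set (r # u # map st X'). prim v" using pr pu Cons by auto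
    ultimately have "ccw_list (r # w # u # map st X')" "w \<notin> set (r # u # map st X')"
      using ccw_list_insert[OF _ c2 pw] by blast+
    then show ?thesis using Cons x by simp
  qed
  have e1: "map (slide_st e c h st en) X = map st X" "map (slide_en e c h en) X = map en X"
    using assms(2,3) by (auto simp: slide_st_def slide_en_def)
  have e2: "slide_st e c h st en c = r" "slide_st e c h st en e = w"
    "slide_en e c h en c = w" "slide_en e c h en e = u"
    using assms(2,3) h cyc(1) by (auto simp: slide_st_def slide_en_def r_def w_def u_def)
  have M: "map (slide_st e c h st en) (c # e # X) = r # w # map st X"
    "map (slide_st e c h st en) (rotate1 (c # e # X)) = w # map st X @ [r]"
    "map (slide_en e c h en) (c # e # X) = w # u # map en X"
    by (simp_all add: e1 e2)
  moreover have "\<forall>v\<in>set (r # w # map st X). prim v" using pr pw by auto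
  moreover have "distinct (r # w # map st X)" using ins di by auto
  ultimately show ?thesis
    unfolding polygon_def M cyc(2) using ins by (metis M(1) list.set_map imageI)
qed

lemma slide_gluable:
  assumes good: "good w st en g" and b: "b \<in> set w" and c: "c \<in> set w" "c \<noteq> b" "c \<noteq> mate b"
    and h_def: "h = g (mate b)" and u: "en c = u"
  shows "gluable w (slide_st b c h st en) (slide_en b c h en) (slide_g c h g)"
    (is "gluable w ?st ?en ?g")
proof -
  have mm: "mate (mate l) = l" "mate l \<in> set w" if "l \<in> set w" for l
    using good that by (auto simp: good_def labels_ok_def mate_closed_def)
  have mb: "mate b \<in> set w" "mate (mate b) = b" and mc: "mate c \<in> set w" "mate (mate c) = c"
    using mm b c by auto
  have ne: "mate c \<noteq> b" "mate c \<noteq> mate b" using mb mc c by metis+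
  have gl: "glue (mu l) (g l) (st l, en l) (st (mate l), en (mate l))" if "l \<in> set w" for l
    using good that by (auto simp: good_def gluable_def)
  have iv: "act (g l) (act (g (mate l)) v) = v" if "l \<in> set w" "mate l \<noteq> l" "prim v" for l v
    using good that unfolding good_def gluable_def by blast
  have lab: "if mate l = l then mu l \<in> {2, 3} else mu l = 0" if "l \<in> set w" for l
    using good that by (auto simp: good_def labels_ok_def)
  have prim: "prim (st l)" "prim (en l)" "st l \<noteq> en l" if "l \<in> set w" for l
    using good_arc_ok[OF good that] by (auto simp: arc_ok_def)
  have dg: "mdet (g l) = 1" if "l \<in> set w" for l using gl[OF that] by (simp add: glue_def)
  have dh: "mdet h = 1" using dg mb h_def by simp
  have pu: "prim u" using prim c u by blast
  have cancel: "act (madj h) (act h v) = v" "act h (act (madj h) v) = v" if "prim v" for v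
    using act_madj act_act_madj dh that by auto
  have "glue (mu l) (?g l) (?st l, ?en l) (?st (mate l), ?en (mate l))" if l: "l \<in> set w" for l
  proof -
    consider "l = c" "mate c = c" | "l = c" "mate c \<noteq> c" | "l = mate c" "mate c \<noteq> c"
      | "l = b" "mate b = b" | "l = b" "mate b \<noteq> b" | "l = mate b" "mate b \<noteq> b"
      | "l \<notin> {b, mate b, c, mate c}" by blast
    then show ?thesis
    proof cases
      case 1
      have st: "?st c = act h (st c)" "?en c = act h u" "?g c = mmul (mmul h (g c)) (madj h)"
        using 1 c u by (auto simp: slide_st_def slide_en_def slide_g_def)
      have act': "act (?g c) (act h v) = act h (act (g c) v)" if "prim v" for v
        using that by (simp add: st act_mmul cancel)
      show ?thesis
      proof (cases "mu c = 3")
        case True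
        have g3: "mtr (g c) = -1" "vdet u (mvec (g c) u) > 0" "act (g c) u = st c"
          using gl[OF c(1)] True u by (auto simp: glue_def)
        \<comment> \<open>Conjugation by a matrix of determinant one preserves the trace and
          transports the quadratic form that selects the direction of rotation.\<close>
        have "mvec (?g c) (mvec h u) = mvec h (mvec (g c) u)"
          by (simp add: st mvec_mmul mvec_madj[OF dh])
        then have "vdet (act h u) (mvec (?g c) (act h u)) = vdet u (mvec (g c) u)"
          using act_cases[of h u] by (auto simp: mvec_uminus vdet_mvec dh)
        then show ?thesis
          using 1 True g3 act'[OF pu] dh dg[OF c(1)] by (simp add: glue_def st mtr_conj)
      next
        case False
        then have "act (g c) u = st c" "act (g c) (st c) = u"
          using gl[OF c(1)] 1 u by (auto simp: glue_def)
        then show ?thesis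
          using 1 False act'[OF pu] act'[OF prim(1)[OF c(1)]] dh dg[OF c(1)] by
            (simp add: glue_def st)
      qed
    next
      case 2
      have st: "?st c = act h (st c)" "?en c = act h u" "?g c = mmul h (g c)"
        "?st (mate c) = st (mate c)" "?en (mate c) = en (mate c)"
        using 2 c u ne by (auto simp: slide_st_def slide_en_def slide_g_def)
      have "mu c = 0" using lab[OF c(1)] 2 by simp
      then show ?thesis
        using 2 gl[OF c(1)] dh u by (auto simp: glue_def st act_mmul)
    next
      case 3
      have st: "?st c = act h (st c)" "?en c = act h u" "?g (mate c) = mmul (g (mate c)) (madj h)"
        "?st (mate c) = st (mate c)" "?en (mate c) = en (mate c)"
        using 3 c u ne by (auto simp: slide_st_def slide_en_def slide_g_def)
      have "mu (mate c) = 0" using lab[OF mc(1)] 3 mc by metis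
      then show ?thesis
        using 3 gl[OF mc(1)] dh u mc cancel[OF pu] cancel[OF prim(1)[OF c(1)]]
        by (auto simp: glue_def st act_mmul)
    next
      case 4
      \<comment> \<open>An elliptic \<open>b\<close> becomes the side from \<open>act h u\<close> to
        \<open>u\<close>. For order \<open>3\<close> positivity at the new end point comes from
        definiteness; for order \<open>2\<close> it matters that \<open>h\<close> is an involution
        on all cusps.\<close>
      have st: "?st b = act h u" "?en b = u" "?g b = h"
        using 4 c u ne h_def by (auto simp: slide_st_def slide_en_def slide_g_def)
      have gb: "glue (mu b) h (st b, en b) (st b, en b)" using gl[OF b] 4 h_def by simp
      show ?thesis
      proof (cases "mu b = 3")
        case True
        then show ?thesis
          using 4 gb order3_definite[of h "en b" u] pu by (auto simp: glue_def st)
      next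
        case False
        then have "act h (act h u) = u"
          using gb prim[OF b] pu dh by (intro order2_involutive[of h "en b" "st b"])
            (auto simp: glue_def)
        then show ?thesis using 4 False dh by (simp add: glue_def st)
      qed
    next
      case 5
      have st: "?st b = st b" "?en b = u" "?g b = g b" "?st (mate b) = act h u"
        "?en (mate b) = en (mate b)"
        using 5 c u ne by (auto simp: slide_st_def slide_en_def slide_g_def)
      have "mu b = 0" using lab[OF b] 5 by simp
      then show ?thesis
        using 5 gl[OF b] iv[OF b _ pu, folded h_def] by (auto simp: glue_def st)
    next
      case 6
      have st: "?st b = st b" "?en b = u" "?g (mate b) = h" "?st (mate b) = act h u"
        "?en (mate b) = en (mate b)"
        using 6 c u ne h_def by (auto simp: slide_st_def slide_en_def slide_g_def)
      have "mu (mate b) = 0" using lab[OF mb(1)] 6 mb by metis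
      then show ?thesis
        using 6 gl[OF mb(1), folded h_def] mb(2) by (auto simp: glue_def st)
    next
      case 7
      then have "mate l \<notin> {b, mate b, c, mate c}" using mm[OF l] mb mc by auto
      then show ?thesis
        using 7 gl[OF l] by (auto simp: slide_st_def slide_en_def slide_g_def)
    qed
  qed
  moreover have "act (?g l) (act (?g (mate l)) v) = v" if l: "l \<in> set w" "mate l \<noteq> l" "prim v" for l
    v
  proof -
    consider "l = c" | "l = mate c" "mate c \<noteq> c" | "l \<notin> {c, mate c}" by blast
    then show ?thesis
    proof cases
      case 1
      then show ?thesis
        using l iv[OF c(1) _ prim_act, of "madj h" v] dh cancel
        by (simp add: slide_g_def act_mmul)
    next
      case 2
      have "prim (act (g c) v)" using prim_act dg c l by blast
      then show ?thesis
        using 2 l iv[OF mc(1), of v] mc cancel by (simp add: slide_g_def act_mmul)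
    next
      case 3
      then have "mate l \<notin> {c, mate c}" using mm[OF l(1)] mc by auto
      then show ?thesis using 3 iv[OF l] by (simp add: slide_g_def)
    qed
  qed
  ultimately show ?thesis unfolding gluable_def by blast
qed

lemma slide_g_cases:
  obtains "slide_g c h g l = mmul (mmul h (g l)) (madj h)" | "slide_g c h g l = mmul h (g l)"
    | "slide_g c h g l = mmul (g l) (madj h)" | "slide_g c h g l = g l"
  by (cases "l = c"; cases "mate c = c"; cases "l = mate c") (simp_all add: slide_g_def)

text \<open>\<open>h\<close> is the unchanged matrix of \<open>mate b\<close>, so it is a generator
  before and after; the other generators change at most by factors \<open>h\<close> and its
  inverse.\<close>

lemma slide_group:
  assumes good: "good w st en g" and b: "b \<in> set w" and c: "c \<in> set w" "c \<noteq> b" "c \<noteq> mate b"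
    and h_def: "h = g (mate b)"
  shows "psl_gen (slide_g c h g ` set w) = psl_gen (g ` set w)" (is "psl_gen (?g ` _) = _")
proof -
  have mm: "mate (mate l) = l" "mate l \<in> set w" if "l \<in> set w" for l
    using good that by (auto simp: good_def labels_ok_def mate_closed_def)
  have ne: "mate c \<noteq> mate b" using mm b c by metis
  have dg: "mdet (g l) = 1" if "l \<in> set w" for l using good that by
    (auto simp: good_def gluable_def glue_def)
  have dh: "mdet h = 1" using dg mm b h_def by simp
  have dh': "mdet (madj h) = 1" using dh by simp
  have dg': "mdet (?g l) = 1" if "l \<in> set w" for l
    using dg[OF that] dg[OF c(1)] dh by (auto simp: slide_g_def)
  have "h \<in> g ` set w" using h_def mm b by blast
  then have h1: "psl h \<in> psl_gen (g ` set w)" by (rule psl_gen_incl)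
  then have h2: "psl (madj h) \<in> psl_gen (g ` set w)" using dh dg by (intro psl_gen_madj) auto
  have "?g (mate b) = h" using c ne h_def by (auto simp: slide_g_def)
  then have "h \<in> ?g ` set w" using mm(2)[OF b] by (metis imageI)
  then have h3: "psl h \<in> psl_gen (?g ` set w)" by (rule psl_gen_incl)
  then have h4: "psl (madj h) \<in> psl_gen (?g ` set w)" using dh dg' by (intro psl_gen_madj) auto
  have old: "psl (g l) \<in> psl_gen (g ` set w)" if "l \<in> set w" for l using that by
    (intro psl_gen_incl) blast
  have new: "psl (?g l) \<in> psl_gen (?g ` set w)" if "l \<in> set w" for l using that by
    (intro psl_gen_incl) blast
  show ?thesis
  proof
    show "psl_gen (?g ` set w) \<subseteq> psl_gen (g ` set w)"
    proof (rule psl_gen_image_subset)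
      fix l assume l: "l \<in> set w"
      note o1 = psl_gen_mmul[OF h1 old[OF l] dh dg[OF l]]
      have "mdet (mmul h (g l)) = 1" using dh dg[OF l] by simp
      note o2 = psl_gen_mmul[OF o1 h2 this dh'] and o3 = psl_gen_mmul[OF old[OF l] h2 dg[OF l] dh']
      show "psl (?g l) \<in> psl_gen (g ` set w)"
        by (cases rule: slide_g_cases[of c h g l]) (metis o1 o2 o3 old[OF l])+
    qed (use dg in simp)
    show "psl_gen (g ` set w) \<subseteq> psl_gen (?g ` set w)"
    proof (rule psl_gen_image_subset)
      fix l assume l: "l \<in> set w"
      have n: "psl (mmul (madj h) (mmul (?g l) h)) \<in> psl_gen (?g ` set w)"
        "psl (mmul (madj h) (?g l)) \<in> psl_gen (?g ` set w)"
          "psl (mmul (?g l) h) \<in> psl_gen (?g ` set w)"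
        by (intro psl_gen_mmul new[OF l] h3 h4 dh dh' dg'[OF l]; simp add: dh dg'[OF l])+
      show "psl (g l) \<in> psl_gen (?g ` set w)"
      proof (cases rule: slide_g_cases[of c h g l])
        case 1
        show ?thesis using n(1) unfolding 1 mmul_cancel[OF dh] .
      next
        case 2
        show ?thesis using n(2) unfolding 2 mmul_cancel[OF dh] .
      next
        case 3
        show ?thesis using n(3) unfolding 3 mmul_cancel[OF dh] .
      next
        case 4
        show ?thesis using new[OF l] unfolding 4 .
      qed
    qed (use dg' in simp)
  qed
qed

section \<open>Translating the whole polygon\<close>

definition conj_g :: "imat \<Rightarrow> ('l \<Rightarrow> imat) \<Rightarrow> 'l \<Rightarrow> imat" where
  "conj_g A g = (\<lambda>l. mmul (mmul A (g l)) (madj A))"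

lemma translate_good:
  assumes good: "good w st en g" and A: "mdet A = 1"
  shows "good w (act A \<circ> st) (act A \<circ> en) (conj_g A g)"
proof -
  have prim: "prim (st l)" "prim (en l)" if "l \<in> set w" for l
    using good_arc_ok[OF good that] by (auto simp: arc_ok_def)
  have mm: "mate l \<in> set w" if "l \<in> set w" for l
    using good that by (auto simp: good_def labels_ok_def mate_closed_def)
  have act': "act (conj_g A g l) (act A v) = act A (act (g l) v)" if "prim v" for l v
    using that by (simp add: conj_g_def act_mmul act_madj[OF A])
  have inj: "inj_on (act A) (st ` set w)"
    using prim by (auto simp: inj_on_def act_inj[OF A])
  have poly: "polygon w (act A \<circ> st) (act A \<circ> en)"
  proof -
    have p: "polygon w st en" using good by (simp add: good_def)
    have "ccw_list (map (act A \<circ> st) w)"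
      using p unfolding polygon_def ccw_list_nth_iff by (simp add: ccw_act[OF A])
    moreover have "distinct (map (act A \<circ> st) w)"
      using p inj unfolding polygon_def by (simp add: distinct_map comp_inj_on)
    moreover have "map (act A \<circ> st) (rotate1 w) = map (act A \<circ> en) w"
      using p unfolding polygon_def by (metis map_map)
    ultimately show ?thesis using prim prim_act[OF A] by (auto simp: polygon_def)
  qed
  have "glue (mu l) (conj_g A g l) ((act A \<circ> st) l, (act A \<circ> en) l)
    ((act A \<circ> st) (mate l), (act A \<circ> en) (mate l))"
    if l: "l \<in> set w" for l
  proof -
    have gl: "glue (mu l) (g l) (st l, en l) (st (mate l), en (mate l))"
      using good l by (auto simp: good_def gluable_def)
    have d: "mdet (conj_g A g l) = 1" using gl A by (simp add: conj_g_def glue_def)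
    have e: "mvec (conj_g A g l) (mvec A v) = mvec A (mvec (g l) v)" for v
      by (simp add: conj_g_def mvec_mmul mvec_madj[OF A])
    have "vdet (act A v) (mvec (conj_g A g l) (act A v)) = vdet v (mvec (g l) v)" for v
      using act_cases[of A v] by (auto simp: mvec_uminus vdet_mvec A e)
    then show ?thesis
      using gl d prim[OF l] prim[OF mm[OF l]] act' A
      by (auto simp: glue_def) (simp_all add: conj_g_def mtr_conj)
  qed
  moreover have "act (conj_g A g l) (act (conj_g A g (mate l)) v) = v"
    if l: "l \<in> set w" "mate l \<noteq> l" "prim v" for l v
  proof -
    define v' where "v' = act (madj A) v"
    have v': "prim v'" "v = act A v'" using prim_act[of "madj A" v] l(3) A act_act_madj[OF A] by
      (auto simp: v'_def)
    have "act (g l) (act (g (mate l)) v') = v'" using good l v' unfolding good_def gluable_def by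
      blast
    moreover have "prim (act (g (mate l)) v')"
      using good mm[OF l(1)] v' by (intro prim_act) (auto simp: good_def gluable_def glue_def)
    ultimately show ?thesis using v' by (simp add: act')
  qed
  ultimately show ?thesis using good poly unfolding good_def gluable_def by blast
qed

text \<open>\<open>A\<close> is the inverse of the generator \<open>g l0\<close>, which conjugation
  by \<open>A\<close> fixes. Hence \<open>A\<close> lies in both groups and can be multiplied
  away.\<close>

lemma translate_group:
  assumes good: "good w st en g" and l0: "l0 \<in> set w" and A: "A = madj (g l0)"
  shows "psl_gen (conj_g A g ` set w) = psl_gen (g ` set w)"
proof -
  have dg: "mdet (g l) = 1" if "l \<in> set w" for l using good that by
    (auto simp: good_def gluable_def glue_def)
  have dA: "mdet A = 1" using dg l0 A by simp
  have dg': "mdet (conj_g A g l) = 1" if "l \<in> set w" for l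
    using dg[OF that] dA by (simp add: conj_g_def)
  have "conj_g A g l0 = g l0"
    using dg[OF l0] by (simp add: conj_g_def A mmul_madj mmul_1)
  then have A1: "psl (g l0) \<in> psl_gen (conj_g A g ` set w)" "psl (g l0) \<in> psl_gen (g ` set w)"
    using l0 by (metis imageI psl_gen_incl)+
  have A2: "psl A \<in> psl_gen (conj_g A g ` set w)" "psl A \<in> psl_gen (g ` set w)"
    using psl_gen_madj[OF A1(1)] psl_gen_madj[OF A1(2)] dg dg' l0 by (simp_all add: A)
  have A1: "psl (madj A) \<in> psl_gen (conj_g A g ` set w)" "psl (madj A) \<in> psl_gen (g ` set w)"
    using A1 by (simp_all add: A)
  show ?thesis
  proof
    show "psl_gen (conj_g A g ` set w) \<subseteq> psl_gen (g ` set w)"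
    proof (rule psl_gen_image_subset)
      fix l assume l: "l \<in> set w"
      show "psl (conj_g A g l) \<in> psl_gen (g ` set w)"
        unfolding conj_g_def using A1 A2 dA dg[OF l] l
        by (intro psl_gen_mmul) (auto intro: psl_gen_incl)
    qed (use dg in auto)
    show "psl_gen (g ` set w) \<subseteq> psl_gen (conj_g A g ` set w)"
    proof (rule psl_gen_image_subset)
      fix l assume l: "l \<in> set w"
      have "g l = mmul (mmul (madj A) (conj_g A g l)) A"
        unfolding conj_g_def
        by (simp only: mmul_assoc mmul_madj[OF dA] mmul_1 mmul_cancel[OF dA])
      then show "psl (g l) \<in> psl_gen (conj_g A g ` set w)"
        using A1 A2 dA dg'[OF l] l
        by (auto intro!: psl_gen_mmul intro: psl_gen_incl)
    qed (use dg' in auto)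
  qed
qed

end

text \<open>By Cayley-Hamilton \<open>s\<close> and its two successive images add up to zero, so the
  three successive determinants are equal, and they are positive by assumption.\<close>

lemma order3_ccw:
  assumes "mdet M = 1" "mtr M = -1" "vdet s (mvec M s) > 0"
  shows "ccw s (act M s) (act M (act M s))"
proof -
  define a where "a = mvec M s"
  have b: "mvec M a = - s - a" unfolding a_def by (rule mvec_cayley[OF assms(1,2)])
  have "vdet a (mvec M a) = vdet s a" using vdet_mvec[of M s a] assms(1) by (simp add: a_def)
  moreover have "vdet (mvec M a) s = vdet s a" unfolding b by (cases s; cases a)
    (simp add: algebra_simps)
  ultimately have c: "ccw s a (mvec M a)" using assms(3) by (simp add: ccw_def a_def)
  have "act M s = a \<or> act M s = - a" using act_cases[of M s] by (simp add: a_def)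
  moreover from this have "act M (act M s) = mvec M a \<or> act M (act M s) = - mvec M a"
    using act_cases[of M "act M s"] by (auto simp: mvec_uminus)
  ultimately show ?thesis using c by (auto simp: ccw_def)
qed

lemma madj_uminus: "madj (- M) = - madj M"
  by (cases M) simp

context labelled_pairing
begin

lemma labels_ok_perm:
  assumes "labels_ok w" "distinct w'" "set w' = set w"
  shows "labels_ok w'"
proof -
  have "length w' = length w" using assms by (metis distinct_card labels_ok_def)
  then show ?thesis using assms(1,2) unfolding labels_ok_def mate_closed_def assms(3) by metis
qed

lemma gluable_perm: "set w' = set w \<Longrightarrow> gluable w' = gluable w"
  by (simp add: fun_eq_iff gluable_def)

lemma good_mdet: "good w st en g \<Longrightarrow> l \<in> set w \<Longrightarrow> mdet (g l) = 1"
  unfolding good_def gluable_def glue_def by blast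

lemma good_slide:
  assumes good: "good (b # c # X @ mate b # Y) st en g" and "mate b \<noteq> b" and h: "h = g (mate b)"
  shows "good (b # X @ c # mate b # Y) (slide_st b c h st en) (slide_en b c h en) (slide_g c h g)"
proof -
  let ?w = "b # c # X @ mate b # Y"
  have lab: "labels_ok ?w" "polygon ?w st en" using good by (auto simp: good_def)
  then have dis: "distinct ?w" and mm: "mate (mate b) = b" and mu: "mu (mate b) = 0"
    using assms(2) by (auto simp: labels_ok_def mate_closed_def)
  have "glue (mu (mate b)) h (st (mate b), en (mate b)) (st b, en b)"
    using good mm unfolding good_def gluable_def h by (metis in_set_conv_decomp append_Cons)
  then have g: "mdet h = 1" "act h (en b) = st (mate b)" "act h (st b) = en (mate b)"
    using mu by (auto simp: glue_def)
  have "gluable ?w (slide_st b c h st en) (slide_en b c h en) (slide_g c h g)"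
    using dis by (intro slide_gluable[OF good _ _ _ _ h refl]) auto
  moreover have sets: "set (b # X @ c # mate b # Y) = set ?w" by auto
  moreover have "labels_ok (b # X @ c # mate b # Y)"
    using dis by (intro labels_ok_perm[OF lab(1) _ sets]) auto
  ultimately show ?thesis
    using slide_polygon[OF lab(2) dis g] gluable_perm[OF sets] by (simp add: good_def)
qed

lemma good_spin:
  assumes good: "good (e # c # X) st en g" and e: "mate e = e" and h: "h = g e"
  shows "good (c # e # X) (slide_st e c h st en) (slide_en e c h en) (slide_g c h g)"
proof -
  let ?w = "e # c # X"
  have lab: "labels_ok ?w" "polygon ?w st en" using good by (auto simp: good_def)
  then have dis: "distinct ?w" and mu: "mu e \<in> {2, 3}" using e by (auto simp: labels_ok_def)
  have gl: "glue (mu e) h (st e, en e) (st e, en e)"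
    using good e unfolding good_def gluable_def h by (metis list.set_intros(1))
  then have d: "mdet h = 1" and s: "act h (en e) = st e" by (auto simp: glue_def split: if_splits)
  have pr: "prim (st e)" "prim (en e)" using good_arc_ok[OF good, of e] by (auto simp: arc_ok_def)
  \<comment> \<open>For order \<open>3\<close>, \<open>h\<close> rotates the triangle on
    \<open>e\<close> with third vertex \<open>t\<close>, so the polygon side of \<open>e\<close>
    goes to the part between \<open>st e\<close> and \<open>t\<close>. For order \<open>2\<close>,
    \<open>h\<close> exchanges the ends of \<open>e\<close> and hence its two sides.\<close>
  have out: "ccw (st e) (act h u) (en e)" if u: "prim u" "ccw (st e) (en e) u" for u
  proof (cases "mu e = 3")
    case True
    have tr: "mtr h = -1" "vdet (en e) (mvec h (en e)) > 0" using gl True by (auto simp: glue_def)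
    define t where "t = act h (st e)"
    have "ccw (en e) u (st e)" using u(2) ccw_rotate by blast
    then have "ccw (st e) (act h u) t" using ccw_act[OF d, of "en e" u "st e"] s by
      (simp add: t_def)
    moreover have "ccw (en e) (st e) t" using order3_ccw[OF d tr] s by (simp add: t_def)
    then have "ccw (st e) t (en e)" using ccw_rotate by blast
    ultimately show ?thesis
      using ccw_trans(1)[of "st e" "act h u" t "en e"] pr prim_act[OF d] u(1) by (simp add: t_def)
  next
    case False
    then have "act h (st e) = en e" using gl by (auto simp: glue_def)
    then have "ccw (en e) (st e) (act h u)" using ccw_act[OF d, of "st e" "en e" u] s u(2) by simp
    then show ?thesis using ccw_rotate by blast
  qed
  have "gluable ?w (slide_st e c h st en) (slide_en e c h en) (slide_g c h g)"
    using dis e h by (intro slide_gluable[OF good _ _ _ _ _ refl]) auto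
  moreover have sets: "set (c # e # X) = set ?w" by auto
  moreover have "labels_ok (c # e # X)"
    using dis by (intro labels_ok_perm[OF lab(1) _ sets]) auto
  ultimately show ?thesis
    using spin_polygon[OF lab(2) dis e d s out] gluable_perm[OF sets] by (simp add: good_def)
qed

end

section \<open>States of the search as finite data\<close>

text \<open>
  An entry consists of a letter, its mate, its elliptic order and the side that it currently
  denotes.
\<close>

type_synonym 'l entry = "'l \<times> 'l \<times> nat \<times> iarc"

text \<open>The first matching entry wins. The default is no arc at all; looking up the mate of a
  letter never meets it as long as the letters are closed under \<open>mate\<close>.\<close>

definition lookup :: "'l \<Rightarrow> 'l entry list \<Rightarrow> iarc" where
  "lookup l s = foldr (\<lambda>y acc. if fst y = l then snd (snd (snd y)) else acc) s ((0, 0), (0, 0))"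

definition map_arc :: "(iarc \<Rightarrow> iarc) \<Rightarrow> 'l entry \<Rightarrow> 'l entry" where
  "map_arc f y = (fst y, fst (snd y), fst (snd (snd y)), f (snd (snd (snd y))))"

definition act_arc :: "imat \<Rightarrow> iarc \<Rightarrow> iarc" where
  "act_arc M a = (act M (fst a), act M (snd a))"

text \<open>The image of \<open>ec\<close> is inserted directly before the mate of
  \<open>eb\<close>. If \<open>eb\<close> is its own mate, this exchanges the two entries, so slides
  and spins share the formula.\<close>

definition slide_entry :: "imat \<Rightarrow> 'l entry \<Rightarrow> 'l entry \<Rightarrow> 'l entry \<Rightarrow> 'l entry list" where
  "slide_entry h eb ec y =
     (let u = snd (snd (snd (snd ec)));
          y' = map_arc (\<lambda>a. (if fst y = fst (snd eb) then act h u else fst a,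
                             if fst y = fst eb then u else snd a)) y
      in if fst y = fst (snd eb) then [map_arc (act_arc h) ec, y'] else [y'])"

text \<open>
  The gluing matrix \<open>h\<close> is not computed but guessed by the search, and only checked here. If the
  moved side is the base side, the whole polygon is translated back, which keeps the side \<open>(\<infinity>, 0)\<close>
  in place.
\<close>

definition slide_entries :: "'l \<Rightarrow> imat \<Rightarrow> 'l entry list \<Rightarrow> 'l entry list" where
  "slide_entries base h s = (case s of [] \<Rightarrow> s | eb # s' \<Rightarrow> (case s' of [] \<Rightarrow> s | ec # R \<Rightarrow>
     if fst eb \<noteq> base \<and> fst (snd eb) \<noteq> base \<and> fst ec \<noteq> fst (snd eb) \<and>
        glue (fst (snd (snd eb))) h (lookup (fst (snd eb)) s) (snd (snd (snd eb)))
     then map (\<lambda>y. if fst ec = base then map_arc (act_arc (madj h)) y else y)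
            (concat (map (slide_entry h eb ec) (eb # R)))
     else s))"

text \<open>A nonzero tag requests a slide or spin with the guessed matrix. Illegal or badly guessed
  moves leave the state unchanged, so any list of tags and matrices is a legitimate run.\<close>

definition move_entries :: "'l \<Rightarrow> nat \<times> imat \<Rightarrow> 'l entry list \<Rightarrow> 'l entry list" where
  "move_entries base m s = (if fst m = 0 then (case s of [] \<Rightarrow> [] | x # xs \<Rightarrow> xs @ [x])
     else slide_entries base (snd m) s)"

definition run_moves :: "'l \<Rightarrow> (nat \<times> imat) list \<Rightarrow> 'l entry list \<Rightarrow> 'l entry list" where
  "run_moves base ms s = foldl (\<lambda>s m. move_entries base m s) s ms"

text \<open>Does nothing if no block is in front, so that reaching the empty list by iteration
  certifies a product of blocks. The number of iterations is part of what the search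
  guesses.\<close>

definition chop :: "'l entry list \<Rightarrow> 'l entry list" where
  "chop s = (case s of [] \<Rightarrow> s | a # s1 \<Rightarrow>
     if fst a = fst (snd a) then s1 else (case s1 of [] \<Rightarrow> s | b # s2 \<Rightarrow>
       if fst b = fst (snd a) then s2 else (case s2 of [] \<Rightarrow> s | c # s3 \<Rightarrow>
         (case s3 of [] \<Rightarrow> s | d # s4 \<Rightarrow>
         if fst b \<noteq> fst (snd b) \<and> fst c = fst (snd a) \<and> fst d = fst (snd b) then s4 else s))))"

context labelled_pairing
begin

definition state :: "'l list \<Rightarrow> ('l \<Rightarrow> ivec) \<Rightarrow> ('l \<Rightarrow> ivec) \<Rightarrow> 'l entry list" where
  "state w st en = map (\<lambda>l. (l, mate l, mu l, (st l, en l))) w"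

lemma lookup_state: "l \<in> set w \<Longrightarrow> lookup l (state w st en) = (st l, en l)"
  by (induction w) (auto simp: lookup_def state_def)

definition slide_word :: "'l \<Rightarrow> 'l \<Rightarrow> 'l list \<Rightarrow> 'l list" where
  "slide_word b c R = concat (map (\<lambda>l. if l = mate b then [c, l] else [l]) (b # R))"

lemma concat_if_notin: "x \<notin> set R \<Longrightarrow> concat (map (\<lambda>l. if l = x then [c, l] else [l]) R) = R"
  by (induction R) auto

lemma slide_word_spin: "mate b = b \<Longrightarrow> b \<notin> set R \<Longrightarrow> slide_word b c R = c # b # R"
  by (simp add: slide_word_def concat_if_notin)

lemma slide_word_slide:
  "mate b \<noteq> b \<Longrightarrow> mate b \<notin> set X \<union> set Y \<Longrightarrow> slide_word b c (X @ mate b # Y) = b # X @ c # mate b # Y"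
  by (simp add: slide_word_def concat_if_notin)

text \<open>States store no gluing matrices, hence the existential quantifier; the group and the
  position of the base side are what every move has to preserve.\<close>

definition invariant :: "(rat^2^2) set set \<Rightarrow> 'l list \<Rightarrow> ('l \<Rightarrow> ivec) \<Rightarrow> ('l \<Rightarrow> ivec) \<Rightarrow> bool" where
  "invariant G w st en \<longleftrightarrow> (\<exists>g. good w st en g \<and> psl_gen (g ` set w) = G \<and> st base = (1, 0) \<and> en base
    = (0, 1))"

lemma invariant_rotate: "invariant G (x # w) st en \<Longrightarrow> invariant G (w @ [x]) st en"
proof -
  assume "invariant G (x # w) st en"
  then obtain g where g: "good (x # w) st en g" "psl_gen (g ` set (x # w)) = G" "st base = (1, 0)"
    "en base = (0, 1)"
    unfolding invariant_def by blast
  have "set (w @ [x]) = set (x # w)" by auto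
  then show ?thesis using good_rotate[OF g(1)] g(2-4) unfolding invariant_def by metis
qed

lemma good_slide_word:
  assumes good: "good (b # c # R) st en g" and c: "c \<noteq> mate b" and h: "h = g (mate b)"
  shows "good (slide_word b c R) (slide_st b c h st en) (slide_en b c h en) (slide_g c h g)"
    "set (slide_word b c R) = set (b # c # R)"
proof -
  have lab: "distinct (b # c # R)" "mate b \<in> set (b # c # R)"
    using good by (auto simp: good_def labels_ok_def mate_closed_def)
  have "good (slide_word b c R) (slide_st b c h st en) (slide_en b c h en) (slide_g c h g) \<and>
    set (slide_word b c R) = set (b # c # R)"
  proof (cases "mate b = b")
    case True
    then show ?thesis using good_spin[OF good True] h lab by (auto simp: slide_word_spin)
  next
    case False
    then have "mate b \<in> set R" using lab c by auto
    then obtain X Y where R: "R = X @ mate b # Y" by (meson split_list)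
    have "slide_word b c R = b # X @ c # mate b # Y" using lab R False by
      (simp add: slide_word_slide)
    then show ?thesis using good_slide[of b c X Y st en g h] good R False h by auto
  qed
  then show "good (slide_word b c R) (slide_st b c h st en) (slide_en b c h en) (slide_g c h g)"
    "set (slide_word b c R) = set (b # c # R)" by auto
qed

lemma concat_slide_entry:
  assumes "c \<notin> set L" and c: "c \<noteq> b" "c \<noteq> mate b"
  shows "concat (map (slide_entry h (b, mate b, mu b, st b, en b) (c, mate c, mu c, st c, en c))
    (state L st en))
    = state (concat (map (\<lambda>l. if l = mate b then [c, l] else [l]) L)) (slide_st b c h st en)
      (slide_en b c h en)"
  using assms(1)
proof (induction L)
  case (Cons l L)
  have "slide_entry h (b, mate b, mu b, st b, en b) (c, mate c, mu c, st c, en c)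
    (l, mate l, mu l, st l, en l)
    = state (if l = mate b then [c, l] else [l]) (slide_st b c h st en) (slide_en b c h en)"
    using Cons.prems c by (auto simp: slide_entry_def Let_def state_def map_arc_def act_arc_def
      slide_st_def slide_en_def)
  then show ?case using Cons by (simp add: state_def)
qed (simp add: state_def)

lemma slide_entries_state:
  assumes inv: "invariant G (b # c # R) st en" and g: "b \<noteq> base" "mate b \<noteq> base" "c \<noteq> mate b"
    and gl: "glue (mu b) h (st (mate b), en (mate b)) (st b, en b)"
  obtains st' en' where "slide_entries base h (state (b # c # R) st en) = state (slide_word b c R)
    st' en'"
    "invariant G (slide_word b c R) st' en'"
proof -
  let ?w = "b # c # R"
  obtain g where good: "good ?w st en g" and G: "psl_gen (g ` set ?w) = G" and bs:
    "st base = (1, 0)" "en base = (0, 1)"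
    using inv by (auto simp: invariant_def)
  have lab: "distinct ?w" "mate b \<in> set ?w" "mate (mate b) = b"
    "if mate b = b then mu b \<in> {2, 3} else mu b = 0"
      "if mate (mate b) = mate b then mu (mate b) \<in> {2, 3} else mu (mate b) = 0" "base \<in> set ?w"
    using good by (auto simp: good_def labels_ok_def mate_closed_def)
  have mu: "mu (mate b) = mu b" using lab(3-5) by (cases "mate b = b") auto
  have "glue (mu (mate b)) (g (mate b)) (st (mate b), en (mate b)) (st b, en b)"
    using good lab(2,3) unfolding good_def gluable_def by metis
  \<comment> \<open>The guess agrees with the true gluing matrix up to sign, and the sign does not
    affect the action on arcs; the proof continues with the true matrix.\<close>
  then have "h = g (mate b) \<or> h = - g (mate b)"
    using gl mu good_arc_ok[OF good] lab by (intro glue_unique[of "mu b"]) auto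
  then have act: "act h = act (g (mate b))" "act (madj h) = act (madj (g (mate b)))"
    by (elim disjE; simp only: act_uminus madj_uminus)+
  define \<delta> where "\<delta> = g (mate b)"
  have d: "mdet \<delta> = 1" unfolding \<delta>_def by (rule good_mdet[OF good lab(2)])
  define st1 where "st1 = slide_st b c \<delta> st en"
  define en1 where "en1 = slide_en b c \<delta> en"
  define g1 where "g1 = slide_g c \<delta> g"
  have good1: "good (slide_word b c R) st1 en1 g1" and set1: "set (slide_word b c R) = set ?w"
    using good_slide_word[OF good g(3) \<delta>_def] unfolding st1_def en1_def g1_def by blast+
  have G1: "psl_gen (g1 ` set ?w) = G"
    unfolding g1_def G[symmetric] by (rule slide_group[OF good _ _ _ g(3) \<delta>_def])
      (use lab(1) in auto)
  have st1: "slide_st b c h st en = st1" "slide_en b c h en = en1"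
    by (simp_all add: st1_def en1_def slide_st_def slide_en_def act \<delta>_def)
  have arcs: "lookup (mate b) (state ?w st en) = (st (mate b), en (mate b))"
    using lab(2) by (rule lookup_state)
  have eq: "slide_entries base h (state ?w st en) =
    map (\<lambda>y. if c = base then map_arc (act_arc (madj h)) y else y)
      (state (slide_word b c R) st1 en1)"
  proof -
    have "concat (map (slide_entry h (b, mate b, mu b, st b, en b) (c, mate c, mu c, st c, en c))
      (state (b # R) st en))
        = state (slide_word b c R) st1 en1"
      unfolding slide_word_def st1[symmetric] using lab(1) g by (intro concat_slide_entry) auto
    moreover define eb where "eb = (b, mate b, mu b, st b, en b)"
    moreover define ec where "ec = (c, mate c, mu c, st c, en c)"
    moreover have st_eq: "state ?w st en = eb # ec # state R st en"
      "state (b # R) st en = eb # state R st en"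
      by (simp_all add: state_def eb_def ec_def)
    moreover have guard: "fst eb \<noteq> base \<and> fst (snd eb) \<noteq> base \<and> fst ec \<noteq> fst (snd eb) \<and>
      glue (fst (snd (snd eb))) h (lookup (fst (snd eb)) (eb # ec # state R st en))
        (snd (snd (snd eb)))"
      using g gl arcs unfolding st_eq by (simp add: eb_def ec_def)
    moreover have "slide_entries base h (eb # ec # state R st en) =
      map (\<lambda>y. if fst ec = base then map_arc (act_arc (madj h)) y else y)
        (concat (map (slide_entry h eb ec) (eb # state R st en)))"
      unfolding slide_entries_def list.case by (rule if_P[OF guard])
    ultimately show ?thesis by (simp only: fst_conv)
  qed
  show ?thesis
  proof (cases "c = base")
    case False
    have "st1 base = (1, 0)" "en1 base = (0, 1)"
      using False g bs by (simp_all add: st1_def en1_def slide_st_def slide_en_def)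
    then have "invariant G (slide_word b c R) st1 en1"
      using good1 G1 unfolding set1[symmetric] invariant_def by blast
    then show ?thesis using eq False that[of st1 en1] by (simp add: state_def)
  next
    case True
    define A where "A = madj \<delta>"
    have "mate (mate c) = c" using good by (auto simp: good_def labels_ok_def mate_closed_def)
    then have "mate b \<noteq> mate c" using lab(1,3) by auto
    \<comment> \<open>The slide leaves the matrix of \<open>mate b\<close> alone, so the corrective
      translation is by the inverse of a generator of the new symbol, as
      \<open>translate_group\<close> requires.\<close>
    then have "\<delta> = g1 (mate b)"
      using g(3) by (simp add: g1_def slide_g_def \<delta>_def)
    then have A: "A = madj (g1 (mate b))" by (simp add: A_def)
    have dA: "mdet A = 1" using d by (simp add: A_def)
    have good2: "good (slide_word b c R) (act A \<circ> st1) (act A \<circ> en1) (conj_g A g1)"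
      by (rule translate_good[OF good1 dA])
    have "psl_gen (conj_g A g1 ` set (slide_word b c R)) = G"
      using translate_group[OF good1 _ A] lab(2) G1 set1 by simp
    moreover have "(act A \<circ> st1) base = (1, 0)" "(act A \<circ> en1) base = (0, 1)"
    proof -
      have "prim (1, 0)" "prim (0, 1)" by (auto simp: prim_def)
      moreover have "st1 base = act \<delta> (1, 0)" "en1 base = act \<delta> (0, 1)"
        using True g bs by (simp_all add: st1_def en1_def slide_st_def slide_en_def)
      ultimately show "(act A \<circ> st1) base = (1, 0)" "(act A \<circ> en1) base = (0, 1)"
        using act_madj[OF d] by (simp_all add: A_def)
    qed
    ultimately have "invariant G (slide_word b c R) (act A \<circ> st1) (act A \<circ> en1)"
      using good2 unfolding invariant_def by blast
    moreover have "slide_entries base h (state ?w st en) = state (slide_word b c R) (act A \<circ> st1)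
      (act A \<circ> en1)"
      unfolding eq using True by (simp add: state_def map_arc_def act_arc_def act(2) A_def \<delta>_def)
    ultimately show ?thesis using that by blast
  qed
qed

section \<open>Soundness and completeness of the runs\<close>

lemma move_entries_sound:
  assumes "invariant G w st en"
  obtains w' st' en' where "move_entries base m (state w st en) = state w' st' en'"
    "invariant G w' st' en'"
    "set w' = set w"
proof (cases "fst m = 0")
  case True
  show ?thesis
  proof (cases w)
    case (Cons x v)
    then show ?thesis
      using True assms invariant_rotate[of G x v st en]
      by (intro that[of "v @ [x]" st en]) (auto simp: move_entries_def state_def)
  qed (use True assms that[of w st en] in \<open>auto simp: move_entries_def state_def\<close>)
next
  case False
  obtain b c R where w: "w = b # c # R"
  proof -
    have "2 \<le> length w" using assms by (auto simp: invariant_def good_def labels_ok_def)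
    then show ?thesis using that by (cases w; cases "tl w") auto
  qed
  have mb: "mate b \<in> set w" using assms w by (auto simp: invariant_def good_def labels_ok_def
    mate_closed_def)
  show ?thesis
  proof (cases "b \<noteq> base \<and> mate b \<noteq> base \<and> c \<noteq> mate b \<and>
      glue (mu b) (snd m) (st (mate b), en (mate b)) (st b, en b)")
    case True
    have "invariant G (b # c # R) st en" using assms w by simp
    then obtain st' en' where *: "slide_entries base (snd m) (state w st en) = state
      (slide_word b c R) st' en'"
      "invariant G (slide_word b c R) st' en'"
      using slide_entries_state[of G b c R st en "snd m"] True w by metis
    moreover have "set (slide_word b c R) = set w"
    proof -
      obtain g where "good (b # c # R) st en g" using assms w unfolding invariant_def by blast
      then show ?thesis using good_slide_word(2)[of b c R st en g] True w by blast
    qed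
    ultimately show ?thesis using that False by (simp add: move_entries_def)
  next
    case no: False
    have "slide_entries base (snd m) (state w st en) = state w st en"
      using no lookup_state[OF mb, of st en] w by (auto simp: slide_entries_def state_def)
    then show ?thesis using that[of w st en] assms False by (simp add: move_entries_def)
  qed
qed

lemma run_moves_sound:
  assumes "invariant G w st en"
  obtains w' st' en' where "run_moves base ms (state w st en) = state w' st' en'"
    "invariant G w' st' en'"
    "set w' = set w"
proof -
  have "\<exists>w' st' en'. run_moves base ms (state w st en) = state w' st' en' \<and> invariant G w' st' en' \<and>
    set w' = set w"
    using assms
  proof (induction ms arbitrary: w st en)
    case Nil
    then show ?case by (auto simp: run_moves_def)
  next
    case (Cons m ms)
    obtain w' st' en' where "move_entries base m (state w st en) = state w' st' en'"
      "invariant G w' st' en'"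
      "set w' = set w" using move_entries_sound[OF Cons.prems] by metis
    then show ?case using Cons.IH[of w' st' en'] by (simp add: run_moves_def)
  qed
  then show ?thesis using that by blast
qed

text \<open>The right guess for a slide or spin is the gluing matrix of
  \<open>mate b\<close>.\<close>

lemma move_entries_complete:
  assumes inv: "invariant G w st en" and "move w w'"
  obtains m st' en' where "move_entries base m (state w st en) = state w' st' en'"
    "invariant G w' st' en'"
proof -
  note finish = that
  have sl: thesis if bc: "w = b # c # R" "b \<noteq> base" "mate b \<noteq> base" "c \<noteq> mate b"
    "w' = slide_word b c R" for b c R
  proof -
    obtain g where good: "good w st en g" using inv by (auto simp: invariant_def)
    have lab: "mate b \<in> set w" "mate (mate b) = b" "if mate b = b then mu b \<in> {2, 3} else mu b = 0"
      "if mate (mate b) = mate b then mu (mate b) \<in> {2, 3} else mu (mate b) = 0"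
      using good bc by (auto simp: good_def labels_ok_def mate_closed_def)
    have "glue (mu b) (g (mate b)) (st (mate b), en (mate b)) (st b, en b)"
      using good lab unfolding good_def gluable_def by metis
    then obtain st' en' where "slide_entries base (g (mate b)) (state w st en) = state w' st' en'"
      "invariant G w' st' en'"
      using slide_entries_state[of G b c R st en "g (mate b)"] inv bc by metis
    then show ?thesis by (intro finish[of "(1, g (mate b))" st' en'])
      (simp_all add: move_entries_def)
  qed
  have dis: "distinct w" using inv by (auto simp: invariant_def good_def labels_ok_def)
  from assms(2) show ?thesis
  proof cases
    case (rot x v)
    then show ?thesis
      using inv invariant_rotate[of G x v st en]
      by (intro that[of "(0, undefined)" st en]) (auto simp: move_entries_def state_def)
  next
    case (slide b c X Y)
    then show ?thesis using dis by (intro sl[of b c "X @ mate b # Y"]) (auto simp: slide_word_slide)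
  next
    case (spin e c X)
    then show ?thesis using dis by (intro sl[of e c X]) (auto simp: slide_word_spin)
  qed
qed

lemma run_moves_complete:
  assumes "reach w w'" "invariant G w st en"
  shows "\<exists>ms st' en'. run_moves base ms (state w st en) = state w' st' en' \<and> invariant G w' st' en'"
  using assms
proof (induction rule: rtranclp_induct)
  case base
  then show ?case by (intro exI[of _ "[]"]) (auto simp: run_moves_def)
next
  case (step y z)
  then obtain ms st1 en1 where 1: "run_moves base ms (state w st en) = state y st1 en1"
    "invariant G y st1 en1"
    by blast
  obtain m st2 en2 where "move_entries base m (state y st1 en1) = state z st2 en2"
    "invariant G z st2 en2"
    using move_entries_complete[OF 1(2) step(2)] .
  then show ?case using 1(1) by (intro exI[of _ "ms @ [m]"]) (auto simp: run_moves_def)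
qed

lemma chop_sound: "(chop ^^ k) (state w st en) = [] \<Longrightarrow> blocks w"
proof (induction k arbitrary: w)
  case 0
  then show ?case by (auto simp: state_def intro: blocks.Nil)
next
  case (Suc k)
  have "\<exists>w'. chop (state w st en) = state w' st en \<and> (blocks w' \<longrightarrow> blocks w)"
  proof (cases w)
    case Nil
    then show ?thesis by (auto simp: chop_def state_def)
  next
    case (Cons a w1)
    show ?thesis
    proof (cases "mate a = a")
      case True
      then show ?thesis using Cons by (intro exI[of _ w1])
        (auto simp: chop_def state_def intro: blocks.ell)
    next
      case na: False
      show ?thesis
      proof (cases w1)
        case Nil
        then show ?thesis using Cons na by (intro exI[of _ w]) (auto simp: chop_def state_def)
      next
        case w1: (Cons b w2)
        show ?thesis
        proof (cases "b = mate a")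
          case True
          then show ?thesis using Cons w1 na by (intro exI[of _ w2])
            (auto simp: chop_def state_def intro: blocks.pair)
        next
          case nb: False
          show ?thesis
          proof (cases "\<exists>w4. w2 = mate a # mate b # w4 \<and> mate b \<noteq> b")
            case True
            then obtain w4 where "w2 = mate a # mate b # w4" "mate b \<noteq> b" by blast
            then show ?thesis using Cons w1 na nb
              by (intro exI[of _ w4]) (auto simp: chop_def state_def intro: blocks.handle)
          next
            case False
            have "chop (state w st en) = state w st en"
            proof (cases w2)
              case w2: (Cons c w3)
              then show ?thesis using False Cons w1 na nb by (cases w3)
                (auto simp: chop_def state_def)
            qed (use Cons w1 na nb in \<open>auto simp: chop_def state_def\<close>)
            then show ?thesis by blast
          qed
        qed
      qed
    qed
  qed
  then show ?case using Suc by (metis funpow_simps_right(2) o_apply)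
qed

text \<open>Distinctness prevents misreadings: the second letter of a handle is not the mate of the
  first, so \<open>chop\<close> does not take it for a pair.\<close>

lemma chop_complete:
  assumes "blocks w" "distinct w"
  shows "\<exists>k. (chop ^^ k) (state w st en) = []"
proof -
  have step: "\<exists>k. (chop ^^ k) s = []" if "chop s = s'" "\<exists>k. (chop ^^ k) s' = []" for s s' ::
    "'l entry list"
    using that by (metis funpow_simps_right(2) o_apply)
  show ?thesis
    using assms
  proof induction
    case Nil
    then show ?case by (intro exI[of _ 0]) (simp add: state_def)
  next
    case (ell e w)
    have "chop (state (e # w) st en) = state w st en"
      using ell.hyps ell.prems by (simp add: chop_def state_def)
    moreover have "\<exists>k. (chop ^^ k) (state w st en) = []" using ell.IH ell.prems by simp
    ultimately show ?case by (rule step)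
  next
    case (pair a w)
    have "chop (state (a # mate a # w) st en) = state w st en"
      using pair.hyps pair.prems by (simp add: chop_def state_def)
    moreover have "\<exists>k. (chop ^^ k) (state w st en) = []" using pair.IH pair.prems by simp
    ultimately show ?case by (rule step)
  next
    case (handle a b w)
    have "chop (state (a # b # mate a # mate b # w) st en) = state w st en"
      using handle.hyps handle.prems by (simp add: chop_def state_def)
    moreover have "\<exists>k. (chop ^^ k) (state w st en) = []" using handle.IH handle.prems by simp
    ultimately show ?case by (rule step)
  qed
qed

end

section \<open>The algorithm\<close>

text \<open>The definitions by pattern matching are restated through projections, for which there
  are computability rules.\<close>

lemma mvec_conv:
  "mvec M v = (fst M * fst v + fst (snd M) * snd v, fst (snd (snd M)) * fst v + snd (snd (snd M)) *
    snd v)"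
  by (cases M; cases v) simp

lemma mdet_conv: "mdet M = fst M * snd (snd (snd M)) - fst (snd M) * fst (snd (snd M))"
  by (cases M) simp

lemma mtr_conv: "mtr M = fst M + snd (snd (snd M))"
  by (cases M) simp

lemma madj_conv: "madj M = (snd (snd (snd M)), - fst (snd M), - fst (snd (snd M)), fst M)"
  by (cases M) simp

lemma vdet_conv: "vdet u v = fst u * snd v - snd u * fst v"
  by (cases u; cases v) simp

lemma computable_madj [computable_intros]: "computable f \<Longrightarrow> computable (\<lambda>x. madj (f x))"
  unfolding madj_conv by (intro computable_intros)

lemma computable_mvec [computable_intros]:
  "computable f \<Longrightarrow> computable g \<Longrightarrow> computable (\<lambda>x. mvec (f x) (g x))"
  unfolding mvec_conv by (intro computable_intros)

lemma computable_act [computable_intros]: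
  assumes "computable f" "computable g"
  shows "computable (\<lambda>x. act (f x) (g x))"
proof -
  have "computable nrm" unfolding nrm_def[abs_def] by (intro computable_intros)
  from computable_comp[OF this computable_mvec[OF assms]] show ?thesis unfolding act_def .
qed

lemma computable_glue:
  assumes "computable m" "computable f" "computable a" "computable b"
  shows "computable (\<lambda>x. glue (m x) (f x) (a x) (b x))"
  unfolding glue_def mdet_conv mtr_conv vdet_conv using assms by (intro computable_intros)

lemma computable_lookup [computable_intros]:
  fixes f :: "'a::encodable \<Rightarrow> 'l::encodable"
  assumes "computable f" "computable s"
  shows "computable (\<lambda>x. lookup (f x) (s x))"
  unfolding lookup_def by (intro computable_intros computable_comp[OF assms(1)] assms(2))

lemma computable_slide_entry:
  fixes eb :: "'a::encodable \<Rightarrow> 'l::encodable entry"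
  assumes "computable \<gamma>" "computable eb" "computable ec" "computable y"
  shows "computable (\<lambda>x. slide_entry (\<gamma> x) (eb x) (ec x) (y x))"
  unfolding slide_entry_def Let_def map_arc_def act_arc_def using assms by (intro computable_intros)

lemma computable_slide_entries:
  fixes s :: "'a::encodable \<Rightarrow> 'l::encodable entry list"
  assumes "computable \<gamma>" "computable s"
  shows "computable (\<lambda>x. slide_entries base (\<gamma> x) (s x))"
  unfolding slide_entries_def map_arc_def act_arc_def
  by (intro computable_intros computable_glue computable_slide_entry
      computable_comp[OF assms(1)] computable_comp[OF assms(2)] assms)

lemma computable_run_moves:
  fixes s :: "'a::encodable \<Rightarrow> 'l::encodable entry list"
  assumes "computable ms" "computable s"
  shows "computable (\<lambda>x. run_moves base (ms x) (s x))"
  unfolding run_moves_def move_entries_def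
  by (intro computable_intros computable_slide_entries assms)

lemma computable_chop:
  fixes s :: "'a::encodable \<Rightarrow> 'l::encodable entry list"
  assumes "computable s"
  shows "computable (\<lambda>x. chop (s x))"
proof -
  have "computable (chop :: 'l entry list \<Rightarrow> _)"
    unfolding chop_def[abs_def] by (intro computable_intros)
  from computable_comp[OF this assms] show ?thesis .
qed

lemma computable_chop_funpow:
  fixes s :: "'a::encodable \<Rightarrow> 'l::encodable entry list"
  assumes "computable k" "computable s"
  shows "computable (\<lambda>x. (chop ^^ k x) (s x))"
proof -
  have "computable (\<lambda>x. rec_nat (s x) (\<lambda>_ y. chop y) (k x))"
    by (intro computable_intros computable_chop assms)
  moreover have "rec_nat t (\<lambda>_ y. chop y) n = (chop ^^ n) t" for n and t :: "'l entry list"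
    by (induction n) auto
  ultimately show ?thesis by simp
qed

text \<open>The initial sides serve as letters, that is, as names that stay fixed while the sides
  they denote change.\<close>

definition entries_of_triples :: "(iarc \<times> iarc \<times> nat) list \<Rightarrow> iarc entry list" where
  "entries_of_triples x = map (\<lambda>t. (fst t, fst (snd t), snd (snd t), fst t)) x"

text \<open>The mate of a letter is only a name, so the side that it currently denotes has to be
  looked up.\<close>

definition triples_of_entries :: "'l entry list \<Rightarrow> (iarc \<times> iarc \<times> nat) list" where
  "triples_of_entries s = map (\<lambda>y. (snd (snd (snd y)), lookup (fst (snd y)) s, fst (snd (snd y))))
    s"

lemma computable_entries_of_triples:
  "computable x \<Longrightarrow> computable (\<lambda>p. entries_of_triples (x p))"
  unfolding entries_of_triples_def by (intro computable_intros)

lemma computable_triples_of_entries: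
  fixes s :: "'a::encodable \<Rightarrow> 'l::encodable entry list"
  assumes "computable s"
  shows "computable (\<lambda>x. triples_of_entries (s x))"
  unfolding triples_of_entries_def by (intro computable_intros computable_comp[OF assms] assms)

subsection \<open>Normalized words\<close>

lemma cyclic_subseq:
  assumes "in_cyclic_order [p, q, r, s] xs"
  obtains "subseq [p, q, r, s] xs" | "subseq [q, r, s, p] xs" | "subseq [r, s, p, q] xs" |
    "subseq [s, p, q, r] xs"
proof -
  obtain k where "subseq [p, q, r, s] (rotate k xs)" using assms by (auto simp: in_cyclic_order_def)
  moreover define m where "m = k mod length xs"
  ultimately have "subseq [p, q, r, s] (drop m xs @ take m xs)" by (simp add: rotate_drop_take)
  then obtain y1 y2 where y: "[p, q, r, s] = y1 @ y2" "subseq y1 (drop m xs)"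
    "subseq y2 (take m xs)"
    by (meson subseq_appendE)
  then have "subseq (y2 @ y1) (take m xs @ drop m xs)" by (intro list_emb_append_mono)
  then have sub: "subseq (y2 @ y1) xs" by simp
  have "y2 @ y1 \<in> {[p, q, r, s], [q, r, s, p], [r, s, p, q], [s, p, q, r]}"
    using y(1) by (auto simp: Cons_eq_append_conv)
  then show ?thesis using sub that by auto
qed

lemma subseq4_nth:
  assumes "subseq [p, q, r, s] xs"
  obtains i j k l where "i < j" "j < k" "k < l" "l < length xs" "xs ! i = p" "xs ! j = q"
    "xs ! k = r" "xs ! l = s"
proof -
  obtain i j k l where "i < length xs" "xs ! i = p" "Suc i \<le> j" "xs ! j = q" "Suc j \<le> k"
    "xs ! k = r"
      "Suc k \<le> l" "l < length xs" "xs ! l = s"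
    using assms unfolding subseq_Cons_nth_iff[of p] subseq_Cons_drop_iff by blast
  then show ?thesis using that[of i j k l] by simp
qed

text \<open>However the cycle is cut open, \<open>q\<close> or \<open>s\<close> stays between
  \<open>p\<close> and \<open>r\<close>, so their indices differ by at least two.\<close>

lemma cyclic_order_separated:
  assumes "in_cyclic_order [p, q, r, s] xs"
  obtains i j where "i < length xs" "j < length xs" "xs ! i = p" "xs ! j = r"
    "Suc i < j \<or> Suc j < i"
  using assms
proof (cases rule: cyclic_subseq)
  case 1
  then obtain i j k l where "i < j" "j < k" "k < l" "l < length xs" "xs ! i = p" "xs ! k = r" by
    (rule subseq4_nth)
  then show ?thesis by (intro that[of i k]) auto
next
  case 2
  then obtain i j k l where "i < j" "j < k" "k < l" "l < length xs" "xs ! j = r" "xs ! l = p" by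
    (rule subseq4_nth)
  then show ?thesis by (intro that[of l j]) auto
next
  case 3
  then obtain i j k l where "i < j" "j < k" "k < l" "l < length xs" "xs ! i = r" "xs ! k = p" by
    (rule subseq4_nth)
  then show ?thesis by (intro that[of k i]) auto
next
  case 4
  then obtain i j k l where "i < j" "j < k" "k < l" "l < length xs" "xs ! j = p" "xs ! l = r" by
    (rule subseq4_nth)
  then show ?thesis by (intro that[of j l]) auto
qed

lemma in_cyclic_order_rotate1:
  assumes "in_cyclic_order (y # ys) xs"
  shows "in_cyclic_order (ys @ [y]) xs"
proof -
  obtain k where "subseq (y # ys) (rotate k xs)" using assms by (auto simp: in_cyclic_order_def)
  from list_emb_ConsD[OF this] obtain U V where UV: "rotate k xs = U @ y # V" "subseq ys V" by blast
  have "rotate (length (U @ [y])) (rotate k xs) = V @ (U @ [y])"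
    unfolding UV(1) using rotate_append[of "U @ [y]" V] by simp
  then have "rotate (length (U @ [y]) + k) xs = V @ (U @ [y])" by (simp add: rotate_rotate)
  moreover have "subseq [y] (U @ [y])" by (simp add: subseq_singleton_left)
  then have "subseq (ys @ [y]) (V @ (U @ [y]))" using UV(2) by (intro list_emb_append_mono)
  ultimately show ?thesis unfolding in_cyclic_order_def by metis
qed

lemma arc_index_nth:
  assumes "distinct (arcs F)" "i < length (arcs F)"
  shows "arc_index F (arcs F ! i) = i"
  unfolding arc_index_def using assms by (intro the_equality) (auto simp: nth_eq_iff_index_eq)

lemma linked_dist:
  assumes "linked F a b" "distinct (arcs F)"
  shows "\<bar>int (arc_index F a) - int (arc_index F (star F a))\<bar> \<ge> 2"
proof -
  obtain y z where "in_cyclic_order [a, y, star F a, z] (arcs F)" using assms(1) unfolding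
    linked_def by blast
  then obtain i j where "i < length (arcs F)" "j < length (arcs F)" "arcs F ! i = a"
    "arcs F ! j = star F a"
      "Suc i < j \<or> Suc j < i"
    by (rule cyclic_order_separated)
  moreover from this have "arc_index F a = i" "arc_index F (star F a) = j"
    using arc_index_nth[OF assms(2)] by metis+
  ultimately show ?thesis by auto
qed

context labelled_pairing
begin

text \<open>Locates the block of \<open>l\<close> within the whole word, because
  \<open>arc_index\<close> counts from the beginning of the boundary.\<close>

lemma blocks_cases:
  assumes "blocks w" "l \<in> set w"
  obtains "mate l = l"
    | a X Y where "w = X @ a # mate a # Y" "l = a \<or> l = mate a" "mate a \<noteq> a"
    | a b X Y where "w = X @ a # b # mate a # mate b # Y" "l = a \<or> l = b \<or> l = mate a \<or> l = mate b"
proof -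
  define Q where "Q v \<longleftrightarrow> mate l = l \<or> (\<exists>a X Y. v = X @ a # mate a # Y \<and> (l = a \<or> l = mate a) \<and> mate a
    \<noteq> a) \<or>
    (\<exists>a b X Y. v = X @ a # b # mate a # mate b # Y \<and> (l = a \<or> l = b \<or> l = mate a \<or> l = mate b))" for
      v
  have Q_append: "Q (u @ v)" if "Q v" for u v
    using that unfolding Q_def by (metis append.assoc)
  have "Q w"
    using assms
  proof (induction rule: blocks.induct)
    case (ell e w)
    show ?case
    proof (cases "l = e")
      case True
      then show ?thesis using ell by (simp add: Q_def)
    next
      case False
      then show ?thesis using ell Q_append[of w "[e]"] by simp
    qed
  next
    case (pair a w)
    show ?case
    proof (cases "l = a \<or> l = mate a")
      case True
      then show ?thesis using pair unfolding Q_def by (metis append_Nil)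
    next
      case False
      then show ?thesis using pair Q_append[of w "[a, mate a]"] by simp
    qed
  next
    case (handle a b w)
    show ?case
    proof (cases "l = a \<or> l = b \<or> l = mate a \<or> l = mate b")
      case True
      then show ?thesis unfolding Q_def by (metis append_Nil)
    next
      case False
      then show ?thesis using handle Q_append[of w "[a, b, mate a, mate b]"] by simp
    qed
  qed simp
  then show ?thesis using that unfolding Q_def by blast
qed

text \<open>A letter and its mate have index difference \<open>0\<close>, \<open>1\<close> or
  \<open>2\<close> according to the kind of block. Links need a difference of at least two, which
  excludes them in the first two kinds; in a handle the two pairs are linked with each
  other.\<close>

lemma normalized_if_blocks:
  assumes arcs: "arcs F = map h w" and inj: "inj_on h (set w)" and w: "distinct w" "mate_closed w"
    "blocks w"
    and star: "\<And>l. l \<in> set w \<Longrightarrow> star F (h l) = h (mate l)"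
  shows "normalized F"
  unfolding normalized_def
proof
  fix a assume "a \<in> set (arcs F)"
  then obtain l where l: "l \<in> set w" "a = h l" using arcs by auto
  have dis: "distinct (arcs F)" using arcs inj w by (simp add: distinct_map)
  have idx: "arc_index F (h x) = length X" if "w = X @ x # Y" for x X Y
  proof -
    have "arcs F ! length X = h x" "length X < length (arcs F)" using that arcs by
      (auto simp: nth_append)
    then show ?thesis using arc_index_nth[OF dis] by metis
  qed
  have len: "length (arcs F) = length w" using arcs by simp
  have not_linked: "\<not> linked F (h l) b"
    if "\<bar>int (arc_index F (h l)) - int (arc_index F (h (mate l)))\<bar> < 2" for b
    using linked_dist[OF _ dis, of "h l" b] that star[OF l(1)] by auto
  have mm: "mate (mate x) = x" if "x \<in> set w" for x using w(2) that by (auto simp: mate_closed_def)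
  from w(3) l(1) show "arc_dist F a (star F a) \<le> 2 \<and>
    (arc_dist F a (star F a) = 2 \<longleftrightarrow> (\<exists>b\<in>set (arcs F). linked F a b))"
  proof (cases rule: blocks_cases)
    case 1
    then have "arc_dist F a (star F a) = 0" using l star by (simp add: arc_dist_def)
    moreover have "\<not> linked F a b" for b using not_linked 1 l by simp
    ultimately show ?thesis by simp
  next
    case (2 x X Y)
    have "arc_index F (h x) = length X" "arc_index F (h (mate x)) = Suc (length X)"
      using idx[of X x "mate x # Y"] idx[of "X @ [x]" "mate x" Y] 2 by auto
    moreover have "mate (mate x) = x" using mm 2 by auto
    ultimately have d: "\<bar>int (arc_index F (h l)) - int (arc_index F (h (mate l)))\<bar> = 1" using 2(2)
      by auto
    then have "arc_dist F a (star F a) \<le> 1" using l star by (simp add: arc_dist_def Let_def)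
    moreover have "\<not> linked F a b" for b using not_linked d l by simp
    ultimately show ?thesis by auto
  next
    case (3 x y X Y)
    have ix: "arc_index F (h x) = length X" "arc_index F (h y) = length X + 1"
      "arc_index F (h (mate x)) = length X + 2" "arc_index F (h (mate y)) = length X + 3"
      using idx[of X x "y # mate x # mate y # Y"] idx[of "X @ [x]" y "mate x # mate y # Y"]
        idx[of "X @ [x, y]" "mate x" "mate y # Y"] idx[of "X @ [x, y, mate x]" "mate y" Y] 3 by auto
    have m: "mate (mate x) = x" "mate (mate y) = y" using mm 3 by auto
    have ins: "x \<in> set w" "y \<in> set w" "mate x \<in> set w" "mate y \<in> set w" using 3 by auto
    have ne: "h x \<noteq> h y" "h y \<noteq> h x" "h (mate x) \<noteq> h y" "h (mate y) \<noteq> h x"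
    proof -
      have "arc_index F (h x) \<noteq> arc_index F (h y)" "arc_index F (h (mate x)) \<noteq> arc_index F (h y)"
        "arc_index F (h (mate y)) \<noteq> arc_index F (h x)"
        unfolding ix by simp_all
      then show "h x \<noteq> h y" "h y \<noteq> h x" "h (mate x) \<noteq> h y" "h (mate y) \<noteq> h x" by metis+
    qed
    have sts: "star F (h x) = h (mate x)" "star F (h y) = h (mate y)" "star F (h (mate x)) = h x"
      "star F (h (mate y)) = h y" using star[OF ins(1)] star[OF ins(2)] star[OF ins(3)]
        star[OF ins(4)] m by simp_all
    have "\<bar>int (arc_index F (h l)) - int (arc_index F (h (mate l)))\<bar> = 2" using 3(2) ix m by auto
    \<comment> \<open>With at least four sides, going around the polygon the other way is not
      shorter than \<open>2\<close>.\<close>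
    moreover have "length w \<ge> 4" using 3 by simp
    ultimately have d: "arc_dist F a (star F a) = 2" using l star len by
      (simp add: arc_dist_def Let_def)
    have "subseq [h x, h y, h (mate x), h (mate y)] (arcs F)"
      unfolding arcs 3(1) by (auto intro!: list_emb_append2)
    then have c1: "in_cyclic_order [h x, h y, h (mate x), h (mate y)] (arcs F)"
      unfolding in_cyclic_order_def by (metis rotate0 id_apply)
    have c2: "in_cyclic_order [h y, h (mate x), h (mate y), h x] (arcs F)"
      using in_cyclic_order_rotate1[OF c1] by simp
    have c3: "in_cyclic_order [h (mate x), h (mate y), h x, h y] (arcs F)"
      using in_cyclic_order_rotate1[OF c2] by simp
    have c4: "in_cyclic_order [h (mate y), h x, h y, h (mate x)] (arcs F)"
      using in_cyclic_order_rotate1[OF c3] by simp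
    have "linked F (h x) (h y)" "linked F (h y) (h x)" "linked F (h (mate x)) (h y)"
      "linked F (h (mate y)) (h x)"
      unfolding linked_def sts using c1 c2 c3 c4 ne by auto
    moreover have "h x \<in> set (arcs F)" "h y \<in> set (arcs F)" using ins arcs by auto
    ultimately have "\<exists>b\<in>set (arcs F). linked F a b" using 3(2) l by auto
    then show ?thesis using d by simp
  qed
qed

end

section \<open>From symbols to states and back\<close>

definition vec_arc :: "arc \<Rightarrow> iarc" where
  "vec_arc a = (cusp_vec (fst a), cusp_vec (snd a))"

lemma cusp_arc_vec_arc [simp]: "cusp_arc (vec_arc a) = a"
  by (simp add: cusp_arc_def vec_arc_def)

lemma vec_arc_cusp_arc: "arc_ok a \<Longrightarrow> vec_arc (cusp_arc a) = a"
  by (simp add: cusp_arc_def vec_arc_def arc_ok_def)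

lemma vec_arc_inject [simp]: "vec_arc a = vec_arc b \<longleftrightarrow> a = b"
  by (metis cusp_arc_vec_arc)

lemma enc_cusp_vec: "enc (cusp_vec c) = cusp_code c"
  by (cases c) (auto simp: cusp_vec_def enc_int_def enc_prod_def)

lemma enc_vec_arc: "enc (vec_arc a) = arc_code a"
  by (simp add: vec_arc_def arc_code_def enc_cusp_vec)

definition ell_order :: "farey_data \<Rightarrow> arc \<Rightarrow> nat" where
  "ell_order F a = (if a \<in> ell_arcs F then mu_ell F a else 0)"

definition symbol_triples :: "farey_data \<Rightarrow> (iarc \<times> iarc \<times> nat) list" where
  "symbol_triples F = map (\<lambda>a. (vec_arc a, vec_arc (star F a), ell_order F a)) (arcs F)"

lemma symbol_code_eq: "symbol_code F = enc (symbol_triples F)"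
  by (simp add: symbol_code_def symbol_triples_def enc_list_def enc_vec_arc ell_order_def comp_def)

lemma gluing_mat_eq:
  assumes "a \<in> ell_arcs F \<Longrightarrow> mu_ell F a \<in> {2, 3}"
  shows "gluing_mat F a = glue_mat (ell_order F a) a (star F a)"
  using assms by (auto simp: gluing_mat_def glue_mat_def ell_order_def ell_arcs_def)

abbreviation base_arc :: iarc where
  "base_arc \<equiv> ((1, 0), (0, 1))"

lemma vec_arc_base: "vec_arc (cusp_of 1 0, cusp_of 0 1) = base_arc"
proof -
  have "vec_arc (cusp_arc base_arc) = base_arc" by (rule vec_arc_cusp_arc)
    (simp add: arc_ok_def prim_def)
  then show ?thesis by (simp add: cusp_arc_def vec_cusp_def)
qed

lemma symbol_invariant:
  assumes F: "extended_farey_symbol F"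
  defines "mate \<equiv> \<lambda>l. vec_arc (star F (cusp_arc l))" and "mu \<equiv> \<lambda>l. ell_order F (cusp_arc l)"
    and "w \<equiv> map vec_arc (arcs F)"
  shows "labelled_pairing.invariant mate base_arc mu (symbol_group F) w fst snd"
    and "entries_of_triples (symbol_triples F) = labelled_pairing.state mate mu w fst snd"
proof -
  interpret labelled_pairing mate base_arc mu .
  show "entries_of_triples (symbol_triples F) = state w fst snd"
    unfolding state_def entries_of_triples_def symbol_triples_def w_def map_map
    by (simp add: comp_def mate_def mu_def)
  let ?V = "vertices F"
  have conv: "convex_ideal_polygon ?V" and base: "(cusp_of 1 0, cusp_of 0 1) \<in> set (arcs F)"
    and st: "\<And>a. a \<in> set (arcs F) \<Longrightarrow> star F a \<in> set (arcs F) \<and> star F (star F a) = a"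
    and ell: "\<And>a. a \<in> ell_arcs F \<Longrightarrow> mu_ell F a \<in> {2, 3}"
    and SL: "\<And>a. a \<in> set (arcs F) \<Longrightarrow> gluing_mat F a \<in> carrier SL2Z"
    using F by (auto simp: extended_farey_symbol_def)
  have V: "length ?V \<ge> 2" "distinct ?V" using conv by (auto simp: convex_ideal_polygon_def)
  have arcs: "arcs F = zip ?V (rotate1 ?V)" by (simp add: arcs_def polygon_sides_conv_zip)
  have dis: "distinct w"
    using V by (auto simp: w_def distinct_map arcs distinct_zipI1 inj_on_def)
  have lab: "labels_ok w"
    unfolding labels_ok_def
  proof (intro conjI)
    show "mate_closed w" unfolding mate_closed_def w_def using st by (auto simp: mate_def)
    show "2 \<le> length w" using V by (simp add: w_def arcs)
    show "base_arc \<in> set w" using base vec_arc_base unfolding w_def by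
      (metis image_eqI list.set_map)
    show "\<forall>l\<in>set w. if mate l = l then mu l \<in> {2, 3} else mu l = 0"
    proof
      fix l assume "l \<in> set w"
      then obtain a where a: "a \<in> set (arcs F)" "l = vec_arc a" by (auto simp: w_def)
      then have "mate l = l \<longleftrightarrow> a \<in> ell_arcs F" by (simp add: mate_def ell_arcs_def)
      then show "if mate l = l then mu l \<in> {2, 3} else mu l = 0"
        using ell[of a] a by (simp add: mu_def ell_order_def)
    qed
  qed (rule dis)
  have poly: "polygon w fst snd"
  proof -
    have "map fst w = map cusp_vec (map fst (arcs F))" by (simp add: w_def vec_arc_def)
    then have fs: "map fst w = map cusp_vec ?V" by (simp add: arcs)
    have "map snd w = map cusp_vec (map snd (arcs F))" by (simp add: w_def vec_arc_def)
    then have sn: "map snd w = map cusp_vec (rotate1 ?V)" by (simp add: arcs)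
    have "map vec_cusp (map cusp_vec ?V) = ?V" by (simp add: comp_def)
    moreover have d: "distinct (map cusp_vec ?V)"
      using V by (simp add: distinct_map inj_on_def) (metis vec_cusp_cusp_vec)
    ultimately have "ccw_list (map cusp_vec ?V)"
      using convex_ideal_polygon_iff[of "map cusp_vec ?V"] conv V by simp
    moreover have "map fst (rotate1 w) = map snd w"
      unfolding sn rotate1_map[symmetric] fs by (simp add: rotate1_map)
    moreover have "\<forall>l\<in>set w. prim (fst l)" by (auto simp: w_def vec_arc_def)
    ultimately show ?thesis unfolding polygon_def fs using d by blast
  qed
  have ok: "arc_ok l" if "l \<in> set w" for l
    using polygon_arc_ok[OF poly that _ dis] lab by (simp add: labels_ok_def)
  have "\<exists>M. glue (mu l) M l (mate l) \<and> gluing_mat F (cusp_arc l) = rat_mat M" if l: "l \<in> set w" for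
    l
  proof -
    obtain a where a: "a \<in> set (arcs F)" "l = vec_arc a" using l by (auto simp: w_def)
    have ml: "mate l \<in> set w" using l lab by (auto simp: labels_ok_def mate_closed_def)
    have eq: "gluing_mat F a = glue_mat (mu l) (cusp_arc l) (cusp_arc (mate l))"
      using gluing_mat_eq[OF ell, of a] a by (simp add: mu_def mate_def)
    have "glue_mat (mu l) (cusp_arc l) (cusp_arc (mate l)) \<in> carrier SL2Z"
      using SL[OF a(1)] eq by simp
    then obtain M where "glue (mu l) M l (mate l)"
      "glue_mat (mu l) (cusp_arc l) (cusp_arc (mate l)) = rat_mat M"
      using glue_mat_SL2Z[OF _ ok[OF l] ok[OF ml]] by blast
    then show ?thesis using eq a(2) by (metis cusp_arc_vec_arc)
  qed
  then obtain g where g: "\<And>l. l \<in> set w \<Longrightarrow> glue (mu l) (g l) l (mate l) \<and> gluing_mat F (cusp_arc l) =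
    rat_mat (g l)"
    by metis
  have "gluable w fst snd g"
    unfolding gluable_def
  proof (intro ballI conjI impI allI)
    fix l assume l: "l \<in> set w"
    have ml: "mate l \<in> set w" "mate (mate l) = l" using l lab by
      (auto simp: labels_ok_def mate_closed_def)
    show "glue (mu l) (g l) (fst l, snd l) (fst (mate l), snd (mate l))" using g[OF l] by simp
    fix v assume ne: "mate l \<noteq> l" and v: "prim v"
    have "mu l = 0" "mu (mate l) = 0" using lab l ml ne by (auto simp: labels_ok_def)
    then have gl: "act (g l) (snd (mate l)) = fst l" "act (g l) (fst (mate l)) = snd l"
      "mdet (g l) = 1"
      "act (g (mate l)) (snd l) = fst (mate l)" "act (g (mate l)) (fst l) = snd (mate l)"
        "mdet (g (mate l)) = 1"
      using g[OF l] g[OF ml(1)] ml(2) by (auto simp: glue_def)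
    \<comment> \<open>The product glues the side to its own reversal, as the identity does, so by
      uniqueness it is plus or minus the identity.\<close>
    have "glue 0 (mmul (g l) (g (mate l))) l (snd l, fst l)"
      using gl by (simp add: glue_def act_mmul)
    moreover have "glue 0 (1, 0, 0, 1) l (snd l, fst l)"
    proof -
      have "act (1, 0, 0, 1) u = u" if "prim u" for u using nrm_prim[OF that] by (cases u)
        (simp add: act_def)
      then show ?thesis using ok[OF l] by (simp add: glue_def arc_ok_def)
    qed
    moreover have "arc_ok (snd l, fst l)" using ok[OF l] by (auto simp: arc_ok_def)
    ultimately have "mmul (g l) (g (mate l)) = (1, 0, 0, 1) \<or> mmul (g l) (g (mate l)) = -
      (1, 0, 0, 1)"
      using ok[OF l] by (intro glue_unique)
    then have "act (mmul (g l) (g (mate l))) = act (1, 0, 0, 1)"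
      by (elim disjE; simp only: act_uminus)
    then show "act (g l) (act (g (mate l)) v) = v"
      using nrm_prim[OF v] by (cases v) (simp add: act_mmul[symmetric], simp add: act_def)
  qed
  then have "good w fst snd g" using lab poly by (simp add: good_def)
  moreover have "psl_gen (g ` set w) = symbol_group F"
  proof -
    have "psl (g (vec_arc a)) = PSL_class (gluing_mat F a)" if "a \<in> set (arcs F)" for a
      using g[of "vec_arc a"] that by (simp add: psl_def w_def)
    then have "psl ` g ` set w = (\<lambda>a. PSL_class (gluing_mat F a)) ` set (arcs F)"
      by (simp add: w_def image_image)
    then show ?thesis by (simp add: psl_gen_def symbol_group_def)
  qed
  ultimately show "invariant (symbol_group F) w fst snd"
    unfolding invariant_def by (intro exI[of _ g]) simp
qed

context labelled_pairing
begin

lemma symbol_of_invariant: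
  assumes inv: "invariant G w st en" and bl: "blocks w"
  obtains F where "extended_farey_symbol F" "normalized F" "symbol_group F = G"
    "symbol_triples F = triples_of_entries (state w st en)"
proof -
  obtain g where good: "good w st en g" and G: "psl_gen (g ` set w) = G" and bs: "st base = (1, 0)"
    "en base = (0, 1)"
    using inv by (auto simp: invariant_def)
  have lab: "distinct w" "mate_closed w" "2 \<le> length w" "base \<in> set w"
    and mu: "\<And>l. l \<in> set w \<Longrightarrow> if mate l = l then mu l \<in> {2, 3} else mu l = 0"
    using good by (auto simp: good_def labels_ok_def)
  have poly: "polygon w st en" and gl: "\<And>l. l \<in> set w \<Longrightarrow> glue (mu l) (g l) (st l, en l)
    (st (mate l), en (mate l))"
    using good by (auto simp: good_def gluable_def)
  have ml: "mate l \<in> set w" "mate (mate l) = l" if "l \<in> set w" for l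
    using lab(2) that by (auto simp: mate_closed_def)
  define h where "h l = cusp_arc (st l, en l)" for l
  have ok: "arc_ok (st l, en l)" if "l \<in> set w" for l by (rule good_arc_ok[OF good that])
  have vh: "vec_arc (h l) = (st l, en l)" if "l \<in> set w" for l
    unfolding h_def by (rule vec_arc_cusp_arc[OF ok[OF that]])
  have inj: "inj_on h (set w)"
  proof (rule inj_onI)
    fix x y assume xy: "x \<in> set w" "y \<in> set w" "h x = h y"
    then have "st x = st y" using vh[OF xy(1)] vh[OF xy(2)] by simp
    then show "x = y" using polygonD(2)[OF poly] xy by (simp add: distinct_map inj_on_def)
  qed
  \<comment> \<open>The pairing of a symbol is a function of sides, so letters are recovered from
    the sides they now denote. Values off the boundary are irrelevant.\<close>
  define ix where "ix = inv_into (set w) h"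
  have ix: "ix (h l) = l" if "l \<in> set w" for l unfolding ix_def using inj that by
    (rule inv_into_f_f)
  define F where "F = \<lparr>vertices = map (vec_cusp \<circ> st) w, star = (\<lambda>a. h (mate (ix a))), mu_ell =
    (\<lambda>a. mu (ix a))\<rparr>"
  have arcs: "arcs F = map h w"
  proof -
    have "rotate1 (map (vec_cusp \<circ> st) w) = map vec_cusp (map st (rotate1 w))" by
      (simp add: rotate1_map)
    also have "\<dots> = map (vec_cusp \<circ> en) w" unfolding polygonD(4)[OF poly] by simp
    finally have "arcs F = zip (map (vec_cusp \<circ> st) w) (map (vec_cusp \<circ> en) w)"
      by (simp add: arcs_def F_def polygon_sides_conv_zip)
    also have "\<dots> = map h w"
      by (simp add: h_def[abs_def] cusp_arc_def comp_def zip_map_map) (simp add: zip_same_conv_map)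
    finally show ?thesis .
  qed
  have star: "star F (h l) = h (mate l)" and muF: "mu_ell F (h l) = mu l" if "l \<in> set w" for l
    using ix[OF that] by (simp_all add: F_def)
  have ell: "h l \<in> ell_arcs F \<longleftrightarrow> mate l = l" if "l \<in> set w" for l
    using that star[OF that] inj ml[OF that] by (auto simp: ell_arcs_def arcs inj_on_def)
  have ord: "ell_order F (h l) = mu l" if "l \<in> set w" for l
    using ell[OF that] muF[OF that] mu[OF that] by (simp add: ell_order_def)
  have muok: "mu_ell F a \<in> {2, 3}" if "a \<in> ell_arcs F" for a
  proof -
    obtain l where l: "l \<in> set w" "a = h l" using \<open>a \<in> ell_arcs F\<close> by (auto simp: ell_arcs_def arcs)
    then show ?thesis using \<open>a \<in> ell_arcs F\<close> ell[OF l(1)] muF[OF l(1)] mu[OF l(1)] by auto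
  qed
  have glm: "gluing_mat F (h l) = rat_mat (g l) \<or> gluing_mat F (h l) = rat_mat (- g l)" if l:
    "l \<in> set w" for l
    using glue_mat_eq[OF gl[OF l] ok[OF l] ok[OF ml(1)[OF l]]] gluing_mat_eq[OF muok, of "h l"]
    unfolding ord[OF l] star[OF l] by (simp add: h_def)
  have "extended_farey_symbol F"
    unfolding extended_farey_symbol_def
  proof (intro conjI)
    have "convex_ideal_polygon (map vec_cusp (map st w))"
      using convex_ideal_polygon_iff[of "map st w"] polygonD[OF poly] lab(3) by simp
    then show "convex_ideal_polygon (vertices F)" by (simp add: F_def)
    have "h base = (cusp_of 1 0, cusp_of 0 1)" by (simp add: h_def cusp_arc_def bs vec_cusp_def)
    then show "(cusp_of 1 0, cusp_of 0 1) \<in> set (arcs F)" using lab(4) unfolding arcs by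
      (metis image_eqI list.set_map)
    show "\<forall>a\<in>set (arcs F). star F a \<in> set (arcs F) \<and> star F (star F a) = a"
      using star ml by (auto simp: arcs)
    show "\<forall>a\<in>ell_arcs F. mu_ell F a \<in> {2, 3}" using muok by blast
    show "\<forall>a\<in>set (arcs F). gluing_mat F a \<in> carrier SL2Z"
    proof
      fix a assume "a \<in> set (arcs F)"
      then obtain l where l: "l \<in> set w" "a = h l" by (auto simp: arcs)
      then show "gluing_mat F a \<in> carrier SL2Z"
        using glm[OF l(1)] good_mdet[OF good l(1)] by (metis mdet_uminus rat_mat_in_SL2Z)
    qed
  qed
  moreover have "normalized F"
    by (rule normalized_if_blocks[OF arcs inj lab(1,2) bl star])
  moreover have "symbol_group F = G"
  proof -
    have "PSL_class (gluing_mat F (h l)) = psl (g l)" if "l \<in> set w" for l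
      using glm[OF that] psl_uminus[of "g l"] unfolding psl_def by metis
    then have "(\<lambda>a. PSL_class (gluing_mat F a)) ` set (arcs F) = psl ` g ` set w"
      by (simp add: arcs image_image)
    then show ?thesis using G by (simp add: psl_gen_def symbol_group_def)
  qed
  moreover have "symbol_triples F = triples_of_entries (state w st en)"
  proof -
    have "symbol_triples F = map (\<lambda>l. ((st l, en l), (st (mate l), en (mate l)), mu l)) w"
      using vh star ord ml by (auto simp: symbol_triples_def arcs)
    also have "\<dots> = map (\<lambda>l. ((st l, en l), lookup (mate l) (state w st en), mu l)) w"
      using lookup_state ml by (intro map_cong) auto
    also have "\<dots> = triples_of_entries (state w st en)"
      unfolding triples_of_entries_def state_def map_map by (simp add: comp_def)
    finally show ?thesis .
  qed
  ultimately show ?thesis by (rule that)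
qed

end

theorem mainTheorem1:
  shows "\<exists>alg. partial_recursive alg \<and>
    (\<forall>F. extended_farey_symbol F \<longrightarrow>
      (\<exists>Fnorm. alg (symbol_code F) = Some (symbol_code Fnorm) \<and>
         extended_farey_symbol Fnorm \<and> normalized Fnorm \<and>
         symbol_group Fnorm = symbol_group F))"
proof -
  \<comment> \<open>A witness \<open>y\<close> consists of a number of \<open>chop\<close> steps and
    a list of moves. The run sees only the list of triples, never the symbol.\<close>
  define run where "run x y = run_moves base_arc (snd y) (entries_of_triples x)"
    for x and y :: "nat \<times> (nat \<times> imat) list"
  define P where "P x y \<longleftrightarrow> (chop ^^ fst y) (run x y) = []" for x y
  have crun: "computable (\<lambda>p. run (fst p) (snd p))"
    unfolding run_def by (intro computable_run_moves computable_entries_of_triples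
      computable_intros)
  have "computable (\<lambda>p. P (fst p) (snd p))"
    unfolding P_def by (intro computable_eq computable_chop_funpow crun computable_intros)
  moreover have "computable (\<lambda>p. triples_of_entries (run (fst p) (snd p)))"
    by (intro computable_triples_of_entries crun)
  moreover have "surj (enc :: nat \<times> (nat \<times> imat) list \<Rightarrow> nat)"
    by (intro surj_enc_prod surj_enc_list surj_enc_nat surj_enc_int)
  ultimately obtain alg where alg: "partial_recursive alg"
    "\<And>x. \<exists>y. P x y \<Longrightarrow> \<exists>y. P x y \<and> alg (enc x) = Some (enc (triples_of_entries (run x y)))"
    using partial_recursive_search[of P "\<lambda>x y. triples_of_entries (run x y)"] by blast
  have "\<exists>Fnorm. alg (symbol_code F) = Some (symbol_code Fnorm) \<and> extended_farey_symbol Fnorm \<and>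
      normalized Fnorm \<and> symbol_group Fnorm = symbol_group F" if F: "extended_farey_symbol F" for F
  proof -
    define mate where "mate = (\<lambda>l. vec_arc (star F (cusp_arc l)))"
    define mu where "mu = (\<lambda>l. ell_order F (cusp_arc l))"
    define w where "w = map vec_arc (arcs F)"
    interpret labelled_pairing mate base_arc mu .
    have inv: "invariant (symbol_group F) w fst snd" and st:
      "entries_of_triples (symbol_triples F) = state w fst snd"
      using symbol_invariant[OF F] unfolding mate_def mu_def w_def by blast+
    have "mate_closed w" "distinct w" "base_arc \<in> set w"
      using inv by (auto simp: invariant_def good_def labels_ok_def)
    then obtain v where v: "reach w v" "blocks v" using reach_normal_form by blast
    obtain ms st' en' where ms: "run_moves base_arc ms (state w fst snd) = state v st' en'"
      "invariant (symbol_group F) v st' en'" using run_moves_complete[OF v(1) inv] by blast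
    have "distinct v" using ms(2) by (auto simp: invariant_def good_def labels_ok_def)
    then obtain k where "(chop ^^ k) (state v st' en') = []" using chop_complete[OF v(2)] by blast
    then have "P (symbol_triples F) (k, ms)" by (simp add: P_def run_def st ms)
    then obtain y where y: "P (symbol_triples F) y"
      "alg (enc (symbol_triples F)) = Some (enc (triples_of_entries (run (symbol_triples F) y)))"
      using alg(2) by blast
    \<comment> \<open>The search may stop at a witness other than \<open>(k, ms)\<close>, so
      soundness is applied to the witness \<open>y\<close> that it actually found.\<close>
    obtain u st2 en2 where u: "run (symbol_triples F) y = state u st2 en2"
      "invariant (symbol_group F) u st2 en2"
      using run_moves_sound[OF inv, of "snd y"] by (metis run_def st)
    have "blocks u" using y(1) chop_sound[of "fst y" u st2 en2] by (simp add: P_def u)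
    then obtain Fnorm where "extended_farey_symbol Fnorm" "normalized Fnorm"
      "symbol_group Fnorm = symbol_group F"
      "symbol_triples Fnorm = triples_of_entries (state u st2 en2)"
      using symbol_of_invariant[OF u(2)] by blast
    then show ?thesis using y(2) u(1) by (intro exI[of _ Fnorm]) (simp add: symbol_code_eq)
  qed
  then show ?thesis using alg(1) by blast
qed

end
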